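(* Let $z_0=\begin{pmatrix}u_0\\ \rho_0\end{pmatrix}\in H^s\times H^{s-1}$, $s>\frac52$, let $m_0=u_0-u_0''$, and let $T$ be the maximal existence time of the solution $z=\begin{pmatrix}u\\ \rho\end{pmatrix}$ to the two-component b-family equation with initial data $z_0$. If $1<k_1\le3$, $k_2\ge0$, $m_0$ is odd, $\rho_0$ is even, $\rho_0(0)=0$, and $\int_0^{+\infty}e^{-y}m_0(y)\,dy\ge0$, then $T$ is finite.
   Context: All function spaces are over $\mathbb{R}$; $H^r=H^r(\mathbb{R})$. The real constants $k_1,k_2,k_3$ are given, for some $b\in\mathbb{R}$, by one of two cases: (i) $k_1=b,\ k_2=2b,\ k_3=1$; or (ii) $k_1=b+1,\ k_2=2,\ k_3=b$. The two-component b-family equation is $$m_t=um_x+k_1u_xm+k_2\rho\rho_x,\qquad \rho_t=k_3(u\rho)_x,\qquad m=u-u_{xx},\quad t>0,\ x\in\mathbb{R},$$ with $u(0,\cdot)=u_0$, $\rho(0,\cdot)=\rho_0$; it is understood in the equivalent form $$u_t-uu_x=\partial_x(1-\partial_x^2)^{-1}\left(\tfrac{k_1}{2}u^2+\tfrac{3-k_1}{2}u_x^2+\tfrac{k_2}{2}\rho^2\right),\qquad \rho_t-k_3u\rho_x=k_3u_x\rho.$$ For $z_0\in H^s\times H^{s-1}$, $s\ge2$, there is a unique maximal solution $z\in C([0,T);H^s\times H^{s-1})\cap C^1([0,T);H^{s-1}\times H^{s-2})$; $T$ is its maximal existence time.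
   Formalization: The formal theorem additionally assumes that the initial data z_0 = (u_0, ρ_0) is not identically zero; for z_0 = 0 all stated hypotheses hold but the zero solution is global, so T is infinite. *)

theory Defs
  imports "HOL-Analysis.Analysis"
begin

section \<open>Sobolev spaces on the real line\<close>

text \<open>
  The Fourier transform of a square-integrable function is the \<open>L\<^sup>2\<close>-limit of the truncated
  integrals (Plancherel). It is determined up to a null set; \<open>SOME\<close> picks a representative.
  The nonnegative integral is used because it cannot hide a failure of integrability.
\<close>
definition fourier :: "(real \<Rightarrow> real) \<Rightarrow> real \<Rightarrow> complex" where
  "fourier f = (SOME g. g \<in> borel_measurable lborel \<and>
     ((\<lambda>R. \<integral>\<^sup>+\<xi>. ennreal ((cmod (g \<xi> -
          (LBINT x:{-R..R}. complex_of_real (f x) * cis (- (x * \<xi>)))))\<^sup>2) \<partial>lborel)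
        \<longlongrightarrow> 0) at_top)"

definition sobolev_norm :: "real \<Rightarrow> (real \<Rightarrow> real) \<Rightarrow> real" where
  "sobolev_norm r f = sqrt (LBINT \<xi>. (1 + \<xi>\<^sup>2) powr r * (cmod (fourier f \<xi>))\<^sup>2)"

text \<open>
  \<open>H\<^sup>r\<close> for \<open>r \<ge> 0\<close>, as a set of functions rather than of classes modulo null sets.
\<close>
definition sobolev :: "real \<Rightarrow> (real \<Rightarrow> real) set" where
  "sobolev r = {f. f \<in> borel_measurable lborel \<and> integrable lborel (\<lambda>x. (f x)\<^sup>2) \<and>
     integrable lborel (\<lambda>\<xi>. (1 + \<xi>\<^sup>2) powr r * (cmod (fourier f \<xi>))\<^sup>2)}"

text \<open>
  For \<open>r > 1/2\<close> every class in \<open>H\<^sup>r\<close> has exactly one continuous representative, with which it is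
  identified as usual. For \<open>r > 3/2\<close> and \<open>r > 5/2\<close> this representative is \<open>C\<^sup>1\<close> and
  \<open>C\<^sup>2\<close> respectively, so that \<^const>\<open>deriv\<close> computes its derivatives.
\<close>
definition sobolev_cont :: "real \<Rightarrow> (real \<Rightarrow> real) set" where
  "sobolev_cont r = {f \<in> sobolev r. continuous_on UNIV f}"

section \<open>The operator \<open>1 - \<partial>\<^sub>x\<^sup>2\<close> and its inverse\<close>

definition helmholtz :: "(real \<Rightarrow> real) \<Rightarrow> real \<Rightarrow> real" where
  "helmholtz f x = f x - deriv (deriv f) x"

text \<open>
  The inverse is only applied to continuous square-integrable functions, whose preimage
  in \<open>H\<^sup>2\<close> is classically twice differentiable.
\<close>
definition inv_helmholtz :: "(real \<Rightarrow> real) \<Rightarrow> real \<Rightarrow> real" where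
  "inv_helmholtz = the_inv_into
     {w \<in> sobolev_cont 2. \<forall>x. w differentiable (at x) \<and> deriv w differentiable (at x)} helmholtz"

section \<open>Curves in Sobolev spaces\<close>

definition curve_cont :: "real \<Rightarrow> real set \<Rightarrow> (real \<Rightarrow> real \<Rightarrow> real) \<Rightarrow> bool" where
  "curve_cont r J v \<longleftrightarrow> (\<forall>t\<in>J. v t \<in> sobolev_cont r \<and>
     ((\<lambda>\<tau>. sobolev_norm r (\<lambda>x. v \<tau> x - v t x)) \<longlongrightarrow> 0) (at t within J))"

text \<open>\<open>v \<in> C\<^sup>1(J; H\<^sup>r)\<close> with derivative \<open>v'\<close>.\<close>
definition curve_C1 ::
  "real \<Rightarrow> real set \<Rightarrow> (real \<Rightarrow> real \<Rightarrow> real) \<Rightarrow> (real \<Rightarrow> real \<Rightarrow> real) \<Rightarrow> bool" where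
  "curve_C1 r J v v' \<longleftrightarrow> curve_cont r J v \<and> curve_cont r J v' \<and>
     (\<forall>t\<in>J. ((\<lambda>\<tau>. sobolev_norm r (\<lambda>x. (v \<tau> x - v t x) / (\<tau> - t) - v' t x)) \<longlongrightarrow> 0) (at t within J))"

section \<open>The two-component b-family equation\<close>

definition time_interval :: "ereal \<Rightarrow> real set" where
  "time_interval T = {t. 0 \<le> t \<and> ereal t < T}"

text \<open>
  Solutions on \<open>[0,T)\<close>, \<open>0 < T \<le> \<infinity>\<close>, for \<open>s > 5/2\<close>: all Sobolev orders that occur then
  exceed \<open>1/2\<close>, and both equations hold pointwise between continuous functions.
\<close>
definition b_family_solution ::
  "real \<Rightarrow> real \<Rightarrow> real \<Rightarrow> real \<Rightarrow> (real \<Rightarrow> real) \<Rightarrow> (real \<Rightarrow> real) \<Rightarrow> ereal \<Rightarrow>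
   (real \<Rightarrow> real \<Rightarrow> real) \<Rightarrow> (real \<Rightarrow> real \<Rightarrow> real) \<Rightarrow> bool" where
  "b_family_solution k1 k2 k3 s u0 \<rho>0 T u \<rho> \<longleftrightarrow>
     0 < T \<and> u 0 = u0 \<and> \<rho> 0 = \<rho>0 \<and>
     curve_cont s (time_interval T) u \<and> curve_cont (s - 1) (time_interval T) \<rho> \<and>
     (\<exists>ut \<rho>t. curve_C1 (s - 1) (time_interval T) u ut \<and> curve_C1 (s - 2) (time_interval T) \<rho> \<rho>t \<and>
       (\<forall>t\<in>time_interval T. \<forall>x.
          ut t x - u t x * deriv (u t) x =
            deriv (inv_helmholtz (\<lambda>y. k1 / 2 * (u t y)\<^sup>2 + (3 - k1) / 2 * (deriv (u t) y)\<^sup>2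
                                        + k2 / 2 * (\<rho> t y)\<^sup>2)) x \<and>
          \<rho>t t x - k3 * u t x * deriv (\<rho> t) x = k3 * deriv (u t) x * \<rho> t x))"

text \<open>A solution is maximal, and \<open>T\<close> its maximal existence time, if it has no proper extension.\<close>
definition b_family_maximal_solution ::
  "real \<Rightarrow> real \<Rightarrow> real \<Rightarrow> real \<Rightarrow> (real \<Rightarrow> real) \<Rightarrow> (real \<Rightarrow> real) \<Rightarrow> ereal \<Rightarrow>
   (real \<Rightarrow> real \<Rightarrow> real) \<Rightarrow> (real \<Rightarrow> real \<Rightarrow> real) \<Rightarrow> bool" where
  "b_family_maximal_solution k1 k2 k3 s u0 \<rho>0 T u \<rho> \<longleftrightarrow>
     b_family_solution k1 k2 k3 s u0 \<rho>0 T u \<rho> \<and>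
     \<not> (\<exists>T' u' \<rho>'. T < T' \<and> b_family_solution k1 k2 k3 s u0 \<rho>0 T' u' \<rho>' \<and>
          (\<forall>t\<in>time_interval T. u' t = u t \<and> \<rho>' t = \<rho> t))"

end

theory Submission
  imports Defs "HOL-Probability.Sinc_Integral"
begin

text \<open>
  Suppose that \<open>T = \<infinity>\<close>. The whole contradiction comes from one scalar function, the slope
  \<open>a(t) = u\<^sub>x(t,0)\<close> at the origin. Differentiating the equation for \<open>u\<close> in \<open>x\<close> and using
  \<open>\<partial>\<^sub>x\<^sup>2 (1 - \<partial>\<^sub>x\<^sup>2)\<^sup>-\<^sup>1 F = (1 - \<partial>\<^sub>x\<^sup>2)\<^sup>-\<^sup>1 F - F\<close> gives
  \<open>u\<^sub>t\<^sub>x = u\<^sub>x\<^sup>2 + u u\<^sub>x\<^sub>x + W - F\<close>, where \<open>F\<close> is the quadratic source and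
  \<open>W = (1 - \<partial>\<^sub>x\<^sup>2)\<^sup>-\<^sup>1 F\<close> is its convolution with \<open>exp (-\<bar>x\<bar>) / 2\<close>.
  If \<open>u(t,\<cdot>)\<close> is odd and \<open>\<rho>(t,0) = 0\<close>, this reads at \<open>x = 0\<close>

    \<open>a' = (k1 - 1)/2 a\<^sup>2 + W(t,0)\<close>.

  For \<open>1 < k1 \<le> 3\<close> and \<open>k2 > 0\<close> the source is nonnegative, hence so is \<open>W\<close>, and \<open>W(0,0) > 0\<close>
  because the data do not vanish identically. The integral hypothesis says exactly that
  \<open>a(0) \<ge> 0\<close> (lemma \<open>helmholtz_laplace_at_0\<close>). So \<open>a\<close> becomes positive and then
  blows up in finite time (lemma \<open>riccati_no_global_solution\<close>), although it is finite for all \<open>t\<close>.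

  Two things remain: the symmetry of the solution at later times, and the passage from Sobolev
  regularity to classical calculus.

  Symmetry is a uniqueness statement. The functions \<open>v = u(x) + u(-x)\<close>, \<open>v\<^sub>x\<close> and
  \<open>\<sigma> = \<rho>(x) - \<rho>(-x)\<close> vanish at time \<open>0\<close> and satisfy a linear system with bounded coefficients,
  apart from transport terms \<open>u v\<^sub>x\<^sub>x\<close> and \<open>k3 u \<sigma>\<^sub>x\<close> that would cost a derivative. Instead of
  energy estimates or characteristics, the proof compares their moduli with the barrier
  \<open>\<epsilon> exp ((C + 1) t)\<close>: all three functions decay in \<open>x\<close>, so at the first time at which the barrier
  is reached it is touched at an extremum, where the transport terms vanish
  (lemmas \<open>barrier_zero\<close> and \<open>symmetry\<close>). The nonlocal term is controlled in the supremum
  norm by the maximum principle for \<open>w - w''\<close> (lemma \<open>helmholtz_max_principle\<close>).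

  The regularity facts needed are the embeddings of \<open>H\<^sup>r\<close> into spaces of continuously differentiable
  functions, with bounds by the Sobolev norm, and the identification of \<^const>\<open>inv_helmholtz\<close> with
  the convolution above. Both rest on the Fourier transform in \<open>L\<^sup>2\<close>, which is built here
  from a Plancherel inequality, damping all integrals by \<open>exp (-\<epsilon> \<bar>\<xi>\<bar>)\<close>; the factor turns into the
  Poisson kernel on the other side (lemmas \<open>plancherel_bound\<close>, \<open>fourier_spec\<close>,
  \<open>fourier_inversion\<close>).
\<close>

section \<open>The Fourier integral\<close>

text \<open>
  The transform as an absolutely convergent integral. It agrees with \<^const>\<open>fourier\<close> on integrable
  functions that are also square-integrable; evaluated at \<open>- x\<close> it also serves as the inverse transform,
  up to the factor \<open>2 * pi\<close>.
\<close>
definition ft :: "(real \<Rightarrow> complex) \<Rightarrow> real \<Rightarrow> complex" where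
  "ft f \<xi> = (LBINT x. f x * cis (- (x * \<xi>)))"

definition L2 :: "(real \<Rightarrow> complex) \<Rightarrow> bool" where
  "L2 f \<longleftrightarrow> f \<in> borel_measurable lborel \<and> integrable lborel (\<lambda>x. (cmod (f x))\<^sup>2)"

lemma measurable_cis [measurable]: "cis \<in> borel_measurable borel"
  by (intro borel_measurable_continuous_onI continuous_intros)

lemma integrable_cis_mult:
  assumes "integrable lborel f"
  shows "integrable lborel (\<lambda>x. f x * cis (c * x))" "integrable lborel (\<lambda>x. f x * cis (- (x * c)))"
proof -
  have [measurable]: "f \<in> borel_measurable lborel" using assms by simp
  show "integrable lborel (\<lambda>x. f x * cis (c * x))" "integrable lborel (\<lambda>x. f x * cis (- (x * c)))"
    by (rule Bochner_Integration.integrable_bound[OF assms]; simp add: norm_mult)+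
qed

lemma ft_bound:
  assumes "integrable lborel f"
  shows "cmod (ft f \<xi>) \<le> (LBINT x. cmod (f x))"
proof -
  have "cmod (ft f \<xi>) \<le> (LBINT x. cmod (f x * cis (- (x * \<xi>))))"
    unfolding ft_def by (rule integral_norm_bound)
  then show ?thesis by (simp add: norm_mult)
qed

lemma ft_measurable:
  assumes "f \<in> borel_measurable lborel"
  shows "ft f \<in> borel_measurable lborel"
proof -
  have [measurable]: "f \<in> borel_measurable borel" using assms by simp
  show ?thesis unfolding ft_def[abs_def]
    by measurable
qed

lemma ft_linear:
  assumes "integrable lborel f" "integrable lborel g"
  shows "ft (\<lambda>x. a * f x + b * g x) \<xi> = a * ft f \<xi> + b * ft g \<xi>"
proof -
  have "ft (\<lambda>x. a * f x + b * g x) \<xi> =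
      (LBINT x. a * (f x * cis (- (x * \<xi>))) + b * (g x * cis (- (x * \<xi>))))"
    unfolding ft_def by (simp add: algebra_simps)
  also have "\<dots> = a * ft f \<xi> + b * ft g \<xi>"
    unfolding ft_def using integrable_cis_mult(2)[OF assms(1), of \<xi>] integrable_cis_mult(2)[OF assms(2), of \<xi>] by simp
  finally show ?thesis .
qed

lemma ft_diff:
  assumes "integrable lborel f" "integrable lborel g"
  shows "ft (\<lambda>x. f x - g x) \<xi> = ft f \<xi> - ft g \<xi>"
  using ft_linear[OF assms, of 1 "-1"] by simp

lemma exp_half_line:
  fixes a \<xi> :: real
  assumes "a > 0"
  shows "set_integrable lborel {0..} (\<lambda>x. complex_of_real (exp (- (a * x))) * cis (- (x * \<xi>)))"
    and "(LBINT x:{0..}. complex_of_real (exp (- (a * x))) * cis (- (x * \<xi>))) = 1 / Complex a \<xi>"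
proof -
  let ?f = "\<lambda>x. complex_of_real (exp (- (a * x))) * cis (- (x * \<xi>))"
  have "set_integrable lborel {0<..} (\<lambda>x. exp (-(x * a)))"
    by (rule integrable_I0i_exp_mscale[OF assms])
  then have "integrable lborel (\<lambda>x. indicator {0<..} x *\<^sub>R exp (-(x * a)))"
    by (simp add: set_integrable_def)
  moreover have "integrable lborel (\<lambda>x. indicator {0<..} x *\<^sub>R exp (-(x * a))) =
     integrable lborel (\<lambda>x. indicator {0..} x *\<^sub>R exp (-(x * a)))"
  proof (rule integrable_cong_AE)
    show "AE x in lborel. indicator {0<..} x *\<^sub>R exp (-(x * a)) = indicator {0..} x *\<^sub>R exp (-(x * a))"
      using AE_lborel_singleton[of "0::real"] by eventually_elim (auto simp: indicator_def)
  qed auto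
  ultimately have i: "integrable lborel (\<lambda>x. indicator {0..} x *\<^sub>R exp (-(x * a)))" by simp
  show int: "set_integrable lborel {0..} ?f"
    unfolding set_integrable_def
    by (rule Bochner_Integration.integrable_bound[OF i]) (auto simp: norm_mult indicator_def mult.commute)
  have eq: "?f x = exp (- (of_real x * Complex a \<xi>))" for x
    by (simp add: complex_eq_iff Re_exp Im_exp mult.commute)
  have nz: "Complex a \<xi> \<noteq> 0" using assms by (auto simp: complex_eq_iff)
  let ?F = "\<lambda>x::real. - exp (- (of_real x * Complex a \<xi>)) / Complex a \<xi>"
  have FTC: "(LBINT x:{0..b}. ?f x) = ?F b - ?F 0" if "b \<ge> 0" for b
    unfolding set_lebesgue_integral_def
  proof (rule integral_FTC_Icc[OF that])
    show "(?F has_vector_derivative ?f x) (at x within {0..b})" for x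
      unfolding eq using nz
      by (auto intro!: derivative_eq_intros has_vector_derivative_real_field simp: field_simps)
    show "continuous_on {0..b} ?f" by (intro continuous_intros)
  qed
  have "((\<lambda>b. LBINT x:{0..b}. ?f x) \<longlongrightarrow> (LBINT x:{0..}. ?f x)) at_top"
    by (rule tendsto_set_lebesgue_integral_at_top[OF _ int]) auto
  moreover have "((\<lambda>b. LBINT x:{0..b}. ?f x) \<longlongrightarrow> 1 / Complex a \<xi>) at_top"
  proof -
    have "((\<lambda>b. cmod (?f b)) \<longlongrightarrow> 0) at_top"
    proof -
      have "filterlim (\<lambda>b. a * b) at_top at_top"
        by (rule filterlim_tendsto_pos_mult_at_top[OF tendsto_const assms filterlim_ident])
      then have "((\<lambda>b. exp (- (a * b))) \<longlongrightarrow> 0) at_top"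
        by (intro filterlim_compose[OF exp_at_bot]) (simp add: filterlim_uminus_at_bot)
      then show ?thesis by (simp add: norm_mult)
    qed
    then have "(?f \<longlongrightarrow> 0) at_top" by (rule tendsto_norm_zero_cancel)
    then have "((\<lambda>b. - ?f b / Complex a \<xi> - ?F 0) \<longlongrightarrow> - 0 / Complex a \<xi> - ?F 0) at_top"
      using nz by (intro tendsto_intros) auto
    then have "((\<lambda>b. ?F b - ?F 0) \<longlongrightarrow> 1 / Complex a \<xi>) at_top"
      unfolding eq by simp
    then show ?thesis
      by (rule Lim_transform_eventually)
         (rule eventually_mono[OF eventually_ge_at_top[of 0]], simp only: FTC)
  qed
  ultimately show "(LBINT x:{0..}. ?f x) = 1 / Complex a \<xi>"
    using tendsto_unique trivial_limit_at_top_linorder by blast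
qed

text \<open>
  This explicit pair is used twice: with small \<open>a\<close> it turns exponential damping of a transform into the
  Poisson kernel, and with \<open>a = 1\<close> it shows that convolution with \<open>exp (- \<bar>x\<bar>) / 2\<close> inverts
  \<open>1 + \<xi>\<^sup>2\<close>.
\<close>
lemma exp_abs_ft:
  fixes a :: real
  assumes "a > 0"
  shows "integrable lborel (\<lambda>x. complex_of_real (exp (- (a * \<bar>x\<bar>))))"
    and "ft (\<lambda>x. complex_of_real (exp (- (a * \<bar>x\<bar>)))) \<xi> = complex_of_real (2 * a / (a\<^sup>2 + \<xi>\<^sup>2))"
proof -
  let ?f = "\<lambda>\<xi> x. complex_of_real (exp (- (a * x))) * cis (- (x * \<xi>))"
  let ?g = "\<lambda>\<xi> x. complex_of_real (exp (- (a * \<bar>x\<bar>))) * cis (- (x * \<xi>))"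
  define h where "h \<xi> x = indicator {0..} x *\<^sub>R ?f \<xi> x" for \<xi> x
  have hi: "integrable lborel (h \<xi>)" and hI: "(LBINT x. h \<xi> x) = 1 / Complex a \<xi>" for \<xi>
    using exp_half_line[OF assms, of \<xi>] by (simp_all add: h_def[abs_def] set_integrable_def set_lebesgue_integral_def)
  have hi2: "integrable lborel (\<lambda>x. h \<xi> (- x))" and hI2: "(LBINT x. h \<xi> (-x)) = 1 / Complex a \<xi>" for \<xi>
    using lborel_integrable_real_affine[OF hi, of "-1" \<xi> 0] lborel_integral_real_affine[of "-1" "h \<xi>" 0] hI[of \<xi>] by simp_all
  have [measurable]: "h \<xi> \<in> borel_measurable borel" for \<xi> using hi[of \<xi>] by auto
  have AE: "AE x in lborel. h \<xi> x + h (- \<xi>) (- x) = ?g \<xi> x" for \<xi>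
    using AE_lborel_singleton[of "0::real"] by eventually_elim (auto simp: h_def indicator_def)
  have gi: "integrable lborel (?g \<xi>)" and gI: "(LBINT x. ?g \<xi> x) = 1 / Complex a \<xi> + 1 / Complex a (- \<xi>)" for \<xi>
  proof -
    have *: "integrable lborel (\<lambda>x. h \<xi> x + h (- \<xi>) (- x))" using hi hi2 by auto
    then show "integrable lborel (?g \<xi>)"
      using integrable_cong_AE[THEN iffD1, OF _ _ AE *] by auto
    have "(LBINT x. ?g \<xi> x) = (LBINT x. h \<xi> x + h (- \<xi>) (- x))"
      using AE by (intro integral_cong_AE) (auto simp: eq_commute)
    then show "(LBINT x. ?g \<xi> x) = 1 / Complex a \<xi> + 1 / Complex a (- \<xi>)"
      using hi hi2 hI hI2 by simp
  qed
  show "integrable lborel (\<lambda>x. complex_of_real (exp (- (a * \<bar>x\<bar>))))" using gi[of 0] by simp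
  have "1 / Complex a \<xi> + 1 / Complex a (- \<xi>) = complex_of_real (2 * a / (a\<^sup>2 + \<xi>\<^sup>2))"
    using assms by (simp add: complex_eq_iff Re_divide Im_divide power2_eq_square add_divide_distrib[symmetric])
  then show "ft (\<lambda>x. complex_of_real (exp (- (a * \<bar>x\<bar>)))) \<xi> = complex_of_real (2 * a / (a\<^sup>2 + \<xi>\<^sup>2))"
    unfolding ft_def gI by simp
qed

lemma lorentz_integral:
  fixes a c :: real
  assumes "a > 0"
  shows "integrable lborel (\<lambda>y. 2 * a / (a\<^sup>2 + (y - c)\<^sup>2))"
    and "(LBINT y. 2 * a / (a\<^sup>2 + (y - c)\<^sup>2)) = 2 * pi"
proof -
  let ?k = "\<lambda>x::real. inverse (1 + x\<^sup>2)"
  have i: "integrable lborel ?k" and I: "(LBINT x. ?k x) = pi"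
    using integrable_inverse_1_plus_square LBINT_inverse_1_plus_square
    by (simp_all add: set_integrable_def interval_integral_to_infinity_eq interval_lebesgue_integral_def set_lebesgue_integral_def einterval_eq)
  have eq: "?k (- c / a + (1 / a) * y) = (a / 2) * (2 * a / (a\<^sup>2 + (y - c)\<^sup>2))" for y
  proof -
    have e: "- c / a + (1 / a) * y = (y - c) / a" using assms by (simp add: field_simps)
    have p: "a\<^sup>2 + (y - c)\<^sup>2 > 0" using assms by (simp add: add_pos_nonneg)
    have "1 + ((y - c) / a)\<^sup>2 = (a\<^sup>2 + (y - c)\<^sup>2) / a\<^sup>2" using assms by (simp add: power_divide field_simps)
    then show ?thesis unfolding e using assms by (simp add: power2_eq_square)
  qed
  have "integrable lborel (\<lambda>y. ?k (- c / a + (1 / a) * y))"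
    using lborel_integrable_real_affine[OF i, of "1/a" "- c / a"] assms by simp
  then show "integrable lborel (\<lambda>y. 2 * a / (a\<^sup>2 + (y - c)\<^sup>2))"
    unfolding eq integrable_mult_left_iff using assms by simp
  have "pi = (1 / a) * (LBINT y. ?k (- c / a + (1 / a) * y))"
    using lborel_integral_real_affine[of "1/a" ?k "- c / a"] I assms by simp
  then show "(LBINT y. 2 * a / (a\<^sup>2 + (y - c)\<^sup>2)) = 2 * pi"
    unfolding eq integral_mult_right_zero using assms by simp
qed

lemma integrable_tensor:
  fixes f g :: "real \<Rightarrow> complex"
  assumes "integrable lborel f" "integrable lborel g"
  shows "integrable (lborel \<Otimes>\<^sub>M lborel) (\<lambda>(x, y). f x * g y)"
proof -
  have [measurable]: "f \<in> borel_measurable borel" "g \<in> borel_measurable borel" using assms by auto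
  show ?thesis
  proof (rule lborel_pair.Fubini_integrable)
    show "integrable lborel (\<lambda>x. LBINT y. cmod (case (x, y) of (x, y) \<Rightarrow> f x * g y))"
      using assms by (simp add: norm_mult)
    show "AE x in lborel. integrable lborel (\<lambda>y. case (x, y) of (x, y) \<Rightarrow> f x * g y)"
      using assms by simp
  qed measurable
qed

text \<open>
  Fubini applied to \<open>f x * g \<xi> * cis (- (x * \<xi>))\<close>. Every regularised inversion below is an instance.
\<close>
lemma ft_multiplication_formula:
  assumes "integrable lborel f" "integrable lborel g"
  shows "(LBINT \<xi>. ft f \<xi> * g \<xi>) = (LBINT x. f x * ft g x)"
proof -
  have [measurable]: "f \<in> borel_measurable borel" "g \<in> borel_measurable borel" using assms by auto
  have i: "integrable (lborel \<Otimes>\<^sub>M lborel) (\<lambda>(x, y). f x * g y * cis (- (x * y)))"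
    by (rule Bochner_Integration.integrable_bound[OF integrable_tensor[OF assms]])
       (auto simp: norm_mult)
  have "(LBINT \<xi>. ft f \<xi> * g \<xi>) = (LBINT \<xi>. LBINT x. f x * g \<xi> * cis (- (x * \<xi>)))"
    unfolding ft_def by (subst integral_mult_left_zero[symmetric]) (simp add: mult_ac)
  also have "\<dots> = (LBINT x. LBINT \<xi>. f x * g \<xi> * cis (- (x * \<xi>)))"
    using lborel_pair.Fubini_integral[OF i] by simp
  also have "\<dots> = (LBINT x. f x * ft g x)"
    unfolding ft_def by (subst integral_mult_right_zero[symmetric]) (simp add: mult_ac)
  finally show ?thesis .
qed

section \<open>A Plancherel inequality\<close>

lemma L2_cmod_mult_integrable:
  assumes "L2 f" "L2 g"
  shows "integrable lborel (\<lambda>x. cmod (f x) * cmod (g x))"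
proof (rule Bochner_Integration.integrable_bound)
  show "integrable lborel (\<lambda>x. (cmod (f x))\<^sup>2 + (cmod (g x))\<^sup>2)"
    using assms by (auto simp: L2_def)
  show "(\<lambda>x. cmod (f x) * cmod (g x)) \<in> borel_measurable lborel"
    using assms by (auto simp: L2_def)
  have "a * b \<le> a\<^sup>2 + b\<^sup>2" if "a \<ge> 0" "b \<ge> 0" for a b :: real
  proof -
    have "2 * (a * b) \<le> a\<^sup>2 + b\<^sup>2" using sum_squares_bound[of a b] by (simp add: mult.assoc)
    moreover have "0 \<le> a * b" using that by simp
    ultimately show ?thesis by linarith
  qed
  then show "AE x in lborel. norm (cmod (f x) * cmod (g x)) \<le> norm ((cmod (f x))\<^sup>2 + (cmod (g x))\<^sup>2)"
    by (auto simp: abs_mult)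
qed

lemma L2_mult_integrable:
  assumes "L2 f" "L2 g"
  shows "integrable lborel (\<lambda>x. f x * g x)"
  by (rule Bochner_Integration.integrable_bound[OF L2_cmod_mult_integrable[OF assms]])
     (use assms in \<open>auto simp: L2_def norm_mult\<close>)

lemma L2_Cauchy_Schwarz:
  assumes "L2 f" "L2 g"
  shows "(LBINT x. cmod (f x) * cmod (g x))\<^sup>2 \<le> (LBINT x. (cmod (f x))\<^sup>2) * (LBINT x. (cmod (g x))\<^sup>2)"
proof -
  have [measurable]: "f \<in> borel_measurable borel" "g \<in> borel_measurable borel"
    using assms by (auto simp: L2_def)
  have "(\<integral>\<^sup>+x. ennreal (cmod (f x)) * ennreal (cmod (g x)) \<partial>lborel)\<^sup>2
      \<le> (\<integral>\<^sup>+x. ennreal (cmod (f x)) ^ 2 \<partial>lborel) * (\<integral>\<^sup>+x. ennreal (cmod (g x)) ^ 2 \<partial>lborel)"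
    by (rule Cauchy_Schwarz_nn_integral) auto
  moreover have "(\<integral>\<^sup>+x. ennreal (cmod (f x)) * ennreal (cmod (g x)) \<partial>lborel) = ennreal (LBINT x. cmod (f x) * cmod (g x))"
    using L2_cmod_mult_integrable[OF assms]
    by (subst nn_integral_eq_integral[symmetric]) (auto simp: ennreal_mult)
  moreover have "(\<integral>\<^sup>+x. ennreal (cmod (f x)) ^ 2 \<partial>lborel) = ennreal (LBINT x. (cmod (f x))\<^sup>2)"
    using assms by (subst nn_integral_eq_integral[symmetric]) (auto simp: ennreal_power L2_def)
  moreover have "(\<integral>\<^sup>+x. ennreal (cmod (g x)) ^ 2 \<partial>lborel) = ennreal (LBINT x. (cmod (g x))\<^sup>2)"
    using assms by (subst nn_integral_eq_integral[symmetric]) (auto simp: ennreal_power L2_def)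
  ultimately show ?thesis
    by (simp add: ennreal_mult[symmetric] ennreal_power)
qed

lemma ft_damped_inversion:
  assumes f: "integrable lborel f" and "\<epsilon> > 0"
  shows "(LBINT \<xi>. ft f \<xi> * (complex_of_real (exp (- (\<epsilon> * \<bar>\<xi>\<bar>))) * cis (y * \<xi>)))
       = (LBINT x. f x * complex_of_real (2 * \<epsilon> / (\<epsilon>\<^sup>2 + (x - y)\<^sup>2)))"
proof -
  let ?e = "\<lambda>\<xi>. complex_of_real (exp (- (\<epsilon> * \<bar>\<xi>\<bar>)))"
  have e: "integrable lborel ?e" by (rule exp_abs_ft(1)[OF assms(2)])
  have g: "ft (\<lambda>\<xi>. ?e \<xi> * cis (y * \<xi>)) x = complex_of_real (2 * \<epsilon> / (\<epsilon>\<^sup>2 + (x - y)\<^sup>2))" for x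
  proof -
    have "ft (\<lambda>\<xi>. ?e \<xi> * cis (y * \<xi>)) x = ft ?e (x - y)"
      unfolding ft_def by (intro Bochner_Integration.integral_cong) (auto simp: cis_mult algebra_simps)
    then show ?thesis using exp_abs_ft(2)[OF assms(2)] by simp
  qed
  show ?thesis
    using ft_multiplication_formula[OF f integrable_cis_mult(1)[OF e, of y]] unfolding g .
qed

lemma nn_integral_fatou_bound:
  fixes g :: "nat \<Rightarrow> 'a \<Rightarrow> ennreal"
  assumes "\<And>n. g n \<in> borel_measurable M"
    and "AE x in M. (\<lambda>n. g n x) \<longlonglongrightarrow> h x"
    and "\<forall>\<^sub>F n in sequentially. (\<integral>\<^sup>+x. g n x \<partial>M) \<le> c"
  shows "(\<integral>\<^sup>+x. h x \<partial>M) \<le> c"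
proof -
  have "(\<integral>\<^sup>+x. h x \<partial>M) = (\<integral>\<^sup>+x. liminf (\<lambda>n. g n x) \<partial>M)"
    by (rule nn_integral_cong_AE, use assms(2) in eventually_elim) (simp add: lim_imp_Liminf)
  also have "\<dots> \<le> liminf (\<lambda>n. \<integral>\<^sup>+x. g n x \<partial>M)"
    by (rule nn_integral_liminf) (use assms in auto)
  also have "\<dots> \<le> c"
    by (rule Liminf_le) (use assms in auto)
  finally show ?thesis .
qed

text \<open>
  Two applications of the multiplication formula rewrite the left side as the double integral of
  \<open>cnj (f x) * f z\<close> against the Poisson kernel at \<open>z - x\<close>. That kernel has mass \<open>2 * pi\<close> in either
  variable, so \<open>2 * \<bar>f x\<bar> * \<bar>f z\<bar> \<le> \<bar>f x\<bar>\<^sup>2 + \<bar>f z\<bar>\<^sup>2\<close> gives the bound uniformly in \<open>\<epsilon>\<close>.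
\<close>
lemma plancherel_damped:
  assumes f: "integrable lborel f" and L2: "L2 f" and "\<epsilon> > 0"
  shows "(\<integral>\<^sup>+\<xi>. ennreal (exp (- (\<epsilon> * \<bar>\<xi>\<bar>)) * (cmod (ft f \<xi>))\<^sup>2) \<partial>lborel)
          \<le> ennreal (2 * pi * (LBINT x. (cmod (f x))\<^sup>2))"
proof -
  have [measurable]: "f \<in> borel_measurable borel" using f by auto
  have [measurable]: "ft f \<in> borel_measurable borel" using ft_measurable[of f] by auto
  let ?e = "\<lambda>\<xi>. complex_of_real (exp (- (\<epsilon> * \<bar>\<xi>\<bar>)))"
  let ?P = "\<lambda>x. 2 * \<epsilon> / (\<epsilon>\<^sup>2 + x\<^sup>2)"
  let ?G = "\<lambda>\<xi>. ?e \<xi> * ft f \<xi>"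
  let ?h = "\<lambda>x. cnj (f (- x))"
  define N where "N = (LBINT x. (cmod (f x))\<^sup>2)"
  have P0: "?P x \<ge> 0" for x using assms by (simp add: add_nonneg_nonneg)
  have fsq: "integrable lborel (\<lambda>x. (cmod (f x))\<^sup>2)" using L2 by (simp add: L2_def)
  have h: "integrable lborel ?h"
    using lborel_integrable_real_affine[OF f, of "-1" 0] by simp
  have e: "integrable lborel ?e" by (rule exp_abs_ft(1)[OF assms(3)])
  have G: "integrable lborel ?G"
  proof (rule Bochner_Integration.integrable_bound)
    show "integrable lborel (\<lambda>\<xi>. of_real (LBINT x. cmod (f x)) * ?e \<xi>)" using e by simp
    show "AE x in lborel. cmod (?G x) \<le> cmod (of_real (LBINT x. cmod (f x)) * ?e x)"
    proof (rule AE_I2)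
      fix x
      have "cmod (?G x) = cmod (ft f x) * exp (- (\<epsilon> * \<bar>x\<bar>))" by (simp add: norm_mult)
      also have "\<dots> \<le> (LBINT x. cmod (f x)) * exp (- (\<epsilon> * \<bar>x\<bar>))"
        by (intro mult_right_mono ft_bound f) auto
      also have "\<dots> = cmod (of_real (LBINT x. cmod (f x)) * ?e x)"
        unfolding norm_mult by simp
      finally show "cmod (?G x) \<le> cmod (of_real (LBINT x. cmod (f x)) * ?e x)" .
    qed
  qed simp
  have hft: "ft ?h \<xi> = cnj (ft f \<xi>)" for \<xi>
  proof -
    have "ft ?h \<xi> = (LBINT x. cnj (f x) * cis (x * \<xi>))"
      unfolding ft_def using lborel_integral_real_affine[of "-1" "\<lambda>x. cnj (f x) * cis (x * \<xi>)" 0] by simp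
    also have "\<dots> = (LBINT x. cnj (f x * cis (- (x * \<xi>))))"
      by (simp add: cis_cnj del: Bochner_Integration.integral_cnj)
    also have "\<dots> = cnj (ft f \<xi>)"
      unfolding ft_def by (rule Bochner_Integration.integral_cnj)
    finally show ?thesis .
  qed
  have Gft: "ft ?G (- y) = (LBINT x. f x * complex_of_real (?P (x - y)))" for y
    using ft_damped_inversion[OF f assms(3), of y] unfolding ft_def[of ?G] by (simp add: mult_ac)
  have "(LBINT \<xi>. complex_of_real (exp (- (\<epsilon> * \<bar>\<xi>\<bar>)) * (cmod (ft f \<xi>))\<^sup>2)) = (LBINT \<xi>. ft ?h \<xi> * ?G \<xi>)"
  proof (rule Bochner_Integration.integral_cong[OF refl])
    fix \<xi>
    have "complex_of_real ((cmod (ft f \<xi>))\<^sup>2) = ft f \<xi> * cnj (ft f \<xi>)"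
      by (rule complex_norm_square)
    then show "complex_of_real (exp (- (\<epsilon> * \<bar>\<xi>\<bar>)) * (cmod (ft f \<xi>))\<^sup>2) = ft ?h \<xi> * ?G \<xi>"
      unfolding hft of_real_mult by (simp only: mult_ac)
  qed
  also have "\<dots> = (LBINT x. ?h x * ft ?G x)"
    by (rule ft_multiplication_formula[OF h G])
  also have "\<dots> = (LBINT x. cnj (f x) * ft ?G (- x))"
    using lborel_integral_real_affine[of "-1" "\<lambda>x. cnj (f x) * ft ?G (- x)" 0] by simp
  also have "\<dots> = (LBINT x. cnj (f x) * (LBINT z. f z * complex_of_real (?P (z - x))))"
    unfolding Gft ..
  finally have eq: "(LBINT \<xi>. complex_of_real (exp (- (\<epsilon> * \<bar>\<xi>\<bar>)) * (cmod (ft f \<xi>))\<^sup>2))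
      = (LBINT x. cnj (f x) * (LBINT z. f z * complex_of_real (?P (z - x))))" .
  have PI: "(\<integral>\<^sup>+z. ennreal (?P (z - x)) \<partial>lborel) = ennreal (2 * pi)" for x
    using lorentz_integral[OF assms(3), of x] P0 by (subst nn_integral_eq_integral) auto
  have PI': "(\<integral>\<^sup>+x. ennreal (?P (z - x)) \<partial>lborel) = ennreal (2 * pi)" for z
    using PI[of z] by (simp add: power2_commute)
  have N: "(\<integral>\<^sup>+x. ennreal ((cmod (f x))\<^sup>2) \<partial>lborel) = ennreal N"
    unfolding N_def using fsq by (intro nn_integral_eq_integral) auto
  have N0: "N \<ge> 0" unfolding N_def by simp
  have one: "(\<integral>\<^sup>+x. \<integral>\<^sup>+z. ennreal ((cmod (f x))\<^sup>2) * ennreal (?P (z - x)) \<partial>lborel \<partial>lborel) = ennreal (2 * pi * N)"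
    using N0 by (simp add: nn_integral_cmult nn_integral_multc PI N) (simp add: ennreal_mult[symmetric] mult_ac)
  have two: "(\<integral>\<^sup>+x. \<integral>\<^sup>+z. ennreal ((cmod (f z))\<^sup>2) * ennreal (?P (z - x)) \<partial>lborel \<partial>lborel) = ennreal (2 * pi * N)"
  proof -
    have "(\<integral>\<^sup>+x. \<integral>\<^sup>+z. ennreal ((cmod (f z))\<^sup>2) * ennreal (?P (z - x)) \<partial>lborel \<partial>lborel)
        = (\<integral>\<^sup>+z. \<integral>\<^sup>+x. ennreal ((cmod (f z))\<^sup>2) * ennreal (?P (z - x)) \<partial>lborel \<partial>lborel)"
      by (rule lborel_pair.Fubini') measurable
    then show ?thesis
      using N0 by (simp add: nn_integral_cmult nn_integral_multc PI' N) (simp add: ennreal_mult[symmetric] mult_ac)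
  qed
  have int: "integrable lborel (\<lambda>\<xi>. exp (- (\<epsilon> * \<bar>\<xi>\<bar>)) * (cmod (ft f \<xi>))\<^sup>2)"
  proof (rule Bochner_Integration.integrable_bound)
    show "integrable lborel (\<lambda>\<xi>. of_real (LBINT x. cmod (f x)) * ?G \<xi>)" using G by simp
    show "AE x in lborel. norm (exp (- (\<epsilon> * \<bar>x\<bar>)) * (cmod (ft f x))\<^sup>2) \<le> cmod (of_real (LBINT x. cmod (f x)) * ?G x)"
    proof (rule AE_I2)
      fix x
      have "norm (exp (- (\<epsilon> * \<bar>x\<bar>)) * (cmod (ft f x))\<^sup>2) = cmod (ft f x) * cmod (?G x)"
        by (simp add: norm_mult power2_eq_square)
      also have "\<dots> \<le> (LBINT x. cmod (f x)) * cmod (?G x)"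
        by (intro mult_right_mono ft_bound f) auto
      also have "\<dots> = cmod (of_real (LBINT x. cmod (f x)) * ?G x)"
        unfolding norm_mult by simp
      finally show "norm (exp (- (\<epsilon> * \<bar>x\<bar>)) * (cmod (ft f x))\<^sup>2) \<le> cmod (of_real (LBINT x. cmod (f x)) * ?G x)" .
    qed
  qed simp
  have amgm: "cmod (f x) * (cmod (f z) * ?P (z - x)) \<le> ((cmod (f x))\<^sup>2 / 2) * ?P (z - x) + ((cmod (f z))\<^sup>2 / 2) * ?P (z - x)" for x z
  proof -
    have "cmod (f x) * cmod (f z) \<le> (cmod (f x))\<^sup>2 / 2 + (cmod (f z))\<^sup>2 / 2"
      using sum_squares_bound[of "cmod (f x)" "cmod (f z)"] by simp
    from mult_right_mono[OF this P0[of "z - x"]] show ?thesis by (simp add: algebra_simps)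
  qed
  have "(\<integral>\<^sup>+\<xi>. ennreal (exp (- (\<epsilon> * \<bar>\<xi>\<bar>)) * (cmod (ft f \<xi>))\<^sup>2) \<partial>lborel)
      = ennreal (LBINT \<xi>. exp (- (\<epsilon> * \<bar>\<xi>\<bar>)) * (cmod (ft f \<xi>))\<^sup>2)"
    by (rule nn_integral_eq_integral[OF int]) auto
  also have "\<dots> \<le> ennreal (cmod (LBINT \<xi>. complex_of_real (exp (- (\<epsilon> * \<bar>\<xi>\<bar>)) * (cmod (ft f \<xi>))\<^sup>2)))"
    unfolding integral_complex_of_real norm_of_real by (rule ennreal_leI) linarith
  also have "\<dots> \<le> (\<integral>\<^sup>+x. ennreal (cmod (cnj (f x) * (LBINT z. f z * complex_of_real (?P (z - x))))) \<partial>lborel)"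
    unfolding eq by (cases "integrable lborel (\<lambda>x. cnj (f x) * (LBINT z. f z * complex_of_real (?P (z - x))))")
       (auto simp: not_integrable_integral_eq intro!: integral_norm_bound_ennreal)
  also have "\<dots> \<le> (\<integral>\<^sup>+x. ennreal (cmod (f x)) * (\<integral>\<^sup>+z. ennreal (cmod (f z) * ?P (z - x)) \<partial>lborel) \<partial>lborel)"
  proof (rule nn_integral_mono)
    fix x
    have "ennreal (cmod (LBINT z. f z * complex_of_real (?P (z - x)))) \<le> (\<integral>\<^sup>+z. ennreal (cmod (f z * complex_of_real (?P (z - x)))) \<partial>lborel)"
      by (cases "integrable lborel (\<lambda>z. f z * complex_of_real (?P (z - x)))")
         (auto simp: not_integrable_integral_eq simp del: of_real_divide of_real_mult intro!: integral_norm_bound_ennreal)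
    also have "\<dots> = (\<integral>\<^sup>+z. ennreal (cmod (f z) * ?P (z - x)) \<partial>lborel)"
      using P0 by (simp only: norm_mult norm_of_real abs_of_nonneg)
    finally show "ennreal (cmod (cnj (f x) * (LBINT z. f z * complex_of_real (?P (z - x)))))
       \<le> ennreal (cmod (f x)) * (\<integral>\<^sup>+z. ennreal (cmod (f z) * ?P (z - x)) \<partial>lborel)"
      unfolding norm_mult complex_mod_cnj by (simp only: ennreal_mult norm_ge_zero) (rule mult_left_mono, auto)
  qed
  also have "\<dots> = (\<integral>\<^sup>+x. \<integral>\<^sup>+z. ennreal (cmod (f x) * (cmod (f z) * ?P (z - x))) \<partial>lborel \<partial>lborel)"
    using P0 by (subst nn_integral_cmult[symmetric]) (simp_all add: ennreal_mult del: times_divide_eq_right)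
  also have "\<dots> \<le> (\<integral>\<^sup>+x. \<integral>\<^sup>+z. ennreal (1/2) * (ennreal ((cmod (f x))\<^sup>2) * ennreal (?P (z - x)))
        + ennreal (1/2) * (ennreal ((cmod (f z))\<^sup>2) * ennreal (?P (z - x))) \<partial>lborel \<partial>lborel)"
  proof (intro nn_integral_mono)
    fix x z
    have half: "ennreal (1/2) * (ennreal a * ennreal p) = ennreal (a / 2 * p)" if "a \<ge> 0" "p \<ge> 0" for a p
      using ennreal_mult[OF that] ennreal_mult[of "1/2" "a * p"] that by simp
    have "ennreal (cmod (f x) * (cmod (f z) * ?P (z - x)))
        \<le> ennreal (((cmod (f x))\<^sup>2 / 2) * ?P (z - x) + ((cmod (f z))\<^sup>2 / 2) * ?P (z - x))"
      by (rule ennreal_leI[OF amgm])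
    also have "\<dots> = ennreal (1/2) * (ennreal ((cmod (f x))\<^sup>2) * ennreal (?P (z - x)))
        + ennreal (1/2) * (ennreal ((cmod (f z))\<^sup>2) * ennreal (?P (z - x)))"
      unfolding half[OF zero_le_power2 P0]
      by (intro ennreal_plus mult_nonneg_nonneg P0) auto
    finally show "ennreal (cmod (f x) * (cmod (f z) * ?P (z - x)))
      \<le> ennreal (1/2) * (ennreal ((cmod (f x))\<^sup>2) * ennreal (?P (z - x)))
        + ennreal (1/2) * (ennreal ((cmod (f z))\<^sup>2) * ennreal (?P (z - x)))" .
  qed
  also have "\<dots> = ennreal (1/2) * ennreal (2 * pi * N) + ennreal (1/2) * ennreal (2 * pi * N)"
    using one two by (simp add: nn_integral_add nn_integral_cmult)
  also have "\<dots> = ennreal (2 * pi * N)"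
    using N0 ennreal_mult[of "1/2" "2 * pi * N"] ennreal_plus[of "pi * N" "pi * N"] by (simp add: mult_ac)
  finally show ?thesis unfolding N_def by simp
qed

text \<open>
  Fatou's lemma removes the damping. The inequality makes the transforms of the truncations of a
  square-integrable function a Cauchy family, and it shows that derivatives given by inversion are
  square-integrable.
\<close>
lemma plancherel_bound:
  assumes f: "integrable lborel f" and "L2 f"
  shows "L2 (ft f)" and "(\<integral>\<^sup>+\<xi>. ennreal ((cmod (ft f \<xi>))\<^sup>2) \<partial>lborel) \<le> ennreal (2 * pi * (LBINT x. (cmod (f x))\<^sup>2))"
proof -
  have [measurable]: "ft f \<in> borel_measurable borel" using ft_measurable[of f] f by auto
  show b: "(\<integral>\<^sup>+\<xi>. ennreal ((cmod (ft f \<xi>))\<^sup>2) \<partial>lborel) \<le> ennreal (2 * pi * (LBINT x. (cmod (f x))\<^sup>2))"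
  proof (rule nn_integral_fatou_bound)
    let ?g = "\<lambda>n \<xi>. ennreal (exp (- ((1 / real (Suc n)) * \<bar>\<xi>\<bar>)) * (cmod (ft f \<xi>))\<^sup>2)"
    show "?g n \<in> borel_measurable lborel" for n by measurable
    have "(\<lambda>n. ?g n \<xi>) \<longlonglongrightarrow> ennreal (exp (- (0 * \<bar>\<xi>\<bar>)) * (cmod (ft f \<xi>))\<^sup>2)" for \<xi>
      by (intro tendsto_intros LIMSEQ_Suc lim_1_over_n)
    then show "AE \<xi> in lborel. (\<lambda>n. ?g n \<xi>) \<longlonglongrightarrow> ennreal ((cmod (ft f \<xi>))\<^sup>2)" by simp
    show "\<forall>\<^sub>F n in sequentially. (\<integral>\<^sup>+\<xi>. ?g n \<xi> \<partial>lborel) \<le> ennreal (2 * pi * (LBINT x. (cmod (f x))\<^sup>2))"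
      by (intro always_eventually allI plancherel_damped assms) auto
  qed
  show "L2 (ft f)"
    unfolding L2_def integrable_iff_bounded
    using le_less_trans[OF b ennreal_less_top] by auto
qed

section \<open>The Fourier transform of square-integrable functions\<close>

definition trunc :: "(real \<Rightarrow> real) \<Rightarrow> real \<Rightarrow> real \<Rightarrow> complex" where
  "trunc f R x = indicator {-R..R} x *\<^sub>R complex_of_real (f x)"

lemma trunc_ft: "(LBINT x:{-R..R}. complex_of_real (f x) * cis (- (x * \<xi>))) = ft (trunc f R) \<xi>"
  by (simp add: ft_def trunc_def[abs_def] set_lebesgue_integral_def)

text \<open>
  The core of the Riesz-Fischer theorem. The Cauchy condition then identifies the pointwise limit as the
  \<open>L\<^sup>2\<close>-limit by Fatou's lemma.
\<close>
lemma L2_cauchy_AE_subseq: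
  fixes g :: "nat \<Rightarrow> real \<Rightarrow> complex"
  assumes [measurable]: "\<And>n. g n \<in> borel_measurable lborel"
    and cau: "\<And>e::real. e > 0 \<Longrightarrow> \<exists>N. \<forall>m\<ge>N. \<forall>n\<ge>N. (\<integral>\<^sup>+x. ennreal ((cmod (g m x - g n x))\<^sup>2) \<partial>lborel) \<le> ennreal e"
  shows "\<exists>h r. h \<in> borel_measurable lborel \<and> (\<forall>k. k \<le> r k) \<and> (AE x in lborel. (\<lambda>k. g (r k) x) \<longlonglongrightarrow> h x)"
proof -
  \<comment> \<open>Squared distances at most \<open>8\<^sup>-\<^sup>k\<close> stay summable after multiplication by \<open>4\<^sup>k\<close>; hence almost
     everywhere the increments are at most a constant times \<open>2\<^sup>-\<^sup>k\<close>.\<close>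
  have "\<exists>N. \<forall>k. \<forall>m\<ge>N k. \<forall>n\<ge>N k. (\<integral>\<^sup>+x. ennreal ((cmod (g m x - g n x))\<^sup>2) \<partial>lborel) \<le> ennreal ((1/8)^k)"
    using cau by (intro choice allI) simp
  then obtain N where N: "\<And>k m n. m \<ge> N k \<Longrightarrow> n \<ge> N k \<Longrightarrow>
      (\<integral>\<^sup>+x. ennreal ((cmod (g m x - g n x))\<^sup>2) \<partial>lborel) \<le> ennreal ((1/8)^k)" by blast
  define r where "r k = (\<Sum>j\<le>k. Suc (N j))" for k
  have rN: "r k \<ge> N k" "r (Suc k) \<ge> N k" for k
  proof -
    show a: "r k \<ge> N k" unfolding r_def
      by (cases k) simp_all
    show "r (Suc k) \<ge> N k" using a unfolding r_def by simp
  qed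
  have rk: "r k \<ge> k" for k by (induction k) (auto simp: r_def)
  define d where "d k x = (cmod (g (r (Suc k)) x - g (r k) x))\<^sup>2" for k x
  have [measurable]: "d k \<in> borel_measurable lborel" for k unfolding d_def[abs_def] by measurable
  have d_int: "(\<integral>\<^sup>+x. ennreal (4^k * d k x) \<partial>lborel) \<le> ennreal ((1/2)^k)" for k
  proof -
    have "(\<integral>\<^sup>+x. ennreal (4^k * d k x) \<partial>lborel) = ennreal (4^k) * (\<integral>\<^sup>+x. ennreal (d k x) \<partial>lborel)"
      by (subst nn_integral_cmult[symmetric]) (auto simp: ennreal_mult d_def)
    also have "\<dots> \<le> ennreal (4^k) * ennreal ((1/8)^k)"
      unfolding d_def by (intro mult_left_mono N rN) auto
    also have "\<dots> = ennreal ((1/2)^k)"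
      by (subst ennreal_mult[symmetric]) (auto simp: power_mult_distrib[symmetric])
    finally show ?thesis .
  qed
  have "(\<integral>\<^sup>+x. (\<Sum>k. ennreal (4^k * d k x)) \<partial>lborel) = (\<Sum>k. \<integral>\<^sup>+x. ennreal (4^k * d k x) \<partial>lborel)"
    by (rule nn_integral_suminf) auto
  also have "\<dots> \<le> (\<Sum>k. ennreal ((1/2)^k))"
    by (intro suminf_le d_int) auto
  also have "\<dots> = ennreal 2"
    using geometric_sums[of "1/2::real"] by (intro suminf_ennreal_eq) auto
  finally have "(\<integral>\<^sup>+x. (\<Sum>k. ennreal (4^k * d k x)) \<partial>lborel) \<noteq> \<infinity>"
    using ennreal_less_top[of 2] by (auto simp: top_unique)
  then have "AE x in lborel. (\<Sum>k. ennreal (4^k * d k x)) \<noteq> \<infinity>"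
    by (intro nn_integral_PInf_AE) auto
  then have conv: "AE x in lborel. convergent (\<lambda>k. g (r k) x)"
  proof eventually_elim
    fix x assume fin: "(\<Sum>k. ennreal (4^k * d k x)) \<noteq> \<infinity>"
    then obtain C where C: "(\<Sum>k. ennreal (4^k * d k x)) = ennreal C" "C \<ge> 0"
      by (cases "(\<Sum>k. ennreal (4^k * d k x))") auto
    have le: "4^k * d k x \<le> C" for k
    proof -
      have "ennreal (4^k * d k x) \<le> (\<Sum>k. ennreal (4^k * d k x))"
        using sum_le_suminf[of "\<lambda>k. ennreal (4^k * d k x)" "{k}"] by (simp add: summableI)
      then show ?thesis using C by simp
    qed
    have le2: "cmod (g (r (Suc k)) x - g (r k) x) \<le> sqrt C * (1/2)^k" for k
    proof (rule power2_le_imp_le)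
      have "(2::real)^k * 2^k = 4^k" by (simp add: power_mult_distrib[symmetric])
      then have "(2^k)\<^sup>2 = (4::real)^k" by (simp add: power2_eq_square)
      then have "d k x \<le> C * ((1/2)^k)\<^sup>2"
        using le[of k] by (simp add: power_divide field_simps)
      then show "(cmod (g (r (Suc k)) x - g (r k) x))\<^sup>2 \<le> (sqrt C * (1/2)^k)\<^sup>2"
        using C(2) unfolding d_def power_mult_distrib by simp
    qed (use C in auto)
    have "summable (\<lambda>k. g (r (Suc k)) x - g (r k) x)"
      by (rule summable_comparison_test'[where N=0, OF _ le2]) (intro summable_mult summable_geometric, simp)
    then have "convergent (\<lambda>n. \<Sum>k<n. g (r (Suc k)) x - g (r k) x)"
      by (simp add: summable_iff_convergent)
    then have "convergent (\<lambda>n. g (r n) x - g (r 0) x)"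
      unfolding sum_lessThan_telescope[of "\<lambda>k. g (r k) x"] .
    from convergent_add[OF this convergent_const[of "g (r 0) x"]] show "convergent (\<lambda>k. g (r k) x)" by simp
  qed
  define h where "h x = lim (\<lambda>k. g (r k) x)" for x
  have "h \<in> borel_measurable lborel"
    unfolding h_def[abs_def] by measurable
  moreover have "AE x in lborel. (\<lambda>k. g (r k) x) \<longlonglongrightarrow> h x"
    using conv by eventually_elim (simp add: h_def convergent_LIMSEQ_iff)
  ultimately show ?thesis using rk by blast
qed

lemma trunc_square_integrable:
  assumes "f \<in> borel_measurable lborel" "integrable lborel (\<lambda>x. (f x)\<^sup>2)"
  shows "integrable lborel (trunc f R)" "L2 (trunc f R)"
proof -
  have [measurable]: "f \<in> borel_measurable borel" using assms by simp
  have m[measurable]: "trunc f R \<in> borel_measurable borel" unfolding trunc_def[abs_def] by measurable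
  show "integrable lborel (trunc f R)"
  proof (rule Bochner_Integration.integrable_bound)
    show "integrable lborel (\<lambda>x. (f x)\<^sup>2 + indicator {-R..R} x)"
      using assms by (intro Bochner_Integration.integrable_add integrable_real_indicator) (auto simp: emeasure_lborel_Icc_eq)
    have "\<bar>a\<bar> \<le> a\<^sup>2 + 1" for a :: real
      using sum_squares_bound[of "\<bar>a\<bar>" 1] by simp
    then show "AE x in lborel. norm (trunc f R x) \<le> norm ((f x)\<^sup>2 + indicator {-R..R} x)"
      by (auto simp: trunc_def indicator_def)
  qed simp
  show "L2 (trunc f R)" unfolding L2_def
  proof
    show "integrable lborel (\<lambda>x. (cmod (trunc f R x))\<^sup>2)"
      by (rule Bochner_Integration.integrable_bound[OF assms(2)]) (auto simp: trunc_def indicator_def)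
  qed simp
qed

definition l2_tail :: "(real \<Rightarrow> real) \<Rightarrow> real \<Rightarrow> real" where
  "l2_tail f A = (LBINT x. indicator {x. A \<le> \<bar>x\<bar>} x * (f x)\<^sup>2)"

lemma l2_tail_tendsto:
  assumes "integrable lborel (\<lambda>x. (f x)\<^sup>2)"
  shows "(l2_tail f \<longlongrightarrow> 0) at_top"
proof -
  have [measurable]: "(\<lambda>x. (f x)\<^sup>2) \<in> borel_measurable borel" using assms by auto
  have "((\<lambda>A. LBINT x. indicator {x. A \<le> \<bar>x\<bar>} x * (f x)\<^sup>2) \<longlongrightarrow> (LBINT x::real. 0)) at_top"
  proof (rule integral_dominated_convergence_at_top[where w = "\<lambda>x. (f x)\<^sup>2"])
    show "integrable lborel (\<lambda>x. (f x)\<^sup>2)" by (rule assms)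
    show "AE x in lborel. ((\<lambda>A. indicator {x. A \<le> \<bar>x\<bar>} x * (f x)\<^sup>2) \<longlongrightarrow> 0) at_top"
    proof (rule AE_I2)
      fix x :: real
      show "((\<lambda>A. indicator {x. A \<le> \<bar>x\<bar>} x * (f x)\<^sup>2) \<longlongrightarrow> 0) at_top"
        by (rule tendsto_eventually, rule eventually_mono[OF eventually_gt_at_top[of "\<bar>x\<bar>"]]) auto
    qed
    show "\<forall>\<^sub>F A in at_top. AE x in lborel. norm (indicator {x. A \<le> \<bar>x\<bar>} x * (f x)\<^sup>2) \<le> (f x)\<^sup>2"
      by (auto simp: indicator_def)
  qed (auto simp del: borel_measurable_power)
  then show ?thesis by (simp add: l2_tail_def[abs_def])
qed

lemma trunc_diff_bound:
  assumes f: "f \<in> borel_measurable lborel" "integrable lborel (\<lambda>x. (f x)\<^sup>2)"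
    and A: "A \<le> R" "A \<le> S"
  shows "(\<integral>\<^sup>+\<xi>. ennreal ((cmod (ft (trunc f R) \<xi> - ft (trunc f S) \<xi>))\<^sup>2) \<partial>lborel) \<le> ennreal (2 * pi * l2_tail f A)"
proof -
  let ?d = "\<lambda>x. trunc f R x - trunc f S x"
  note R = trunc_square_integrable[OF f, of R] and S = trunc_square_integrable[OF f, of S]
  have [measurable]: "f \<in> borel_measurable borel" using f by simp
  have [measurable]: "?d \<in> borel_measurable borel" unfolding trunc_def[abs_def] by measurable
  have ti: "integrable lborel (\<lambda>x. indicator {x. A \<le> \<bar>x\<bar>} x * (f x)\<^sup>2)"
    by (rule Bochner_Integration.integrable_bound[OF f(2)]) (auto simp: indicator_def)
  have le: "(cmod (?d x))\<^sup>2 \<le> indicator {x. A \<le> \<bar>x\<bar>} x * (f x)\<^sup>2" for x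
    using A by (auto simp: trunc_def indicator_def)
  have i: "integrable lborel (\<lambda>x. (cmod (?d x))\<^sup>2)"
    by (rule Bochner_Integration.integrable_bound[OF ti]) (use le in auto)
  have L: "L2 ?d" unfolding L2_def using i by simp
  have "(\<integral>\<^sup>+\<xi>. ennreal ((cmod (ft (trunc f R) \<xi> - ft (trunc f S) \<xi>))\<^sup>2) \<partial>lborel)
      = (\<integral>\<^sup>+\<xi>. ennreal ((cmod (ft ?d \<xi>))\<^sup>2) \<partial>lborel)"
    using ft_diff[OF R(1) S(1)] by simp
  also have "\<dots> \<le> ennreal (2 * pi * (LBINT x. (cmod (?d x))\<^sup>2))"
    by (rule plancherel_bound(2)[OF _ L]) (use R(1) S(1) in auto)
  also have "\<dots> \<le> ennreal (2 * pi * l2_tail f A)"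
    unfolding l2_tail_def by (intro ennreal_leI mult_left_mono Bochner_Integration.integral_mono i ti le) auto
  finally show ?thesis .
qed

text \<open>
  The limit in the definition of \<^const>\<open>fourier\<close> exists, so that the choice operator picks a function with
  the defining property.
\<close>
lemma fourier_spec:
  assumes f: "f \<in> borel_measurable lborel" "integrable lborel (\<lambda>x. (f x)\<^sup>2)"
  shows "fourier f \<in> borel_measurable lborel"
    and "((\<lambda>R. \<integral>\<^sup>+\<xi>. ennreal ((cmod (fourier f \<xi> - ft (trunc f R) \<xi>))\<^sup>2) \<partial>lborel) \<longlongrightarrow> 0) at_top"
proof -
  have ftm[measurable]: "ft (trunc f R) \<in> borel_measurable borel" for R
    using ft_measurable trunc_square_integrable(2)[OF f] by (simp add: L2_def)
  have t0: "((\<lambda>A. 2 * pi * l2_tail f A) \<longlongrightarrow> 0) at_top"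
    using tendsto_mult_right_zero[OF l2_tail_tendsto[OF f(2)]] by simp
  have ex: "\<exists>h r. h \<in> borel_measurable lborel \<and> (\<forall>k. k \<le> r k) \<and>
      (AE x in lborel. (\<lambda>k. ft (trunc f (real (r k))) x) \<longlonglongrightarrow> h x)"
  proof (rule L2_cauchy_AE_subseq)
    fix e :: real assume "e > 0"
    then have "\<forall>\<^sub>F A in at_top. 2 * pi * l2_tail f A < e" using order_tendstoD(2)[OF t0] by simp
    then obtain A where A: "2 * pi * l2_tail f A < e" by (metis eventually_at_top_linorder order_refl)
    show "\<exists>N. \<forall>m\<ge>N. \<forall>n\<ge>N. (\<integral>\<^sup>+x. ennreal ((cmod (ft (trunc f (real m)) x - ft (trunc f (real n)) x))\<^sup>2) \<partial>lborel) \<le> ennreal e"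
    proof (intro exI[of _ "nat \<lceil>A\<rceil>"] allI impI)
      fix m n assume "m \<ge> nat \<lceil>A\<rceil>" "n \<ge> nat \<lceil>A\<rceil>"
      then have "A \<le> real m" "A \<le> real n" by linarith+
      from trunc_diff_bound[OF f this] show "(\<integral>\<^sup>+x. ennreal ((cmod (ft (trunc f (real m)) x - ft (trunc f (real n)) x))\<^sup>2) \<partial>lborel) \<le> ennreal e"
        using A by (meson ennreal_leI less_imp_le order_trans)
    qed
  qed simp
  then obtain h r where h[measurable]: "h \<in> borel_measurable lborel" and r: "\<And>k. k \<le> r k"
    and lim: "AE x in lborel. (\<lambda>k. ft (trunc f (real (r k))) x) \<longlonglongrightarrow> h x" by blast
  have bound: "(\<integral>\<^sup>+\<xi>. ennreal ((cmod (h \<xi> - ft (trunc f R) \<xi>))\<^sup>2) \<partial>lborel) \<le> ennreal (2 * pi * l2_tail f R)" for R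
  proof (rule nn_integral_fatou_bound)
    let ?g = "\<lambda>k \<xi>. ennreal ((cmod (ft (trunc f (real (r k))) \<xi> - ft (trunc f R) \<xi>))\<^sup>2)"
    show "?g k \<in> borel_measurable lborel" for k by measurable
    show "AE \<xi> in lborel. (\<lambda>k. ?g k \<xi>) \<longlonglongrightarrow> ennreal ((cmod (h \<xi> - ft (trunc f R) \<xi>))\<^sup>2)"
      using lim by eventually_elim (intro tendsto_intros)
    show "\<forall>\<^sub>F k in sequentially. (\<integral>\<^sup>+\<xi>. ?g k \<xi> \<partial>lborel) \<le> ennreal (2 * pi * l2_tail f R)"
    proof (rule eventually_mono[OF eventually_ge_at_top[of "nat \<lceil>R\<rceil>"]])
      fix k assume "k \<ge> nat \<lceil>R\<rceil>"
      with r[of k] have "R \<le> real (r k)" by linarith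
      then show "(\<integral>\<^sup>+\<xi>. ?g k \<xi> \<partial>lborel) \<le> ennreal (2 * pi * l2_tail f R)"
        by (intro trunc_diff_bound[OF f]) auto
    qed
  qed
  have "((\<lambda>R. \<integral>\<^sup>+\<xi>. ennreal ((cmod (h \<xi> - ft (trunc f R) \<xi>))\<^sup>2) \<partial>lborel) \<longlongrightarrow> 0) at_top"
  proof (rule tendsto_sandwich[OF _ _ tendsto_const])
    show "((\<lambda>R. ennreal (2 * pi * l2_tail f R)) \<longlongrightarrow> 0) at_top"
      using tendsto_ennrealI[OF t0] by simp
  qed (use bound in auto)
  then have "\<exists>g. g \<in> borel_measurable lborel \<and>
     ((\<lambda>R. \<integral>\<^sup>+\<xi>. ennreal ((cmod (g \<xi> - (LBINT x:{-R..R}. complex_of_real (f x) * cis (- (x * \<xi>)))))\<^sup>2) \<partial>lborel) \<longlongrightarrow> 0) at_top"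
    unfolding trunc_ft using h by blast
  from someI_ex[OF this, folded fourier_def] show "fourier f \<in> borel_measurable lborel"
    and "((\<lambda>R. \<integral>\<^sup>+\<xi>. ennreal ((cmod (fourier f \<xi> - ft (trunc f R) \<xi>))\<^sup>2) \<partial>lborel) \<longlongrightarrow> 0) at_top"
    unfolding trunc_ft by blast+
qed

lemma nn_integral_tendsto_0_AE_subseq:
  fixes u :: "nat \<Rightarrow> 'a \<Rightarrow> real"
  assumes m: "\<And>n. u n \<in> borel_measurable M" and nn: "\<And>n x. u n x \<ge> 0"
    and lim: "(\<lambda>n. \<integral>\<^sup>+x. ennreal (u n x) \<partial>M) \<longlonglongrightarrow> 0"
  shows "\<exists>r::nat \<Rightarrow> nat. strict_mono r \<and> (AE x in M. (\<lambda>n. u (r n) x) \<longlonglongrightarrow> 0)"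
proof -
  have "\<forall>\<^sub>F n in sequentially. (\<integral>\<^sup>+x. ennreal (u n x) \<partial>M) < 1"
    using order_tendstoD(2)[OF lim, of 1] by simp
  then obtain N where N: "\<And>n. n \<ge> N \<Longrightarrow> (\<integral>\<^sup>+x. ennreal (u n x) \<partial>M) < 1"
    by (auto simp: eventually_sequentially)
  have int: "integrable M (u (n + N))" for n
    unfolding integrable_iff_bounded using N[of "n + N"] m nn by (auto intro: less_trans)
  have "(\<lambda>n. enn2real (\<integral>\<^sup>+x. ennreal (u (n + N) x) \<partial>M)) \<longlonglongrightarrow> enn2real 0"
    using tendsto_enn2real[of "\<lambda>n. \<integral>\<^sup>+x. ennreal (u (n + N) x) \<partial>M" 0] LIMSEQ_ignore_initial_segment[OF lim, of N] by simp
  then have "(\<lambda>n. LINT x|M. norm (u (n + N) x)) \<longlonglongrightarrow> 0"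
    using nn m by (simp add: integral_eq_nn_integral)
  from tendsto_L1_AE_subseq[OF int this] obtain r where r: "strict_mono r"
    "AE x in M. (\<lambda>n. u (r n + N) x) \<longlonglongrightarrow> 0" by auto
  then show ?thesis
    by (intro exI[of _ "\<lambda>n. r n + N"]) (auto simp: strict_mono_def)
qed

lemma fourier_seq:
  assumes f: "f \<in> borel_measurable lborel" "integrable lborel (\<lambda>x. (f x)\<^sup>2)"
  shows "(\<lambda>n. \<integral>\<^sup>+\<xi>. ennreal ((cmod (fourier f \<xi> - ft (trunc f (real n)) \<xi>))\<^sup>2) \<partial>lborel) \<longlonglongrightarrow> 0"
  using filterlim_compose[OF fourier_spec(2)[OF f] filterlim_real_sequentially] .

lemma fourier_L2:
  assumes f: "f \<in> borel_measurable lborel" "integrable lborel (\<lambda>x. (f x)\<^sup>2)"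
  shows "L2 (fourier f)"
proof -
  have [measurable]: "fourier f \<in> borel_measurable borel" using fourier_spec(1)[OF f] by simp
  have ftm[measurable]: "ft (trunc f R) \<in> borel_measurable borel" for R
    using ft_measurable trunc_square_integrable(2)[OF f] by (simp add: L2_def)
  have "\<forall>\<^sub>F n in sequentially. (\<integral>\<^sup>+\<xi>. ennreal ((cmod (fourier f \<xi> - ft (trunc f (real n)) \<xi>))\<^sup>2) \<partial>lborel) < 1"
    using order_tendstoD(2)[OF fourier_seq[OF f], of 1] by simp
  then obtain n where n: "(\<integral>\<^sup>+\<xi>. ennreal ((cmod (fourier f \<xi> - ft (trunc f (real n)) \<xi>))\<^sup>2) \<partial>lborel) < 1"
    by (auto simp: eventually_sequentially)
  let ?g = "ft (trunc f (real n))"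
  have "integrable lborel (\<lambda>\<xi>. (cmod (fourier f \<xi> - ?g \<xi>))\<^sup>2)"
    unfolding integrable_iff_bounded using n by (auto intro: less_trans)
  moreover have "integrable lborel (\<lambda>\<xi>. (cmod (?g \<xi>))\<^sup>2)"
    using plancherel_bound(1)[OF trunc_square_integrable[OF f]] by (simp add: L2_def)
  ultimately have i: "integrable lborel (\<lambda>\<xi>. 2 * (cmod (fourier f \<xi> - ?g \<xi>))\<^sup>2 + 2 * (cmod (?g \<xi>))\<^sup>2)" by simp
  have "(cmod a)\<^sup>2 \<le> 2 * (cmod (a - b))\<^sup>2 + 2 * (cmod b)\<^sup>2" for a b
  proof -
    have "cmod a \<le> cmod (a - b) + cmod b" by (metis diff_add_cancel norm_triangle_ineq)
    then have "(cmod a)\<^sup>2 \<le> (cmod (a - b) + cmod b)\<^sup>2" by (intro power_mono) auto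
    also have "\<dots> \<le> 2 * (cmod (a - b))\<^sup>2 + 2 * (cmod b)\<^sup>2"
      using sum_squares_bound[of "cmod (a - b)" "cmod b"] by (simp add: power2_sum)
    finally show ?thesis .
  qed
  then have "integrable lborel (\<lambda>\<xi>. (cmod (fourier f \<xi>))\<^sup>2)"
    by (intro Bochner_Integration.integrable_bound[OF i]) auto
  then show ?thesis by (simp add: L2_def)
qed

text \<open>
  Along a subsequence the transforms of the truncations converge almost everywhere to the \<open>L\<^sup>2\<close>-limit,
  and everywhere to the Fourier integral by dominated convergence.
\<close>
lemma fourier_eq_ft_AE:
  assumes f: "integrable lborel f" "integrable lborel (\<lambda>x. (f x)\<^sup>2)"
  shows "AE \<xi> in lborel. fourier f \<xi> = ft (\<lambda>x. complex_of_real (f x)) \<xi>"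
proof -
  have fm: "f \<in> borel_measurable lborel" using f by simp
  then have [measurable]: "f \<in> borel_measurable borel" by simp
  have [measurable]: "fourier f \<in> borel_measurable borel" using fourier_spec(1)[OF fm f(2)] by simp
  have ftm[measurable]: "ft (trunc f R) \<in> borel_measurable borel" for R
    using ft_measurable trunc_square_integrable(2)[OF fm f(2)] by (simp add: L2_def)
  obtain r where r: "strict_mono r"
    and lim: "AE \<xi> in lborel. (\<lambda>n. (cmod (fourier f \<xi> - ft (trunc f (real (r n))) \<xi>))\<^sup>2) \<longlonglongrightarrow> 0"
    using nn_integral_tendsto_0_AE_subseq[OF _ _ fourier_seq[OF fm f(2)]] by auto
  have "(\<lambda>n. ft (trunc f (real (r n))) \<xi>) \<longlonglongrightarrow> ft (\<lambda>x. complex_of_real (f x)) \<xi>" for \<xi>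
    unfolding ft_def
  proof (rule integral_dominated_convergence)
    show "integrable lborel (\<lambda>x. \<bar>f x\<bar>)" using f by simp
    show "AE x in lborel. (\<lambda>n. trunc f (real (r n)) x * cis (- (x * \<xi>))) \<longlonglongrightarrow> complex_of_real (f x) * cis (- (x * \<xi>))"
    proof (rule AE_I2, rule tendsto_eventually)
      fix x :: real
      show "\<forall>\<^sub>F n in sequentially. trunc f (real (r n)) x * cis (- (x * \<xi>)) = complex_of_real (f x) * cis (- (x * \<xi>))"
      proof (rule eventually_mono[OF eventually_ge_at_top[of "nat \<lceil>\<bar>x\<bar>\<rceil>"]])
        fix n assume "n \<ge> nat \<lceil>\<bar>x\<bar>\<rceil>"
        with seq_suble[OF r, of n] have "\<bar>x\<bar> \<le> real (r n)" by linarith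
        then show "trunc f (real (r n)) x * cis (- (x * \<xi>)) = complex_of_real (f x) * cis (- (x * \<xi>))"
          by (auto simp: trunc_def indicator_def)
      qed
    qed
    show "AE x in lborel. cmod (trunc f (real (r n)) x * cis (- (x * \<xi>))) \<le> \<bar>f x\<bar>" for n
      by (auto simp: norm_mult trunc_def indicator_def)
  qed (auto simp: trunc_def)
  note c = this
  show ?thesis using lim
  proof eventually_elim
    fix \<xi> assume "(\<lambda>n. (cmod (fourier f \<xi> - ft (trunc f (real (r n))) \<xi>))\<^sup>2) \<longlonglongrightarrow> 0"
    moreover have "(\<lambda>n. (cmod (fourier f \<xi> - ft (trunc f (real (r n))) \<xi>))\<^sup>2) \<longlonglongrightarrow> (cmod (fourier f \<xi> - ft (\<lambda>x. complex_of_real (f x)) \<xi>))\<^sup>2"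
      by (intro tendsto_intros c)
    ultimately show "fourier f \<xi> = ft (\<lambda>x. complex_of_real (f x)) \<xi>"
      using LIMSEQ_unique by fastforce
  qed
qed

lemma square_integrable_linear_combination:
  fixes f g :: "real \<Rightarrow> real"
  assumes f: "f \<in> borel_measurable lborel" "integrable lborel (\<lambda>x. (f x)\<^sup>2)"
    and g: "g \<in> borel_measurable lborel" "integrable lborel (\<lambda>x. (g x)\<^sup>2)"
  shows "(\<lambda>x. a * f x + b * g x) \<in> borel_measurable lborel"
    and "integrable lborel (\<lambda>x. (a * f x + b * g x)\<^sup>2)"
proof -
  show m: "(\<lambda>x. a * f x + b * g x) \<in> borel_measurable lborel" using f(1) g(1) by simp
  have i: "integrable lborel (\<lambda>x. 2 * a\<^sup>2 * (f x)\<^sup>2 + 2 * b\<^sup>2 * (g x)\<^sup>2)" using f g by simp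
  have "(a * y + b * z)\<^sup>2 \<le> 2 * a\<^sup>2 * y\<^sup>2 + 2 * b\<^sup>2 * z\<^sup>2" for y z
    using sum_squares_bound[of "a * y" "b * z"] by (simp add: power2_sum power_mult_distrib)
  then show "integrable lborel (\<lambda>x. (a * f x + b * g x)\<^sup>2)"
    using m by (intro Bochner_Integration.integrable_bound[OF i]) auto
qed

text \<open>
  Linearity holds for the truncations. One subsequence along which all three \<open>L\<^sup>2\<close>-limits hold almost
  everywhere is obtained by applying the extraction to the sum of the three squared errors.
\<close>
lemma fourier_linear_AE:
  assumes f: "f \<in> borel_measurable lborel" "integrable lborel (\<lambda>x. (f x)\<^sup>2)"
    and g: "g \<in> borel_measurable lborel" "integrable lborel (\<lambda>x. (g x)\<^sup>2)"
  shows "AE \<xi> in lborel. fourier (\<lambda>x. a * f x + b * g x) \<xi> = a * fourier f \<xi> + b * fourier g \<xi>"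
proof -
  let ?h = "\<lambda>x. a * f x + b * g x"
  note h = square_integrable_linear_combination[OF f g, of a b]
  have [measurable]: "fourier f \<in> borel_measurable borel" "fourier g \<in> borel_measurable borel" "fourier ?h \<in> borel_measurable borel"
    using fourier_spec(1)[OF f] fourier_spec(1)[OF g] fourier_spec(1)[OF h] by auto
  have [measurable]: "ft (trunc f R) \<in> borel_measurable borel" "ft (trunc g R) \<in> borel_measurable borel"
       "ft (trunc ?h R) \<in> borel_measurable borel" for R
    using ft_measurable trunc_square_integrable(2)[OF f] trunc_square_integrable(2)[OF g] trunc_square_integrable(2)[OF h] by (auto simp: L2_def)
  let ?u = "\<lambda>q n \<xi>. (cmod (fourier q \<xi> - ft (trunc q (real n)) \<xi>))\<^sup>2"
  have "\<exists>r. strict_mono r \<and> (AE \<xi> in lborel. (\<lambda>n. ?u f (r n) \<xi> + ?u g (r n) \<xi> + ?u ?h (r n) \<xi>) \<longlonglongrightarrow> 0)"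
  proof (rule nn_integral_tendsto_0_AE_subseq)
    have "(\<lambda>n. (\<integral>\<^sup>+\<xi>. ennreal (?u f n \<xi>) \<partial>lborel) + (\<integral>\<^sup>+\<xi>. ennreal (?u g n \<xi>) \<partial>lborel) + (\<integral>\<^sup>+\<xi>. ennreal (?u ?h n \<xi>) \<partial>lborel)) \<longlonglongrightarrow> 0 + 0 + 0"
      by (intro tendsto_add fourier_seq f g h)
    then show "(\<lambda>n. \<integral>\<^sup>+\<xi>. ennreal (?u f n \<xi> + ?u g n \<xi> + ?u ?h n \<xi>) \<partial>lborel) \<longlonglongrightarrow> 0"
      by (simp add: ennreal_plus nn_integral_add)
  qed simp_all
  then obtain r where lim: "AE \<xi> in lborel. (\<lambda>n. ?u f (r n) \<xi> + ?u g (r n) \<xi> + ?u ?h (r n) \<xi>) \<longlonglongrightarrow> 0" by blast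
  have eq: "ft (trunc ?h R) \<xi> = a * ft (trunc f R) \<xi> + b * ft (trunc g R) \<xi>" for R \<xi>
  proof -
    have "trunc ?h R = (\<lambda>x. of_real a * trunc f R x + of_real b * trunc g R x)"
      by (auto simp: trunc_def scaleR_conv_of_real algebra_simps)
    then show ?thesis
      using ft_linear[OF trunc_square_integrable(1)[OF f, of R] trunc_square_integrable(1)[OF g, of R]] by simp
  qed
  show ?thesis using lim
  proof eventually_elim
    fix \<xi> assume l: "(\<lambda>n. ?u f (r n) \<xi> + ?u g (r n) \<xi> + ?u ?h (r n) \<xi>) \<longlonglongrightarrow> 0"
    have sub: "(\<lambda>n. ft (trunc q (real (r n))) \<xi>) \<longlonglongrightarrow> fourier q \<xi>"
      if le: "\<And>n. ?u q (r n) \<xi> \<le> ?u f (r n) \<xi> + ?u g (r n) \<xi> + ?u ?h (r n) \<xi>" for q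
    proof -
      have "(\<lambda>n. ?u q (r n) \<xi>) \<longlonglongrightarrow> 0"
        by (rule tendsto_sandwich[OF _ _ tendsto_const l]) (use le in auto)
      then have "(\<lambda>n. sqrt (?u q (r n) \<xi>)) \<longlonglongrightarrow> sqrt 0" by (intro tendsto_intros)
      then have "(\<lambda>n. cmod (ft (trunc q (real (r n))) \<xi> - fourier q \<xi>)) \<longlonglongrightarrow> 0" by (simp add: norm_minus_commute)
      then show ?thesis by (simp add: tendsto_norm_zero_iff LIM_zero_iff)
    qed
    have "(\<lambda>n. ft (trunc f (real (r n))) \<xi>) \<longlonglongrightarrow> fourier f \<xi>" by (rule sub) simp
    moreover have "(\<lambda>n. ft (trunc g (real (r n))) \<xi>) \<longlonglongrightarrow> fourier g \<xi>" by (rule sub) simp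
    ultimately have "(\<lambda>n. ft (trunc ?h (real (r n))) \<xi>) \<longlonglongrightarrow> a * fourier f \<xi> + b * fourier g \<xi>"
      unfolding eq by (intro tendsto_intros)
    moreover have "(\<lambda>n. ft (trunc ?h (real (r n))) \<xi>) \<longlonglongrightarrow> fourier ?h \<xi>" by (rule sub) simp
    ultimately show "fourier ?h \<xi> = a * fourier f \<xi> + b * fourier g \<xi>"
      using LIMSEQ_unique by blast
  qed
qed

section \<open>Fourier inversion\<close>

lemma L2_of_real_iff:
  "L2 (\<lambda>x. complex_of_real (f x)) \<longleftrightarrow> f \<in> borel_measurable lborel \<and> integrable lborel (\<lambda>x. (f x)\<^sup>2)"
proof
  assume L: "L2 (\<lambda>x. complex_of_real (f x))"
  then have "(\<lambda>x. Re (complex_of_real (f x))) \<in> borel_measurable lborel"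
    unfolding L2_def by (intro measurable_compose[OF _ borel_measurable_Re]) simp
  then show "f \<in> borel_measurable lborel \<and> integrable lborel (\<lambda>x. (f x)\<^sup>2)"
    using L by (simp add: L2_def)
qed (auto simp: L2_def)

lemma L2_diff:
  assumes "L2 f" "L2 g"
  shows "L2 (\<lambda>x. f x - g x)"
proof -
  have [measurable]: "f \<in> borel_measurable borel" "g \<in> borel_measurable borel" using assms by (auto simp: L2_def)
  have i: "integrable lborel (\<lambda>x. 2 * (cmod (f x))\<^sup>2 + 2 * (cmod (g x))\<^sup>2)"
    using assms by (simp add: L2_def)
  have "(cmod (a - b))\<^sup>2 \<le> 2 * (cmod a)\<^sup>2 + 2 * (cmod b)\<^sup>2" for a b
  proof -
    have "(cmod (a - b))\<^sup>2 \<le> (cmod a + cmod b)\<^sup>2" by (intro power_mono norm_triangle_ineq4) auto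
    also have "\<dots> \<le> 2 * (cmod a)\<^sup>2 + 2 * (cmod b)\<^sup>2"
      using sum_squares_bound[of "cmod a" "cmod b"] by (simp add: power2_sum)
    finally show ?thesis .
  qed
  then have "integrable lborel (\<lambda>x. (cmod (f x - g x))\<^sup>2)"
    by (intro Bochner_Integration.integrable_bound[OF i]) auto
  then show ?thesis by (simp add: L2_def)
qed

lemma lorentz_L2:
  assumes "\<epsilon> > 0"
  shows "L2 (\<lambda>y. complex_of_real (2 * \<epsilon> / (\<epsilon>\<^sup>2 + (y - x)\<^sup>2)))"
  unfolding L2_of_real_iff
proof
  let ?P = "\<lambda>y. 2 * \<epsilon> / (\<epsilon>\<^sup>2 + (y - x)\<^sup>2)"
  show m: "?P \<in> borel_measurable lborel" by measurable
  show "integrable lborel (\<lambda>y. (?P y)\<^sup>2)"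
  proof (rule Bochner_Integration.integrable_bound)
    show "integrable lborel (\<lambda>y. (2 / \<epsilon>) * ?P y)" using lorentz_integral(1)[OF assms, of x] by (rule integrable_mult_right)
    have "(?P y)\<^sup>2 \<le> (2 / \<epsilon>) * ?P y" for y
    proof -
      have "?P y \<le> 2 * \<epsilon> / \<epsilon>\<^sup>2" using assms by (intro divide_left_mono mult_pos_pos) (auto intro: add_pos_nonneg)
      also have "\<dots> = 2 / \<epsilon>" using assms by (simp add: power2_eq_square)
      finally show ?thesis unfolding power2_eq_square[of "?P y"] using assms by (intro mult_right_mono) auto
    qed
    then show "AE y in lborel. norm ((?P y)\<^sup>2) \<le> norm ((2 / \<epsilon>) * ?P y)"
      by (intro AE_I2) (smt (verit) real_norm_def zero_le_power2)
  qed (use m in measurable)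
qed

text \<open>
  For truncations this is \<open>ft_damped_inversion\<close>. Both sides pass to the limit because the damping factor and
  the Poisson kernel are square-integrable.
\<close>
lemma poisson_identity:
  assumes f: "f \<in> borel_measurable lborel" "integrable lborel (\<lambda>x. (f x)\<^sup>2)" and e: "\<epsilon> > 0"
  shows "(LBINT \<xi>. fourier f \<xi> * (complex_of_real (exp (- (\<epsilon> * \<bar>\<xi>\<bar>))) * cis (x * \<xi>)))
    = complex_of_real (LBINT y. f y * (2 * \<epsilon> / (\<epsilon>\<^sup>2 + (y - x)\<^sup>2)))"
proof -
  let ?P = "\<lambda>y. 2 * \<epsilon> / (\<epsilon>\<^sup>2 + (y - x)\<^sup>2)"
  let ?E = "\<lambda>\<xi>. complex_of_real (exp (- (\<epsilon> * \<bar>\<xi>\<bar>))) * cis (x * \<xi>)"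
  let ?g = "\<lambda>n. ft (trunc f (real n))"
  have [measurable]: "f \<in> borel_measurable borel" using f by simp
  have [measurable]: "trunc f R \<in> borel_measurable borel" for R unfolding trunc_def[abs_def] by measurable
  have E: "L2 ?E"
    unfolding L2_def
  proof
    have i: "integrable lborel (\<lambda>\<xi>. exp (- ((2 * \<epsilon>) * \<bar>\<xi>\<bar>)))"
      using exp_abs_ft(1)[of "2 * \<epsilon>"] e unfolding complex_of_real_integrable_eq by simp
    have "(cmod (?E \<xi>))\<^sup>2 = exp (- ((2 * \<epsilon>) * \<bar>\<xi>\<bar>))" for \<xi>
    proof -
      have "cmod (?E \<xi>) = exp (- (\<epsilon> * \<bar>\<xi>\<bar>))" by (simp add: norm_mult)
      then show ?thesis by (simp only: exp_double[symmetric]) (simp only: mult.assoc mult_minus_right)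
    qed
    then show "integrable lborel (\<lambda>\<xi>. (cmod (?E \<xi>))\<^sup>2)" using i by (simp only:)
  qed measurable
  have H: "L2 (fourier f)" by (rule fourier_L2[OF f])
  have g: "L2 (?g n)" for n by (rule plancherel_bound(1)[OF trunc_square_integrable[OF f]])
  have fL: "L2 (\<lambda>x. complex_of_real (f x))" using f by (simp add: L2_of_real_iff)
  have lhs: "(\<lambda>n. LBINT \<xi>. ?g n \<xi> * ?E \<xi>) \<longlonglongrightarrow> (LBINT \<xi>. fourier f \<xi> * ?E \<xi>)"
  proof -
    let ?N = "\<lambda>n. LBINT \<xi>. (cmod (fourier f \<xi> - ?g n \<xi>))\<^sup>2"
    have d: "L2 (\<lambda>\<xi>. fourier f \<xi> - ?g n \<xi>)" for n by (rule L2_diff[OF H g])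
    have "?N n = enn2real (\<integral>\<^sup>+\<xi>. ennreal ((cmod (fourier f \<xi> - ?g n \<xi>))\<^sup>2) \<partial>lborel)" for n
      using d[of n] by (intro integral_eq_nn_integral) (auto simp: L2_def)
    then have N: "?N \<longlonglongrightarrow> 0"
      using tendsto_enn2real[of "\<lambda>n. \<integral>\<^sup>+\<xi>. ennreal ((cmod (fourier f \<xi> - ?g n \<xi>))\<^sup>2) \<partial>lborel" 0] fourier_seq[OF f] by simp
    have le: "cmod ((LBINT \<xi>. ?g n \<xi> * ?E \<xi>) - (LBINT \<xi>. fourier f \<xi> * ?E \<xi>)) \<le> sqrt (?N n * (LBINT \<xi>. (cmod (?E \<xi>))\<^sup>2))" for n
    proof -
      have "cmod ((LBINT \<xi>. ?g n \<xi> * ?E \<xi>) - (LBINT \<xi>. fourier f \<xi> * ?E \<xi>))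
          = cmod ((LBINT \<xi>. fourier f \<xi> * ?E \<xi>) - (LBINT \<xi>. ?g n \<xi> * ?E \<xi>))"
        by (rule norm_minus_commute)
      also have "\<dots> = cmod (LBINT \<xi>. (fourier f \<xi> - ?g n \<xi>) * ?E \<xi>)"
        unfolding left_diff_distrib
        by (subst Bochner_Integration.integral_diff) (intro L2_mult_integrable H g E refl)+
      also have "\<dots> \<le> (LBINT \<xi>. cmod ((fourier f \<xi> - ?g n \<xi>) * ?E \<xi>))" by (rule integral_norm_bound)
      also have "\<dots> = (LBINT \<xi>. cmod (fourier f \<xi> - ?g n \<xi>) * cmod (?E \<xi>))" by (simp only: norm_mult)
      also have "\<dots> \<le> sqrt (?N n * (LBINT \<xi>. (cmod (?E \<xi>))\<^sup>2))"
        by (rule real_le_rsqrt[OF L2_Cauchy_Schwarz[OF d E]])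
      finally show ?thesis .
    qed
    have "(\<lambda>n. sqrt (?N n * (LBINT \<xi>. (cmod (?E \<xi>))\<^sup>2))) \<longlonglongrightarrow> sqrt (0 * (LBINT \<xi>. (cmod (?E \<xi>))\<^sup>2))"
      by (intro tendsto_intros N)
    then have lim: "(\<lambda>n. sqrt (?N n * (LBINT \<xi>. (cmod (?E \<xi>))\<^sup>2))) \<longlonglongrightarrow> 0"
      by (simp only: mult_zero_left real_sqrt_zero)
    have "(\<lambda>n. (LBINT \<xi>. ?g n \<xi> * ?E \<xi>) - (LBINT \<xi>. fourier f \<xi> * ?E \<xi>)) \<longlonglongrightarrow> 0"
      by (rule Lim_null_comparison[OF always_eventually[OF allI[OF le]] lim])
    then show ?thesis by (rule LIM_zero_cancel)
  qed
  have eq: "(LBINT \<xi>. ?g n \<xi> * ?E \<xi>) = (LBINT y. trunc f (real n) y * complex_of_real (?P y))" for n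
    by (rule ft_damped_inversion[OF trunc_square_integrable(1)[OF f] e])
  have "(\<lambda>n. LBINT y. trunc f (real n) y * complex_of_real (?P y)) \<longlonglongrightarrow> (LBINT y. complex_of_real (f y) * complex_of_real (?P y))"
  proof (rule integral_dominated_convergence)
    show "integrable lborel (\<lambda>y. cmod (complex_of_real (f y)) * cmod (complex_of_real (?P y)))"
      by (rule L2_cmod_mult_integrable[OF fL lorentz_L2[OF e]])
    show "AE y in lborel. (\<lambda>n. trunc f (real n) y * complex_of_real (?P y)) \<longlonglongrightarrow> complex_of_real (f y) * complex_of_real (?P y)"
    proof (rule AE_I2, rule tendsto_eventually)
      fix y :: real
      show "\<forall>\<^sub>F n in sequentially. trunc f (real n) y * complex_of_real (?P y) = complex_of_real (f y) * complex_of_real (?P y)"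
      proof (rule eventually_mono[OF eventually_ge_at_top[of "nat \<lceil>\<bar>y\<bar>\<rceil>"]])
        fix n assume "n \<ge> nat \<lceil>\<bar>y\<bar>\<rceil>"
        then have "\<bar>y\<bar> \<le> real n" by linarith
        then show "trunc f (real n) y * complex_of_real (?P y) = complex_of_real (f y) * complex_of_real (?P y)"
          by (auto simp: trunc_def indicator_def)
      qed
    qed
    show "AE y in lborel. cmod (trunc f (real n) y * complex_of_real (?P y)) \<le> cmod (complex_of_real (f y)) * cmod (complex_of_real (?P y))" for n
      unfolding norm_mult by (intro AE_I2 mult_right_mono) (auto simp: trunc_def indicator_def)
  qed measurable
  from LIMSEQ_unique[OF lhs[unfolded eq] this] show ?thesis
    by (simp only: of_real_mult[symmetric] integral_complex_of_real)
qed

text \<open>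
  The kernel is an approximate identity, but \<open>f\<close> need not be bounded, so the part near \<open>x\<close> and the part at
  distance at least \<open>1\<close> are treated separately. After rescaling, dominated convergence applies to the
  first; the second is of order \<open>\<epsilon>\<close>.
\<close>
lemma poisson_approximation:
  assumes f: "continuous_on UNIV f" "integrable lborel (\<lambda>x. (f x)\<^sup>2)"
  shows "(\<lambda>n. LBINT y. f y * (2 * (1 / real (Suc n)) / ((1 / real (Suc n))\<^sup>2 + (y - x)\<^sup>2))) \<longlonglongrightarrow> 2 * pi * f x"
proof -
  define P where "P \<epsilon> y = 2 * \<epsilon> / (\<epsilon>\<^sup>2 + (y - x)\<^sup>2)" for \<epsilon> y
  define e where "e n = 1 / real (Suc n)" for n
  have e: "e n > 0" for n by (simp add: e_def)
  have e0: "e \<longlonglongrightarrow> 0" unfolding e_def by (intro LIMSEQ_Suc lim_1_over_n)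
  have P0: "P (e n) y \<ge> 0" for n y unfolding P_def using e[of n] by simp
  have [measurable]: "f \<in> borel_measurable borel" by (rule borel_measurable_continuous_onI[OF f(1)])
  have [measurable]: "P \<epsilon> \<in> borel_measurable borel" for \<epsilon> unfolding P_def[abs_def] by measurable
  have fL: "L2 (\<lambda>x. complex_of_real (f x))" using f by (simp add: L2_of_real_iff)
  have fP: "integrable lborel (\<lambda>y. f y * P (e n) y)" for n
    using L2_mult_integrable[OF fL lorentz_L2[OF e, of n x]] unfolding P_def
    by (simp only: of_real_mult[symmetric] complex_of_real_integrable_eq)
  let ?A = "{y. \<bar>y - x\<bar> < 1}"
  have [measurable]: "?A \<in> sets borel" by measurable
  let ?f1 = "\<lambda>y. indicator ?A y * f y"
  let ?f2 = "\<lambda>y. indicator (- ?A) y * f y"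
  have i1: "integrable lborel (\<lambda>y. ?f1 y * P (e n) y)" and i2: "integrable lborel (\<lambda>y. ?f2 y * P (e n) y)" for n
    by (rule Bochner_Integration.integrable_bound[OF fP[of n]]; simp add: indicator_def)+
  have split: "(LBINT y. f y * P (e n) y) = (LBINT y. ?f1 y * P (e n) y) + (LBINT y. ?f2 y * P (e n) y)" for n
    by (subst Bochner_Integration.integral_add[symmetric, OF i1 i2], intro Bochner_Integration.integral_cong)
       (auto simp: indicator_def)
  have one: "(\<lambda>n. LBINT y. ?f1 y * P (e n) y) \<longlonglongrightarrow> 2 * pi * f x"
  proof -
    have sub: "(LBINT y. ?f1 y * P (e n) y) = (LBINT z. ?f1 (x + e n * z) * (2 / (1 + z\<^sup>2)))" for n
    proof -
      have eq: "e n * P (e n) (x + e n * z) = 2 / (1 + z\<^sup>2)" for z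
      proof -
        have p: "1 + z\<^sup>2 > 0" by (simp add: add_pos_nonneg)
        have "(e n)\<^sup>2 + (x + e n * z - x)\<^sup>2 = (e n)\<^sup>2 * (1 + z\<^sup>2)" by (simp add: power_mult_distrib algebra_simps)
        then show ?thesis unfolding P_def using e[of n] p by (simp add: power2_eq_square)
      qed
      have "(LBINT y. ?f1 y * P (e n) y) = e n * (LBINT z. ?f1 (x + e n * z) * P (e n) (x + e n * z))"
        using lborel_integral_real_affine[of "e n" "\<lambda>y. ?f1 y * P (e n) y" x] e[of n] by simp
      also have "\<dots> = (LBINT z. ?f1 (x + e n * z) * (e n * P (e n) (x + e n * z)))"
        by (subst integral_mult_right_zero[symmetric]) (simp only: mult_ac)
      finally show ?thesis unfolding eq .
    qed
    have "compact (f ` {x - 1..x + 1})"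
      using f(1) by (intro compact_continuous_image continuous_on_subset[OF f(1)]) auto
    then have "bounded (f ` {x - 1..x + 1})" by (rule compact_imp_bounded)
    then obtain B where "\<forall>v\<in>f ` {x - 1..x + 1}. norm v \<le> B" unfolding bounded_iff by blast
    then have B: "\<And>y. y \<in> {x - 1..x + 1} \<Longrightarrow> \<bar>f y\<bar> \<le> B" by simp
    have B0: "B \<ge> 0" using B[of x] by auto
    have f1B: "\<bar>?f1 y\<bar> \<le> B" for y using B[of y] B0 by (auto simp: indicator_def abs_less_iff)
    have k: "integrable lborel (\<lambda>z::real. 2 / (1 + z\<^sup>2))" and kI: "(LBINT z::real. 2 / (1 + z\<^sup>2)) = 2 * pi"
      using lorentz_integral[of 1 0] by auto
    have "(\<lambda>n. LBINT z. ?f1 (x + e n * z) * (2 / (1 + z\<^sup>2))) \<longlonglongrightarrow> (LBINT z. f x * (2 / (1 + z\<^sup>2)))"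
    proof (rule integral_dominated_convergence)
      show "integrable lborel (\<lambda>z. B * (2 / (1 + z\<^sup>2)))" using k by (rule integrable_mult_right)
      show "AE z in lborel. (\<lambda>n. ?f1 (x + e n * z) * (2 / (1 + z\<^sup>2))) \<longlonglongrightarrow> f x * (2 / (1 + z\<^sup>2))"
      proof (rule AE_I2)
        fix z
        have l: "(\<lambda>n. x + e n * z) \<longlonglongrightarrow> x + 0 * z" by (intro tendsto_intros e0)
        have "(\<lambda>n. f (x + e n * z)) \<longlonglongrightarrow> f x"
          using f(1) l by (intro continuous_on_tendsto_compose[OF f(1)]) auto
        moreover have "\<forall>\<^sub>F n in sequentially. f (x + e n * z) = ?f1 (x + e n * z)"
        proof -
          have "(\<lambda>n. \<bar>e n * z\<bar>) \<longlonglongrightarrow> \<bar>0 * z\<bar>" by (intro tendsto_intros e0)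
          then have "\<forall>\<^sub>F n in sequentially. \<bar>e n * z\<bar> < 1" using order_tendstoD(2)[of _ "0::real" _ 1] by simp
          then show ?thesis by eventually_elim (simp add: indicator_def)
        qed
        ultimately have "(\<lambda>n. ?f1 (x + e n * z)) \<longlonglongrightarrow> f x" by (rule Lim_transform_eventually)
        then show "(\<lambda>n. ?f1 (x + e n * z) * (2 / (1 + z\<^sup>2))) \<longlonglongrightarrow> f x * (2 / (1 + z\<^sup>2))"
          by (intro tendsto_intros)
      qed
      have "\<bar>?f1 y * (2 / (1 + z\<^sup>2))\<bar> \<le> B * (2 / (1 + z\<^sup>2))" for y z :: real
      proof -
        have "2 / (1 + z\<^sup>2) \<ge> 0" by simp
        then show ?thesis unfolding abs_mult using f1B[of y] by (simp only: abs_of_nonneg mult_right_mono)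
      qed
      then show "AE z in lborel. norm (?f1 (x + e n * z) * (2 / (1 + z\<^sup>2))) \<le> B * (2 / (1 + z\<^sup>2))" for n
        by (intro AE_I2) (simp only: real_norm_def)
    qed measurable
    also have "(LBINT z. f x * (2 / (1 + z\<^sup>2))) = 2 * pi * f x"
      unfolding integral_mult_right_zero kI by simp
    finally show ?thesis unfolding sub .
  qed
  have two: "(\<lambda>n. LBINT y. ?f2 y * P (e n) y) \<longlonglongrightarrow> 0"
  proof -
    define C where "C = (LBINT y. \<bar>f y\<bar> * (2 * 1 / (1\<^sup>2 + (y - x)\<^sup>2)))"
    have iC: "integrable lborel (\<lambda>y. \<bar>f y\<bar> * (2 * 1 / (1\<^sup>2 + (y - x)\<^sup>2)))"
      using L2_cmod_mult_integrable[OF fL lorentz_L2[of 1 x]] unfolding norm_of_real by simp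
    \<comment> \<open>Away from \<open>x\<close> the kernel of width \<open>e n\<close> is at most \<open>2 * e n\<close> times the kernel of width \<open>1\<close>,
       which is square-integrable, so its product with \<open>f\<close> is integrable.\<close>
    have le: "norm (?f2 y * P (e n) y) \<le> (2 * e n) * (\<bar>f y\<bar> * (2 * 1 / (1\<^sup>2 + (y - x)\<^sup>2)))" for n y
    proof (cases "y \<in> ?A")
      case False
      then have a: "1 \<le> \<bar>y - x\<bar>" by simp
      then have s: "1 \<le> (y - x)\<^sup>2" using abs_le_square_iff[of 1 "y - x"] by simp
      have "P (e n) y \<le> 2 * e n / (y - x)\<^sup>2"
        unfolding P_def using s e[of n] by (intro divide_left_mono mult_pos_pos add_pos_pos) auto
      also have "\<dots> = (2 * e n) * (2 / (2 * (y - x)\<^sup>2))" by simp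
      also have "\<dots> \<le> (2 * e n) * (2 / (1 + (y - x)\<^sup>2))"
        using s e[of n] by (intro mult_left_mono divide_left_mono mult_pos_pos add_pos_pos) auto
      finally have "\<bar>f y\<bar> * P (e n) y \<le> \<bar>f y\<bar> * ((2 * e n) * (2 / (1 + (y - x)\<^sup>2)))"
        by (rule mult_left_mono) simp
      moreover have "norm (?f2 y * P (e n) y) = \<bar>f y\<bar> * P (e n) y"
        using False P0[of n y] by (simp add: indicator_def abs_mult)
      ultimately show ?thesis by (simp only: mult_ac power_one)
    qed (use e[of n] in \<open>simp add: indicator_def\<close>)
    have le2: "norm (LBINT y. ?f2 y * P (e n) y) \<le> 2 * e n * C" for n
    proof -
      have "norm (LBINT y. ?f2 y * P (e n) y) \<le> (LBINT y. norm (?f2 y * P (e n) y))" by (rule integral_norm_bound)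
      also have "\<dots> \<le> (LBINT y. (2 * e n) * (\<bar>f y\<bar> * (2 * 1 / (1\<^sup>2 + (y - x)\<^sup>2))))"
        by (intro Bochner_Integration.integral_mono le integrable_mult_right iC integrable_norm i2)
      also have "\<dots> = 2 * e n * C" unfolding C_def integral_mult_right_zero ..
      finally show ?thesis .
    qed
    have "(\<lambda>n. 2 * e n * C) \<longlonglongrightarrow> 2 * 0 * C" by (intro tendsto_intros e0)
    then have lim: "(\<lambda>n. 2 * e n * C) \<longlonglongrightarrow> 0" by simp
    show ?thesis by (rule Lim_null_comparison[OF always_eventually[OF allI[OF le2]] lim])
  qed
  have "(\<lambda>n. LBINT y. f y * P (e n) y) \<longlonglongrightarrow> 2 * pi * f x + 0"
    unfolding split by (intro tendsto_add one two)
  then show ?thesis unfolding P_def e_def add_0_right .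
qed

lemma fourier_inversion:
  assumes f: "continuous_on UNIV f" "integrable lborel (\<lambda>x. (f x)\<^sup>2)"
    and H: "integrable lborel (fourier f)"
  shows "ft (fourier f) (- x) = complex_of_real (2 * pi * f x)"
proof -
  define e where "e n = 1 / real (Suc n)" for n
  have e: "e n > 0" for n by (simp add: e_def)
  have e0: "e \<longlonglongrightarrow> 0" unfolding e_def by (intro LIMSEQ_Suc lim_1_over_n)
  have [measurable]: "f \<in> borel_measurable borel" by (rule borel_measurable_continuous_onI[OF f(1)])
  have fm: "f \<in> borel_measurable lborel" by simp
  have [measurable]: "fourier f \<in> borel_measurable borel" using H by auto
  have "(\<lambda>n. LBINT \<xi>. fourier f \<xi> * (complex_of_real (exp (- (e n * \<bar>\<xi>\<bar>))) * cis (x * \<xi>)))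
     \<longlonglongrightarrow> (LBINT \<xi>. fourier f \<xi> * (complex_of_real (exp (- (0 * \<bar>\<xi>\<bar>))) * cis (x * \<xi>)))"
  proof (rule integral_dominated_convergence)
    show "integrable lborel (\<lambda>\<xi>. cmod (fourier f \<xi>))" using H by simp
    show "AE \<xi> in lborel. (\<lambda>n. fourier f \<xi> * (complex_of_real (exp (- (e n * \<bar>\<xi>\<bar>))) * cis (x * \<xi>)))
        \<longlonglongrightarrow> fourier f \<xi> * (complex_of_real (exp (- (0 * \<bar>\<xi>\<bar>))) * cis (x * \<xi>))"
      by (intro AE_I2 tendsto_intros e0)
    have "cmod (fourier f \<xi> * (complex_of_real (exp (- (e n * \<bar>\<xi>\<bar>))) * cis (x * \<xi>))) \<le> cmod (fourier f \<xi>)" for n \<xi>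
      using e[of n] by (simp add: norm_mult mult_left_le)
    then show "AE \<xi> in lborel. cmod (fourier f \<xi> * (complex_of_real (exp (- (e n * \<bar>\<xi>\<bar>))) * cis (x * \<xi>))) \<le> cmod (fourier f \<xi>)" for n
      by simp
  qed measurable
  moreover have "(\<lambda>n. LBINT \<xi>. fourier f \<xi> * (complex_of_real (exp (- (e n * \<bar>\<xi>\<bar>))) * cis (x * \<xi>)))
      \<longlonglongrightarrow> complex_of_real (2 * pi * f x)"
    unfolding poisson_identity[OF fm f(2) e] unfolding e_def
    by (intro tendsto_of_real poisson_approximation f)
  ultimately have "(LBINT \<xi>. fourier f \<xi> * (complex_of_real (exp (- (0 * \<bar>\<xi>\<bar>))) * cis (x * \<xi>))) = complex_of_real (2 * pi * f x)"
    by (rule LIMSEQ_unique)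
  then show ?thesis unfolding ft_def by (simp add: mult.commute)
qed

section \<open>Sobolev embedding\<close>

lemma cmod_cis_diff: "cmod (cis a - cis b) \<le> \<bar>a - b\<bar>"
proof -
  have "cmod (cis t - 1) \<le> \<bar>t\<bar>" for t
  proof -
    have "(cmod (cis t - 1))\<^sup>2 = (2 * sin (t / 2))\<^sup>2"
    proof -
      have "cos t = 1 - 2 * (sin (t / 2))\<^sup>2" using cos_double_sin[of "t / 2"] by simp
      moreover have "(cmod (cis t - 1))\<^sup>2 = 2 - 2 * cos t"
        by (simp add: cmod_power2 power2_diff)
      ultimately show ?thesis by (simp add: power_mult_distrib)
    qed
    then have "cmod (cis t - 1) = \<bar>2 * sin (t / 2)\<bar>"
      by (metis norm_ge_zero abs_of_nonneg real_sqrt_abs)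
    also have "\<dots> \<le> \<bar>t\<bar>" using abs_sin_x_le_abs_x[of "t / 2"] by simp
    finally show ?thesis .
  qed
  from this[of "a - b"] have "cmod (cis b * (cis (a - b) - 1)) \<le> \<bar>a - b\<bar>" by (simp add: norm_mult)
  then show ?thesis by (simp add: right_diff_distrib cis_mult)
qed

lemma continuous_ft:
  assumes "integrable lborel k"
  shows "continuous_on UNIV (ft k)"
proof (rule continuous_at_imp_continuous_on, rule ballI, rule continuous_at_sequentiallyI)
  fix \<xi> :: real and u :: "nat \<Rightarrow> real"
  assume u: "u \<longlonglongrightarrow> \<xi>"
  have [measurable]: "k \<in> borel_measurable borel" using assms by auto
  show "(\<lambda>n. ft k (u n)) \<longlonglongrightarrow> ft k \<xi>"
    unfolding ft_def
  proof (rule integral_dominated_convergence)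
    show "integrable lborel (\<lambda>x. cmod (k x))" using assms by simp
    have c: "(\<lambda>n. cis (- (x * u n))) \<longlonglongrightarrow> cis (- (x * \<xi>))" for x
      using u by (intro isCont_tendsto_compose[of _ cis] tendsto_intros continuous_intros)
    show "AE x in lborel. (\<lambda>n. k x * cis (- (x * u n))) \<longlonglongrightarrow> k x * cis (- (x * \<xi>))"
      by (intro AE_I2 tendsto_mult tendsto_const c)
  qed (auto simp: norm_mult)
qed

text \<open>
  Differentiation under the integral sign; the difference quotients of \<open>cis\<close> are dominated by \<open>\<bar>\<xi>\<bar>\<close>.
\<close>
lemma has_derivative_Re_ft:
  assumes k: "integrable lborel k" and xk: "integrable lborel (\<lambda>\<xi>. \<i> * of_real \<xi> * k \<xi>)"
  shows "((\<lambda>x. Re (ft k (- x))) has_real_derivative Re (ft (\<lambda>\<xi>. \<i> * of_real \<xi> * k \<xi>) (- x))) (at x)"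
  unfolding DERIV_def LIMSEQ_SEQ_conv[symmetric]
proof (intro allI impI)
  fix h :: "nat \<Rightarrow> real" assume h: "(\<forall>n. h n \<noteq> 0) \<and> h \<longlonglongrightarrow> 0"
  have [measurable]: "k \<in> borel_measurable borel" using k by auto
  let ?q = "\<lambda>n \<xi>. (cis (\<xi> * (x + h n)) - cis (\<xi> * x)) / of_real (h n)"
  have lim: "(\<lambda>n. ?q n \<xi>) \<longlonglongrightarrow> \<i> * of_real \<xi> * cis (\<xi> * x)" for \<xi>
  proof -
    have "((\<lambda>y. cos (\<xi> * y)) has_real_derivative - (\<xi> * sin (\<xi> * x))) (at x)"
      and "((\<lambda>y. sin (\<xi> * y)) has_real_derivative \<xi> * cos (\<xi> * x)) (at x)"
      by (auto intro!: derivative_eq_intros)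
    then have "(\<lambda>n. (cos (\<xi> * (x + h n)) - cos (\<xi> * x)) / h n) \<longlonglongrightarrow> - (\<xi> * sin (\<xi> * x))"
      and "(\<lambda>n. (sin (\<xi> * (x + h n)) - sin (\<xi> * x)) / h n) \<longlonglongrightarrow> \<xi> * cos (\<xi> * x)"
      unfolding DERIV_def LIMSEQ_SEQ_conv[symmetric] using h by blast+
    then show ?thesis by (simp add: tendsto_complex_iff Re_divide_of_real Im_divide_of_real)
  qed
  have "(\<lambda>n. LBINT \<xi>. k \<xi> * ?q n \<xi>) \<longlonglongrightarrow> (LBINT \<xi>. k \<xi> * (\<i> * of_real \<xi> * cis (\<xi> * x)))"
  proof (rule integral_dominated_convergence)
    show "integrable lborel (\<lambda>\<xi>. cmod (\<i> * of_real \<xi> * k \<xi>))" using xk by (rule integrable_norm)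
    show "AE \<xi> in lborel. (\<lambda>n. k \<xi> * ?q n \<xi>) \<longlonglongrightarrow> k \<xi> * (\<i> * of_real \<xi> * cis (\<xi> * x))"
      by (intro AE_I2 tendsto_intros lim)
    have "cmod (k \<xi> * ?q n \<xi>) \<le> cmod (\<i> * of_real \<xi> * k \<xi>)" for n \<xi>
    proof -
      have "cmod (cis (\<xi> * (x + h n)) - cis (\<xi> * x)) \<le> \<bar>\<xi>\<bar> * \<bar>h n\<bar>"
        using cmod_cis_diff[of "\<xi> * (x + h n)" "\<xi> * x"] by (simp add: algebra_simps abs_mult)
      then have le: "cmod (?q n \<xi>) \<le> \<bar>\<xi>\<bar>" using h by (simp add: norm_divide divide_le_eq)
      have "cmod (k \<xi> * ?q n \<xi>) = cmod (?q n \<xi>) * cmod (k \<xi>)" by (simp only: norm_mult mult.commute)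
      also have "\<dots> \<le> \<bar>\<xi>\<bar> * cmod (k \<xi>)" by (rule mult_right_mono[OF le norm_ge_zero])
      also have "\<dots> = cmod (\<i> * of_real \<xi> * k \<xi>)" by (simp add: norm_mult)
      finally show ?thesis .
    qed
    then show "AE \<xi> in lborel. cmod (k \<xi> * ?q n \<xi>) \<le> cmod (\<i> * of_real \<xi> * k \<xi>)" for n by simp
  qed measurable
  then have "(\<lambda>n. Re (LBINT \<xi>. k \<xi> * ?q n \<xi>)) \<longlonglongrightarrow> Re (LBINT \<xi>. k \<xi> * (\<i> * of_real \<xi> * cis (\<xi> * x)))"
    by (rule tendsto_Re)
  moreover have "Re (LBINT \<xi>. k \<xi> * ?q n \<xi>) = (Re (ft k (- (x + h n))) - Re (ft k (- x))) / h n" for n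
  proof -
    have "(LBINT \<xi>. k \<xi> * ?q n \<xi>) = (LBINT \<xi>. (k \<xi> * cis (- (\<xi> * - (x + h n))) - k \<xi> * cis (- (\<xi> * - x))) / of_real (h n))"
      by (simp only: right_diff_distrib times_divide_eq_right mult_minus_right minus_minus)
    also have "\<dots> = (ft k (- (x + h n)) - ft k (- x)) / of_real (h n)"
      unfolding ft_def integral_divide_zero
      using Bochner_Integration.integral_diff[OF integrable_cis_mult(2)[OF k, of "- (x + h n)"] integrable_cis_mult(2)[OF k, of "- x"]]
      by (simp only:)
    finally have "(LBINT \<xi>. k \<xi> * ?q n \<xi>) = (ft k (- (x + h n)) - ft k (- x)) / of_real (h n)" .
    then show ?thesis by (simp only: Re_divide_of_real minus_complex.sel)
  qed
  moreover have "(LBINT \<xi>. k \<xi> * (\<i> * of_real \<xi> * cis (\<xi> * x))) = ft (\<lambda>\<xi>. \<i> * of_real \<xi> * k \<xi>) (- x)"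
    unfolding ft_def by (simp add: mult_ac)
  ultimately show "(\<lambda>n. (Re (ft k (- (x + h n))) - Re (ft k (- x))) / h n) \<longlonglongrightarrow> Re (ft (\<lambda>\<xi>. \<i> * of_real \<xi> * k \<xi>) (- x))"
    by (simp only:)
qed

lemma powr_integrable:
  fixes p :: real
  assumes "p > 1/2"
  shows "integrable lborel (\<lambda>\<xi>::real. (1 + \<xi>\<^sup>2) powr (- p))"
proof -
  let ?f = "\<lambda>x::real. (1 + x) powr (- (2 * p))"
  \<comment> \<open>Comparison with \<open>(1 + \<bar>\<xi>\<bar>) powr (- 2 * p)\<close>, which has an explicit antiderivative on the half-line.\<close>
  let ?F = "\<lambda>x::real. - ((1 + x) powr (1 - 2 * p)) / (2 * p - 1)"
  have "(\<integral>\<^sup>+x. ennreal (?f x) * indicator {0..} x \<partial>lborel) = 0 - ?F 0"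
  proof (rule nn_integral_FTC_atLeast)
    show "DERIV ?F x :> ?f x" if "0 \<le> x" for x
      using that assms by (auto intro!: derivative_eq_intros simp: divide_simps) (simp add: algebra_simps)
    have "((\<lambda>x::real. (1 + x) powr (1 - 2 * p)) \<longlongrightarrow> 0) at_top"
      using assms by (intro tendsto_neg_powr filterlim_tendsto_add_at_top[OF tendsto_const filterlim_ident]) auto
    then have "((\<lambda>x::real. - ((1 + x) powr (1 - 2 * p)) / (2 * p - 1)) \<longlongrightarrow> - 0 / (2 * p - 1)) at_top"
      using assms by (intro tendsto_intros) auto
    then show "(?F \<longlongrightarrow> 0) at_top" by simp
  qed auto
  moreover have "(\<integral>\<^sup>+x. ennreal (norm (indicator {0..} x * ?f x)) \<partial>lborel) = (\<integral>\<^sup>+x. ennreal (?f x) * indicator {0..} x \<partial>lborel)"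
    by (intro nn_integral_cong) (auto simp: indicator_def)
  ultimately have "integrable lborel (\<lambda>x. indicator {0..} x * ?f x)"
    unfolding integrable_iff_bounded by simp
  note i = this
  have i2: "integrable lborel (\<lambda>x. indicator {0..} (- x) * ?f (- x))"
    using lborel_integrable_real_affine[OF i, of "-1" 0] by simp
  have "integrable lborel (\<lambda>x. 2 powr p * (indicator {0..} x * ?f x + indicator {0..} (- x) * ?f (- x)))"
    using i i2 by simp
  then show ?thesis
  proof (rule Bochner_Integration.integrable_bound)
    have "(1 + \<xi>\<^sup>2) powr (- p) \<le> 2 powr p * ?f \<bar>\<xi>\<bar>" for \<xi>
    proof -
      have "(1 + \<bar>\<xi>\<bar>)\<^sup>2 / 2 \<le> 1 + \<xi>\<^sup>2"
        using sum_squares_bound[of 1 "\<bar>\<xi>\<bar>"] by (simp add: power2_sum)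
      then have "(1 + \<xi>\<^sup>2) powr (- p) \<le> ((1 + \<bar>\<xi>\<bar>)\<^sup>2 / 2) powr (- p)"
        using assms by (intro powr_mono2') auto
      also have "\<dots> = 2 powr p * ?f \<bar>\<xi>\<bar>"
        by (simp add: powr_divide powr_minus powr_powr powr_numeral[symmetric] divide_simps del: powr_numeral)
      finally show ?thesis .
    qed
    note le = this
    have "\<bar>(1 + \<xi>\<^sup>2) powr (- p)\<bar> \<le> \<bar>2 powr p * (indicator {0..} \<xi> * ?f \<xi> + indicator {0..} (- \<xi>) * ?f (- \<xi>))\<bar>" for \<xi>
    proof (cases "\<xi> \<ge> 0")
      case True
      then have "2 powr p * ?f \<bar>\<xi>\<bar> \<le> 2 powr p * (indicator {0..} \<xi> * ?f \<xi> + indicator {0..} (- \<xi>) * ?f (- \<xi>))"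
        by (simp add: indicator_def)
      then show ?thesis using le[of \<xi>] by (smt (verit) powr_ge_zero)
    next
      case False
      then have "2 powr p * ?f \<bar>\<xi>\<bar> \<le> 2 powr p * (indicator {0..} \<xi> * ?f \<xi> + indicator {0..} (- \<xi>) * ?f (- \<xi>))"
        by (simp add: indicator_def)
      then show ?thesis using le[of \<xi>] by (smt (verit) powr_ge_zero)
    qed
    then show "AE \<xi> in lborel. norm ((1 + \<xi>\<^sup>2) powr (- p)) \<le> norm (2 powr p * (indicator {0..} \<xi> * ?f \<xi> + indicator {0..} (- \<xi>) * ?f (- \<xi>)))"
      by simp
  qed measurable
qed

text \<open>
  The inverse transform of \<open>(\<i> * \<xi>) ^ j\<close> times the transform of \<open>f\<close>: the \<open>j\<close>-th derivative of
  \<open>f\<close> whenever \<open>j + 1/2 < r\<close> and \<open>f \<in> H\<^sup>r\<close> is continuous.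
\<close>
definition sob_deriv :: "nat \<Rightarrow> (real \<Rightarrow> real) \<Rightarrow> real \<Rightarrow> real" where
  "sob_deriv j f x = Re (ft (\<lambda>\<xi>. (\<i> * of_real \<xi>) ^ j * fourier f \<xi>) (- x)) / (2 * pi)"

text \<open>
  The constant of the embedding of \<open>H\<^sup>r\<close> into the functions with \<open>j\<close> bounded derivatives, which the
  Cauchy-Schwarz inequality produces.
\<close>
definition sob_const :: "nat \<Rightarrow> real \<Rightarrow> real" where
  "sob_const j r = sqrt (LBINT \<xi>. (1 + \<xi>\<^sup>2) powr (real j - r))"

lemma sobolevD:
  assumes "f \<in> sobolev r"
  shows "f \<in> borel_measurable lborel" "integrable lborel (\<lambda>x. (f x)\<^sup>2)"
    "integrable lborel (\<lambda>\<xi>. (1 + \<xi>\<^sup>2) powr r * (cmod (fourier f \<xi>))\<^sup>2)"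
    "fourier f \<in> borel_measurable lborel"
  using assms fourier_spec(1)[of f] by (auto simp: sobolev_def)

lemma abs_power_le_powr: "\<bar>\<xi>\<bar> ^ (2 * j) \<le> (1 + \<xi>\<^sup>2) powr real j" for \<xi> :: real
proof -
  have "\<bar>\<xi>\<bar> ^ (2 * j) = (\<xi>\<^sup>2) ^ j" by (simp add: power_mult)
  also have "\<dots> \<le> (1 + \<xi>\<^sup>2) ^ j" by (intro power_mono) auto
  also have "\<dots> = (1 + \<xi>\<^sup>2) powr real j" by (subst powr_realpow) (auto simp: add_pos_nonneg)
  finally show ?thesis .
qed

text \<open>
  The weight \<open>(1 + \<xi>\<^sup>2) powr (r / 2)\<close> times the transform is square-integrable, and the
  remaining factor is square-integrable exactly when \<open>r - j > 1/2\<close>.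
\<close>
lemma sobolev_weighted:
  assumes f: "f \<in> sobolev r" and j: "real j + 1 / 2 < r"
  shows "integrable lborel (\<lambda>\<xi>. (\<i> * of_real \<xi>) ^ j * fourier f \<xi>)"
    and "L2 (\<lambda>\<xi>. (\<i> * of_real \<xi>) ^ j * fourier f \<xi>)"
    and "(LBINT \<xi>. cmod ((\<i> * of_real \<xi>) ^ j * fourier f \<xi>)) \<le> sob_const j r * sobolev_norm r f"
proof -
  note D = sobolevD[OF f]
  have [measurable]: "fourier f \<in> borel_measurable borel" using D(4) by simp
  let ?k = "\<lambda>\<xi>. (\<i> * of_real \<xi>) ^ j * fourier f \<xi>"
  let ?a = "\<lambda>\<xi>. complex_of_real ((1 + \<xi>\<^sup>2) powr ((real j - r) / 2))"
  let ?b = "\<lambda>\<xi>. complex_of_real ((1 + \<xi>\<^sup>2) powr (r / 2)) * fourier f \<xi>"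
  have sq: "((1 + \<xi>\<^sup>2) powr (c / 2))\<^sup>2 = (1 + \<xi>\<^sup>2) powr c" for c \<xi> :: real
    by (simp add: power2_eq_square powr_add[symmetric])
  have a2: "(cmod (?a \<xi>))\<^sup>2 = (1 + \<xi>\<^sup>2) powr (real j - r)" for \<xi> using sq by simp
  have b2: "(cmod (?b \<xi>))\<^sup>2 = (1 + \<xi>\<^sup>2) powr r * (cmod (fourier f \<xi>))\<^sup>2" for \<xi>
    using sq by (simp add: norm_mult power_mult_distrib)
  have kn: "cmod (?k \<xi>) = \<bar>\<xi>\<bar> ^ j * cmod (fourier f \<xi>)" for \<xi>
    by (simp add: norm_mult norm_power)
  have k_le: "cmod (?k \<xi>) \<le> cmod (?a \<xi>) * cmod (?b \<xi>)" for \<xi>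
  proof -
    have "\<bar>\<xi>\<bar> ^ j \<le> (1 + \<xi>\<^sup>2) powr (real j / 2)"
      by (rule power2_le_imp_le) (use abs_power_le_powr[of \<xi> j] sq in \<open>auto simp: power_mult[symmetric] mult.commute\<close>)
    also have "\<dots> = (1 + \<xi>\<^sup>2) powr ((real j - r) / 2) * (1 + \<xi>\<^sup>2) powr (r / 2)"
      by (simp add: powr_add[symmetric] diff_divide_distrib)
    finally have "\<bar>\<xi>\<bar> ^ j * cmod (fourier f \<xi>) \<le> (1 + \<xi>\<^sup>2) powr ((real j - r) / 2) * (1 + \<xi>\<^sup>2) powr (r / 2) * cmod (fourier f \<xi>)"
      by (rule mult_right_mono) simp
    also have "\<dots> = cmod (?a \<xi>) * cmod (?b \<xi>)" by (simp add: norm_mult)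
    finally show ?thesis unfolding kn .
  qed
  have aL: "L2 ?a" unfolding L2_def a2 using powr_integrable[of "r - real j"] j by simp
  have bL: "L2 ?b" unfolding L2_def b2 using D by simp
  have ab: "integrable lborel (\<lambda>\<xi>. cmod (?a \<xi>) * cmod (?b \<xi>))" by (rule L2_cmod_mult_integrable[OF aL bL])
  show ki: "integrable lborel ?k"
    by (rule Bochner_Integration.integrable_bound[OF ab]) (use k_le in auto)
  have "(LBINT \<xi>. cmod (?k \<xi>)) \<le> (LBINT \<xi>. cmod (?a \<xi>) * cmod (?b \<xi>))"
    by (intro Bochner_Integration.integral_mono integrable_norm ki ab k_le)
  also have "\<dots> \<le> sqrt ((LBINT \<xi>. (cmod (?a \<xi>))\<^sup>2) * (LBINT \<xi>. (cmod (?b \<xi>))\<^sup>2))"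
    by (rule real_le_rsqrt[OF L2_Cauchy_Schwarz[OF aL bL]])
  also have "\<dots> = sob_const j r * sobolev_norm r f"
    unfolding a2 b2 sob_const_def sobolev_norm_def real_sqrt_mult ..
  finally show "(LBINT \<xi>. cmod (?k \<xi>)) \<le> sob_const j r * sobolev_norm r f" .
  show "L2 ?k" unfolding L2_def
  proof
    show "integrable lborel (\<lambda>\<xi>. (cmod (?k \<xi>))\<^sup>2)"
    proof (rule Bochner_Integration.integrable_bound[OF D(3)])
      have "(cmod (?k \<xi>))\<^sup>2 \<le> (1 + \<xi>\<^sup>2) powr r * (cmod (fourier f \<xi>))\<^sup>2" for \<xi>
      proof -
        have "(cmod (?k \<xi>))\<^sup>2 = \<bar>\<xi>\<bar> ^ (2 * j) * (cmod (fourier f \<xi>))\<^sup>2"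
          unfolding kn by (simp add: power_mult_distrib power_mult[symmetric] mult.commute)
        also have "\<dots> \<le> (1 + \<xi>\<^sup>2) powr r * (cmod (fourier f \<xi>))\<^sup>2"
          using j by (intro mult_right_mono order_trans[OF abs_power_le_powr] powr_mono) auto
        finally show ?thesis .
      qed
      then show "AE \<xi> in lborel. norm ((cmod (?k \<xi>))\<^sup>2) \<le> norm ((1 + \<xi>\<^sup>2) powr r * (cmod (fourier f \<xi>))\<^sup>2)"
        by (intro AE_I2) (simp add: abs_mult)
    qed measurable
  qed measurable
qed

lemma sob_deriv_bound:
  assumes f: "f \<in> sobolev r" and j: "real j + 1 / 2 < r"
  shows "\<bar>sob_deriv j f x\<bar> \<le> sob_const j r * sobolev_norm r f"
proof -
  let ?k = "\<lambda>\<xi>. (\<i> * of_real \<xi>) ^ j * fourier f \<xi>"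
  have "\<bar>sob_deriv j f x\<bar> = \<bar>Re (ft ?k (- x))\<bar> / (2 * pi)" by (simp add: sob_deriv_def)
  also have "\<dots> \<le> \<bar>Re (ft ?k (- x))\<bar>" using pi_ge_two by (simp add: divide_le_eq mult_le_cancel_left1)
  also have "\<dots> \<le> cmod (ft ?k (- x))" by (rule abs_Re_le_cmod)
  also have "\<dots> \<le> (LBINT \<xi>. cmod (?k \<xi>))" by (rule ft_bound[OF sobolev_weighted(1)[OF f j]])
  also have "\<dots> \<le> sob_const j r * sobolev_norm r f" by (rule sobolev_weighted(3)[OF f j])
  finally show ?thesis .
qed

lemma sob_deriv_continuous:
  assumes f: "f \<in> sobolev r" and j: "real j + 1 / 2 < r"
  shows "continuous_on UNIV (sob_deriv j f)"
  unfolding sob_deriv_def[abs_def]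
  by (intro continuous_intros continuous_on_compose2[OF continuous_ft[OF sobolev_weighted(1)[OF f j]]]) auto

lemma sob_deriv_square_integrable:
  assumes f: "f \<in> sobolev r" and j: "real j + 1 / 2 < r"
  shows "integrable lborel (\<lambda>x. (sob_deriv j f x)\<^sup>2)"
proof -
  let ?k = "\<lambda>\<xi>. (\<i> * of_real \<xi>) ^ j * fourier f \<xi>"
  have [measurable]: "sob_deriv j f \<in> borel_measurable borel"
    by (rule borel_measurable_continuous_onI[OF sob_deriv_continuous[OF f j]])
  have "integrable lborel (\<lambda>x. (cmod (ft ?k x))\<^sup>2)"
    using plancherel_bound(1)[OF sobolev_weighted(1,2)[OF f j]] by (simp add: L2_def)
  from lborel_integrable_real_affine[OF this, of "-1" 0]
  have i: "integrable lborel (\<lambda>x. (cmod (ft ?k (- x)))\<^sup>2)" by simp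
  show ?thesis
  proof (rule Bochner_Integration.integrable_bound[OF i])
    have "(sob_deriv j f x)\<^sup>2 \<le> (cmod (ft ?k (- x)))\<^sup>2" for x
    proof -
      have "\<bar>sob_deriv j f x\<bar> = \<bar>Re (ft ?k (- x))\<bar> / (2 * pi)" by (simp add: sob_deriv_def)
      also have "\<dots> \<le> \<bar>Re (ft ?k (- x))\<bar>" using pi_ge_two by (simp add: divide_le_eq mult_le_cancel_left1)
      also have "\<dots> \<le> cmod (ft ?k (- x))" by (rule abs_Re_le_cmod)
      finally show ?thesis by (simp add: abs_le_square_iff[symmetric])
    qed
    then show "AE x in lborel. norm ((sob_deriv j f x)\<^sup>2) \<le> norm ((cmod (ft ?k (- x)))\<^sup>2)" by simp
  qed measurable
qed

lemma sob_deriv_has_derivative: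
  assumes f: "f \<in> sobolev r" and j: "real (Suc j) + 1 / 2 < r"
  shows "(sob_deriv j f has_real_derivative sob_deriv (Suc j) f x) (at x)"
proof -
  have j': "real j + 1 / 2 < r" using j by simp
  have "(\<lambda>\<xi>. (\<i> * of_real \<xi>) ^ Suc j * fourier f \<xi>) = (\<lambda>\<xi>. \<i> * of_real \<xi> * ((\<i> * of_real \<xi>) ^ j * fourier f \<xi>))"
    by (simp add: mult_ac)
  then show ?thesis
    unfolding sob_deriv_def[abs_def]
    using has_derivative_Re_ft[OF sobolev_weighted(1)[OF f j'], of x] sobolev_weighted(1)[OF f j]
    by (intro DERIV_cdivide) (simp only:)
qed

lemma sob_deriv_0:
  assumes f: "f \<in> sobolev_cont r" and r: "r > 1 / 2"
  shows "sob_deriv 0 f = f"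
proof
  fix x
  have f': "f \<in> sobolev r" "continuous_on UNIV f" using f by (auto simp: sobolev_cont_def)
  have "integrable lborel (fourier f)" using sobolev_weighted(1)[OF f'(1), of 0] r by simp
  then have "ft (fourier f) (- x) = complex_of_real (2 * pi * f x)"
    using sobolevD[OF f'(1)] by (intro fourier_inversion f')
  then show "sob_deriv 0 f x = f x" by (simp add: sob_deriv_def)
qed

lemma deriv_sob_deriv:
  assumes f: "f \<in> sobolev r" and j: "real (Suc j) + 1 / 2 < r"
  shows "deriv (sob_deriv j f) = sob_deriv (Suc j) f"
  using sob_deriv_has_derivative[OF f j] by (intro ext DERIV_imp_deriv)

lemma sobolev_embed0:
  assumes f: "f \<in> sobolev_cont r" and r: "r > 1 / 2"
  shows "\<bar>f x\<bar> \<le> sob_const 0 r * sobolev_norm r f"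
  using sob_deriv_bound[of f r 0 x] f r sob_deriv_0[OF f r] by (auto simp: sobolev_cont_def)

lemma sobolev_embed1:
  assumes f: "f \<in> sobolev_cont r" and r: "r > 3 / 2"
  shows "(f has_real_derivative deriv f x) (at x)" "\<bar>deriv f x\<bar> \<le> sob_const 1 r * sobolev_norm r f"
    "continuous_on UNIV (deriv f)" "integrable lborel (\<lambda>x. (deriv f x)\<^sup>2)"
proof -
  have f': "f \<in> sobolev r" using f by (auto simp: sobolev_cont_def)
  have s0: "sob_deriv 0 f = f" by (rule sob_deriv_0[OF f]) (use r in simp)
  have d: "deriv f = sob_deriv 1 f" using deriv_sob_deriv[OF f', of 0] r s0 by simp
  show "(f has_real_derivative deriv f x) (at x)"
    using sob_deriv_has_derivative[OF f', of 0 x] r s0 d by simp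
  show "\<bar>deriv f x\<bar> \<le> sob_const 1 r * sobolev_norm r f" "continuous_on UNIV (deriv f)" "integrable lborel (\<lambda>x. (deriv f x)\<^sup>2)"
    unfolding d using r by (intro sob_deriv_bound sob_deriv_continuous sob_deriv_square_integrable f'; simp)+
qed

lemma sobolev_embed2:
  assumes f: "f \<in> sobolev_cont r" and r: "r > 5 / 2"
  shows "(deriv f has_real_derivative deriv (deriv f) x) (at x)"
    "\<bar>deriv (deriv f) x\<bar> \<le> sob_const 2 r * sobolev_norm r f"
    "continuous_on UNIV (deriv (deriv f))"
proof -
  have f': "f \<in> sobolev r" using f by (auto simp: sobolev_cont_def)
  have s0: "sob_deriv 0 f = f" by (rule sob_deriv_0[OF f]) (use r in simp)
  have d: "deriv f = sob_deriv 1 f" using deriv_sob_deriv[OF f', of 0] r s0 by simp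
  have d2: "deriv (deriv f) = sob_deriv 2 f"
    unfolding d using deriv_sob_deriv[OF f', of 1] r by (simp add: numeral_2_eq_2)
  show "(deriv f has_real_derivative deriv (deriv f) x) (at x)"
    unfolding d2 unfolding d using sob_deriv_has_derivative[OF f', of 1 x] r by (simp add: numeral_2_eq_2)
  show "\<bar>deriv (deriv f) x\<bar> \<le> sob_const 2 r * sobolev_norm r f" "continuous_on UNIV (deriv (deriv f))"
    unfolding d2 using r by (intro sob_deriv_bound sob_deriv_continuous f'; simp)+
qed

lemma sobolev_linear_combination:
  assumes "f \<in> sobolev r" "g \<in> sobolev r"
  shows "(\<lambda>x. a * f x + b * g x) \<in> sobolev r"
proof -
  let ?h = "\<lambda>x. a * f x + b * g x"
  let ?w = "\<lambda>q \<xi>. (1 + \<xi>\<^sup>2) powr r * (cmod (fourier q \<xi>))\<^sup>2"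
  let ?d = "\<lambda>\<xi>. 2 * a\<^sup>2 * ?w f \<xi> + 2 * b\<^sup>2 * ?w g \<xi>"
  note f = sobolevD[OF assms(1)] and g = sobolevD[OF assms(2)]
  note l = square_integrable_linear_combination[OF f(1,2) g(1,2), of a b]
  have [measurable]: "fourier ?h \<in> borel_measurable borel" using fourier_spec(1)[OF l] by simp
  have i: "integrable lborel ?d"
    by (intro Bochner_Integration.integrable_add integrable_mult_right f(3) g(3))
  have le: "(cmod (a * y + b * z))\<^sup>2 \<le> 2 * a\<^sup>2 * (cmod y)\<^sup>2 + 2 * b\<^sup>2 * (cmod z)\<^sup>2" for y z :: complex
  proof -
    have "cmod (a * y + b * z) \<le> \<bar>a\<bar> * cmod y + \<bar>b\<bar> * cmod z"
      by (rule order_trans[OF norm_triangle_ineq]) (simp add: norm_mult)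
    then have "(cmod (a * y + b * z))\<^sup>2 \<le> (\<bar>a\<bar> * cmod y + \<bar>b\<bar> * cmod z)\<^sup>2" by (intro power_mono) auto
    also have "\<dots> \<le> 2 * (\<bar>a\<bar> * cmod y)\<^sup>2 + 2 * (\<bar>b\<bar> * cmod z)\<^sup>2"
      using sum_squares_bound[of "\<bar>a\<bar> * cmod y" "\<bar>b\<bar> * cmod z"] by (simp add: power2_sum)
    finally show ?thesis by (simp add: power_mult_distrib)
  qed
  have "integrable lborel (?w ?h)"
  proof (rule Bochner_Integration.integrable_bound[OF i])
    show "AE \<xi> in lborel. norm (?w ?h \<xi>) \<le> norm (?d \<xi>)"
      using fourier_linear_AE[OF f(1,2) g(1,2), of a b]
    proof eventually_elim
      fix \<xi> assume e: "fourier ?h \<xi> = a * fourier f \<xi> + b * fourier g \<xi>"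
      have "?w ?h \<xi> \<le> (1 + \<xi>\<^sup>2) powr r * (2 * a\<^sup>2 * (cmod (fourier f \<xi>))\<^sup>2 + 2 * b\<^sup>2 * (cmod (fourier g \<xi>))\<^sup>2)"
        unfolding e by (intro mult_left_mono le) auto
      then show "norm (?w ?h \<xi>) \<le> norm (?d \<xi>)" by (simp add: algebra_simps)
    qed
  qed measurable
  then show ?thesis using l by (simp add: sobolev_def)
qed

section \<open>The resolvent of the Helmholtz operator\<close>

text \<open>
  A value of modulus \<open>e\<close> forces \<open>\<bar>f\<bar> \<ge> e / 2\<close> on an interval of fixed length by the Lipschitz bound, and
  the integral of \<open>f\<^sup>2\<close> far from the origin has no room for such intervals.
\<close>
lemma square_integrable_Lipschitz_decay:
  fixes f :: "real \<Rightarrow> real"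
  assumes f: "integrable lborel (\<lambda>x. (f x)\<^sup>2)" and lip: "\<And>x y. \<bar>f x - f y\<bar> \<le> L * \<bar>x - y\<bar>"
  shows "(f \<longlongrightarrow> 0) at_infinity"
proof -
  have L: "L \<ge> 0" using lip[of 1 0] by simp
  have "\<exists>b. \<forall>x. b \<le> \<bar>x\<bar> \<longrightarrow> \<bar>f x\<bar> < e" if e: "e > 0" for e
  proof -
    define d where "d = min 1 (e / (2 * (L + 1)))"
    have d: "d > 0" "d \<le> 1" using e L by (auto simp: d_def)
    have Ld: "L * d \<le> e / 2"
    proof -
      have "L * d \<le> (L + 1) * (e / (2 * (L + 1)))" using L d e by (intro mult_mono) (auto simp: d_def)
      also have "\<dots> = e / 2" using L by (simp add: field_simps)
      finally show ?thesis .
    qed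
    have "\<forall>\<^sub>F A in at_top. l2_tail f A < 2 * d * (e / 2)\<^sup>2"
      using order_tendstoD(2)[OF l2_tail_tendsto[OF f], of "2 * d * (e / 2)\<^sup>2"] d e by simp
    then obtain A where A: "l2_tail f A < 2 * d * (e / 2)\<^sup>2" by (metis eventually_at_top_linorder order_refl)
    have "\<bar>f x\<bar> < e" if x: "A + 1 \<le> \<bar>x\<bar>" for x
    proof (rule ccontr)
      assume "\<not> \<bar>f x\<bar> < e"
      have low: "(e / 2)\<^sup>2 \<le> (f y)\<^sup>2" if "y \<in> {x - d..x + d}" for y
      proof -
        have "\<bar>x - y\<bar> \<le> d" using that by auto
        then have "\<bar>f x - f y\<bar> \<le> L * d" using lip[of x y] L by (meson mult_left_mono order_trans)
        then have "e / 2 \<le> \<bar>f y\<bar>" using Ld \<open>\<not> \<bar>f x\<bar> < e\<close> by linarith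
        then have "\<bar>e / 2\<bar> \<le> \<bar>f y\<bar>" using e by simp
        then show ?thesis by (simp only: abs_le_square_iff)
      qed
      have "2 * d * (e / 2)\<^sup>2 = (LBINT y. indicator {x - d..x + d} y * (e / 2)\<^sup>2)"
        using d by (simp add: mult.commute)
      also have "\<dots> \<le> (LBINT y. indicator {y. A \<le> \<bar>y\<bar>} y * (f y)\<^sup>2)"
      proof (rule Bochner_Integration.integral_mono)
        show "integrable lborel (\<lambda>y. indicator {x - d..x + d} y * (e / 2)\<^sup>2)"
          by (intro integrable_mult_left integrable_real_indicator) (auto simp: emeasure_lborel_Icc_eq)
        have [measurable]: "(\<lambda>x. (f x)\<^sup>2) \<in> borel_measurable borel" using f by auto
        show "integrable lborel (\<lambda>y. indicator {y. A \<le> \<bar>y\<bar>} y * (f y)\<^sup>2)"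
          by (rule Bochner_Integration.integrable_bound[OF f]) (auto simp: indicator_def simp del: borel_measurable_power)
        fix y
        show "indicator {x - d..x + d} y * (e / 2)\<^sup>2 \<le> indicator {y. A \<le> \<bar>y\<bar>} y * (f y)\<^sup>2"
          using low[of y] x d by (auto simp: indicator_def)
      qed
      finally show False using A by (simp add: l2_tail_def)
    qed
    then show ?thesis by blast
  qed
  then show ?thesis by (simp add: tendsto_iff eventually_at_infinity)
qed

lemma bounded_deriv_Lipschitz:
  fixes f f' :: "real \<Rightarrow> real"
  assumes "\<And>x. (f has_real_derivative f' x) (at x)" "\<And>x. \<bar>f' x\<bar> \<le> L"
  shows "\<bar>f x - f y\<bar> \<le> L * \<bar>x - y\<bar>"
  using field_differentiable_bound[of UNIV f f' L x y] assms by auto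

lemma decay_attains_max:
  fixes f :: "real \<Rightarrow> real"
  assumes c: "continuous_on UNIV f" and l: "(f \<longlongrightarrow> 0) at_infinity" and pos: "f x0 > 0"
  shows "\<exists>c. \<forall>x. f x \<le> f c"
proof -
  obtain R where R: "\<And>x. R \<le> \<bar>x\<bar> \<Longrightarrow> \<bar>f x\<bar> < f x0"
    using l pos by (auto simp: tendsto_iff eventually_at_infinity)
  let ?R = "max \<bar>R\<bar> \<bar>x0\<bar>"
  have "\<exists>c\<in>{- ?R..?R}. \<forall>y\<in>{- ?R..?R}. f y \<le> f c"
    by (rule continuous_attains_sup) (auto intro: continuous_on_subset[OF c])
  then obtain c where c: "\<And>y. y \<in> {- ?R..?R} \<Longrightarrow> f y \<le> f c" by blast
  have "f x \<le> f c" for x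
  proof (cases "\<bar>x\<bar> \<le> ?R")
    case True then show ?thesis by (intro c) auto
  next
    case False
    then have "R \<le> \<bar>x\<bar>" by auto
    from R[OF this] have "f x < f x0" by simp
    also have "f x0 \<le> f c" by (intro c) auto
    finally show ?thesis by simp
  qed
  then show ?thesis by blast
qed

text \<open>
  At a positive maximum above \<open>N\<close> one would have \<open>w'' \<ge> w - N > 0\<close>, which contradicts maximality.
  This gives injectivity of \<open>1 - \<partial>\<^sub>x\<^sup>2\<close>, oddness of \<open>u0\<close>, and a supremum bound for the nonlocal term.
\<close>
lemma helmholtz_max_principle:
  fixes w w' w'' :: "real \<Rightarrow> real"
  assumes d1: "\<And>x. (w has_real_derivative w' x) (at x)" and d2: "\<And>x. (w' has_real_derivative w'' x) (at x)"
    and l: "(w \<longlongrightarrow> 0) at_infinity" and N: "N \<ge> 0" and le: "\<And>x. w x - w'' x \<le> N"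
  shows "w x \<le> N"
proof (rule ccontr)
  assume a: "\<not> w x \<le> N"
  have "continuous_on UNIV w" using d1 by (meson DERIV_isCont continuous_at_imp_continuous_on)
  then obtain c where c: "\<And>y. w y \<le> w c" using decay_attains_max[OF _ l, of x] a N by force
  have w0: "w' c = 0" using DERIV_local_max[OF d1, of 1 c] c by simp
  have "w'' c > 0" using le[of c] c[of x] a by linarith
  from DERIV_pos_inc_right[OF d2 this] obtain h where h: "h > 0" "\<And>k. k > 0 \<Longrightarrow> k < h \<Longrightarrow> w' c < w' (c + k)" by blast
  obtain z where z: "c < z" "z < c + h / 2" "w (c + h / 2) - w c = (c + h / 2 - c) * w' z"
    using MVT2[of c "c + h / 2" w w'] h(1) d1 by auto
  have "w' z > 0" using h(2)[of "z - c"] z w0 h(1) by simp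
  then have "w (c + h / 2) > w c" using z(3) h(1) by (simp add: algebra_simps) (smt (verit) mult_pos_pos)
  then show False using c[of "c + h / 2"] by simp
qed

lemma sobolev_decay:
  assumes f: "f \<in> sobolev_cont r" and r: "r > 3 / 2"
  shows "(f \<longlongrightarrow> 0) at_infinity"
proof (rule square_integrable_Lipschitz_decay)
  show "integrable lborel (\<lambda>x. (f x)\<^sup>2)" using f by (auto simp: sobolev_cont_def sobolev_def)
  show "\<bar>f x - f y\<bar> \<le> (sob_const 1 r * sobolev_norm r f) * \<bar>x - y\<bar>" for x y
    by (rule bounded_deriv_Lipschitz[OF sobolev_embed1(1,2)[OF f r]])
qed

lemma sobolev_deriv_decay:
  assumes f: "f \<in> sobolev_cont r" and r: "r > 5 / 2"
  shows "(deriv f \<longlongrightarrow> 0) at_infinity"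
proof (rule square_integrable_Lipschitz_decay)
  show "integrable lborel (\<lambda>x. (deriv f x)\<^sup>2)" using r by (intro sobolev_embed1(4)[OF f]) simp
  show "\<bar>deriv f x - deriv f y\<bar> \<le> (sob_const 2 r * sobolev_norm r f) * \<bar>x - y\<bar>" for x y
    by (rule bounded_deriv_Lipschitz[OF sobolev_embed2(1,2)[OF f r]])
qed

text \<open>
  The resolvent \<open>(1 - \<partial>\<^sub>x\<^sup>2)\<^sup>-\<^sup>1\<close> as convolution with its Green function.
\<close>
definition hconv :: "(real \<Rightarrow> real) \<Rightarrow> real \<Rightarrow> real" where
  "hconv F x = (LBINT y. exp (- \<bar>x - y\<bar>) / 2 * F y)"

text \<open>
  Splitting the Green function at the diagonal writes the convolution with two integrals of this form, one for \<open>F\<close>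
  and one for its reflection, which the fundamental theorem of calculus differentiates.
\<close>
definition expint :: "(real \<Rightarrow> real) \<Rightarrow> real \<Rightarrow> real" where
  "expint F x = (LBINT y:{..x}. exp y * F y)"

lemma expint_integrable:
  fixes F :: "real \<Rightarrow> real"
  assumes F: "integrable lborel F"
  shows "set_integrable lborel {..x} (\<lambda>y. exp y * F y)"
  unfolding set_integrable_def
proof (rule Bochner_Integration.integrable_bound)
  have [measurable]: "F \<in> borel_measurable borel" using F by auto
  show "integrable lborel (\<lambda>y. exp x * F y)" using F by simp
  show "AE y in lborel. norm (indicator {..x} y *\<^sub>R (exp y * F y)) \<le> norm (exp x * F y)"
    by (intro AE_I2) (auto simp: indicator_def abs_mult mult_right_mono)
  show "(\<lambda>y. indicat_real {..x} y *\<^sub>R (exp y * F y)) \<in> borel_measurable lborel" by measurable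
qed

lemma expint_has_derivative:
  assumes F: "integrable lborel F" "continuous_on UNIV F"
  shows "(expint F has_real_derivative exp x * F x) (at x)"
proof -
  let ?g = "\<lambda>y. exp y * F y"
  let ?c = "x - 1"
  have cg: "continuous_on S ?g" for S by (intro continuous_intros continuous_on_subset[OF F(2)]) auto
  have eq: "expint F z = expint F ?c + integral {?c..z} ?g" if "z > ?c" for z
  proof -
    have s: "set_integrable lborel {?c..z} ?g"
      by (rule set_integrable_subset[OF expint_integrable[OF F(1), of z]]) auto
    have "{..z} = {..?c} \<union> {?c..z}" using that by auto
    then have "expint F z = (LBINT y:{..?c} \<union> {?c..z}. ?g y)" unfolding expint_def by simp
    also have "\<dots> = (LBINT y:{..?c}. ?g y) + (LBINT y:{?c..z}. ?g y)"
    proof (rule set_integral_Un_AE[OF _ _ _ expint_integrable[OF F(1)] s])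
      show "AE y in lborel. \<not> (y \<in> {..?c} \<and> y \<in> {?c..z})"
        using AE_lborel_singleton[of ?c] by eventually_elim auto
    qed auto
    also have "(LBINT y:{?c..z}. ?g y) = integral {?c..z} ?g"
      by (rule set_borel_integral_eq_integral(2)[OF s])
    finally show ?thesis by (simp add: expint_def)
  qed
  have "((\<lambda>z. integral {?c..z} ?g) has_real_derivative ?g x) (at x within {?c..x + 1})"
    by (rule integral_has_real_derivative[OF cg]) auto
  then have "((\<lambda>z. integral {?c..z} ?g) has_real_derivative ?g x) (at x)"
    by (subst (asm) at_within_interior) auto
  then have "((\<lambda>z. expint F ?c + integral {?c..z} ?g) has_real_derivative ?g x) (at x)"
    by (auto intro!: derivative_eq_intros)
  then show ?thesis
    by (rule has_field_derivative_transform_within_open[of _ _ _ "{?c<..}"]) (auto simp: eq)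
qed

lemma integrable_reflect:
  fixes F :: "real \<Rightarrow> real"
  shows "integrable lborel F \<Longrightarrow> integrable lborel (\<lambda>y. F (- y))"
  using lborel_integrable_real_affine[of F "-1" 0] by simp

lemma hconv_integrable:
  fixes F :: "real \<Rightarrow> real"
  assumes F: "integrable lborel F"
  shows "integrable lborel (\<lambda>y. exp (- \<bar>x - y\<bar>) / 2 * F y)"
proof (rule Bochner_Integration.integrable_bound[OF F])
  have [measurable]: "F \<in> borel_measurable borel" using F by auto
  show "(\<lambda>y. exp (- \<bar>x - y\<bar>) / 2 * F y) \<in> borel_measurable lborel" by measurable
  have "exp (- \<bar>x - y\<bar>) / 2 * \<bar>F y\<bar> \<le> 1 * \<bar>F y\<bar>" for y
    by (intro mult_right_mono) (auto intro: order_trans[of _ 1])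
  then show "AE y in lborel. norm (exp (- \<bar>x - y\<bar>) / 2 * F y) \<le> norm (F y)" by (simp add: abs_mult)
qed

lemma hconv_eq:
  assumes F: "integrable lborel F"
  shows "hconv F x = (exp (- x) * expint F x + exp x * expint (\<lambda>y. F (- y)) (- x)) / 2"
proof -
  have [measurable]: "F \<in> borel_measurable borel" using F by auto
  let ?a = "\<lambda>y. indicator {..x} y *\<^sub>R (exp y * F y)"
  let ?b = "\<lambda>y. indicator {..- x} y *\<^sub>R (exp y * F (- y))"
  have a: "integrable lborel ?a" and aI: "(LBINT y. ?a y) = expint F x"
    using expint_integrable[OF F] by (auto simp: set_integrable_def expint_def set_lebesgue_integral_def)
  have b: "integrable lborel ?b" and bI: "(LBINT y. ?b y) = expint (\<lambda>y. F (- y)) (- x)"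
    using expint_integrable[OF integrable_reflect[OF F], of "- x"] by (auto simp: set_integrable_def expint_def set_lebesgue_integral_def)
  have b': "integrable lborel (\<lambda>y. ?b (- y))" and bI': "(LBINT y. ?b (- y)) = expint (\<lambda>y. F (- y)) (- x)"
    using lborel_integrable_real_affine[OF b, of "-1" 0] lborel_integral_real_affine[of "-1" ?b 0] bI by auto
  have "hconv F x = (LBINT y. (exp (- x) / 2) * ?a y + (exp x / 2) * ?b (- y))"
    unfolding hconv_def
  proof (rule integral_cong_AE)
    show "AE y in lborel. exp (- \<bar>x - y\<bar>) / 2 * F y = (exp (- x) / 2) * ?a y + (exp x / 2) * ?b (- y)"
      using AE_lborel_singleton[of x]
    proof eventually_elim
      fix y assume "y \<noteq> x"
      then consider "y < x" | "y > x" by linarith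
      then show "exp (- \<bar>x - y\<bar>) / 2 * F y = (exp (- x) / 2) * ?a y + (exp x / 2) * ?b (- y)"
      proof cases
        case 1
        then have "exp (- \<bar>x - y\<bar>) = exp (- x) * exp y" by (simp add: mult_exp_exp)
        then show ?thesis using 1 by simp
      next
        case 2
        then have "exp (- \<bar>x - y\<bar>) = exp x * exp (- y)" by (simp add: mult_exp_exp)
        then show ?thesis using 2 by simp
      qed
    qed
  qed measurable
  also have "\<dots> = (exp (- x) / 2) * expint F x + (exp x / 2) * expint (\<lambda>y. F (- y)) (- x)"
    using a b' aI bI' by (subst Bochner_Integration.integral_add) (simp_all only: integrable_mult_right integral_mult_right_zero)
  finally show ?thesis by (simp add: add_divide_distrib)
qed

lemma hconv_derivatives:
  assumes F: "integrable lborel F" "continuous_on UNIV F"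
  shows "\<exists>W'. (\<forall>x. (hconv F has_real_derivative W' x) (at x)) \<and> (\<forall>x. (W' has_real_derivative hconv F x - F x) (at x))"
proof -
  let ?F = "\<lambda>y. F (- y)"
  have cF: "continuous_on UNIV ?F" by (intro continuous_on_compose2[OF F(2)] continuous_intros) auto
  have A: "(expint F has_real_derivative exp x * F x) (at x)" for x by (rule expint_has_derivative[OF F])
  have B: "((\<lambda>x. expint ?F (- x)) has_real_derivative - (exp (- x) * F x)) (at x)" for x
  proof -
    have "((\<lambda>x. expint ?F (- x)) has_real_derivative (exp (- x) * ?F (- x)) * (- 1)) (at x)"
    proof (rule DERIV_chain2[where g = "\<lambda>x. - x"])
      show "(expint ?F has_real_derivative exp (- x) * ?F (- x)) (at (- x))"
        by (rule expint_has_derivative[OF integrable_reflect[OF F(1)] cF])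
    qed (auto intro!: derivative_eq_intros)
    then show ?thesis by simp
  qed
  have E: "(exp has_real_derivative exp x) (at x)" "((\<lambda>x. exp (- x)) has_real_derivative - exp (- x)) (at x)"
    "((\<lambda>x. - exp (- x)) has_real_derivative exp (- x)) (at x)" for x :: real
    by (auto intro!: derivative_eq_intros)
  let ?W' = "\<lambda>x. (- exp (- x) * expint F x + exp x * expint ?F (- x)) / 2"
  have D1: "(hconv F has_real_derivative ?W' x) (at x)" for x
    unfolding hconv_eq[OF F(1), abs_def]
    by (rule DERIV_cong[OF DERIV_cdivide[OF DERIV_add[OF DERIV_mult[OF E(2) A] DERIV_mult[OF E(1) B]]]])
       (simp add: algebra_simps)
  have D2: "(?W' has_real_derivative hconv F x - F x) (at x)" for x
    by (rule DERIV_cong[OF DERIV_cdivide[OF DERIV_add[OF DERIV_mult[OF E(3) A] DERIV_mult[OF E(1) B]]]])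
       (simp add: hconv_eq[OF F(1)] exp_minus field_simps)
  show ?thesis by (rule exI[of _ ?W'], intro conjI allI D1 D2)
qed

text \<open>
  The convolution theorem for the Green function, whose transform is \<open>1 / (1 + \<xi>\<^sup>2)\<close>.
\<close>
lemma hconv_ft:
  assumes F: "integrable lborel F"
  shows "integrable lborel (hconv F)"
    and "ft (\<lambda>x. complex_of_real (hconv F x)) \<xi> = ft (\<lambda>x. complex_of_real (F x)) \<xi> / of_real (1 + \<xi>\<^sup>2)"
proof -
  have [measurable]: "F \<in> borel_measurable borel" using F by auto
  let ?p = "\<lambda>z::real. complex_of_real (exp (- (1 * \<bar>z\<bar>)))"
  let ?K = "\<lambda>\<xi> y x. ?p (x - y) * cis (- (x * \<xi>)) * (complex_of_real (F y) / 2)"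
  have pi: "integrable lborel ?p" by (rule exp_abs_ft(1)) simp
  have pI: "(LBINT z. exp (- \<bar>z::real\<bar>)) = 2"
  proof -
    have "complex_of_real (LBINT z. exp (- \<bar>z\<bar>)) = complex_of_real 2" using exp_abs_ft(2)[of 1 0] by (simp add: ft_def)
    then show ?thesis unfolding of_real_eq_iff .
  qed
  have shift: "integrable lborel (\<lambda>x. ?p (x - y))" for y
    using lborel_integrable_real_affine[OF pi, of 1 "- y"] by simp
  have shift': "integrable lborel (\<lambda>x. exp (- \<bar>x - y\<bar>))" for y :: real
    using shift[of y] unfolding complex_of_real_integrable_eq by simp
  have shiftI: "(LBINT x. exp (- \<bar>x - y\<bar>)) = 2" for y :: real
    using lborel_integral_real_affine[of 1 "\<lambda>z. exp (- \<bar>z\<bar>)" "- y"] pI by simp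
  have inner: "integrable lborel (\<lambda>x. ?K \<xi> y x)" for y \<xi>
    using integrable_cis_mult(2)[OF shift, of y \<xi>] by (rule integrable_mult_left)
  have Kint: "integrable (lborel \<Otimes>\<^sub>M lborel) (\<lambda>(y, x). ?K \<xi> y x)" for \<xi>
  proof (rule lborel_pair.Fubini_integrable)
    have "(LBINT x. norm (?K \<xi> y x)) = \<bar>F y\<bar>" for y
    proof -
      have "(LBINT x. norm (?K \<xi> y x)) = (LBINT x. exp (- \<bar>x - y\<bar>) * (\<bar>F y\<bar> / 2))"
        by (simp add: norm_mult norm_divide)
      also have "\<dots> = \<bar>F y\<bar>" unfolding integral_mult_left_zero shiftI by simp
      finally show ?thesis .
    qed
    then show "integrable lborel (\<lambda>y. LBINT x. norm (case (y, x) of (y, x) \<Rightarrow> ?K \<xi> y x))" using F by simp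
    show "AE y in lborel. integrable lborel (\<lambda>x. case (y, x) of (y, x) \<Rightarrow> ?K \<xi> y x)" using inner by simp
  qed measurable
  have in_x: "(LBINT y. ?K \<xi> y x) = complex_of_real (hconv F x) * cis (- (x * \<xi>))" for \<xi> x
  proof -
    have "(LBINT y. ?K \<xi> y x) = (LBINT y. complex_of_real (exp (- \<bar>x - y\<bar>) / 2 * F y) * cis (- (x * \<xi>)))"
      by (intro Bochner_Integration.integral_cong) (simp_all add: abs_minus_commute)
    also have "\<dots> = complex_of_real (hconv F x) * cis (- (x * \<xi>))"
      unfolding integral_mult_left_zero integral_complex_of_real hconv_def ..
    finally show ?thesis .
  qed
  have in_y: "(LBINT x. ?K \<xi> y x) = complex_of_real (F y) * cis (- (y * \<xi>)) / of_real (1 + \<xi>\<^sup>2)" for y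
  proof -
    have "(LBINT x. ?p (x - y) * cis (- (x * \<xi>))) = (LBINT z. ?p z * cis (- ((y + z) * \<xi>)))"
      using lborel_integral_real_affine[of 1 "\<lambda>x. ?p (x - y) * cis (- (x * \<xi>))" y] by simp
    also have "\<dots> = (LBINT z. (?p z * cis (- (z * \<xi>))) * cis (- (y * \<xi>)))"
    proof -
      have "cis (- ((y + z) * \<xi>)) = cis (- (z * \<xi>)) * cis (- (y * \<xi>))" for z
        by (simp add: cis_mult algebra_simps)
      then show ?thesis by (simp only: mult.assoc)
    qed
    also have "\<dots> = of_real (2 / (1 + \<xi>\<^sup>2)) * cis (- (y * \<xi>))"
      unfolding integral_mult_left_zero using exp_abs_ft(2)[of 1 \<xi>] by (simp add: ft_def)
    finally have e: "(LBINT x. ?p (x - y) * cis (- (x * \<xi>))) = of_real (2 / (1 + \<xi>\<^sup>2)) * cis (- (y * \<xi>))" .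
    have "2 / D * c * (f / 2) = f * c / D" for D c f :: complex by simp
    then show ?thesis unfolding integral_mult_left_zero e of_real_divide of_real_numeral .
  qed
  have "integrable lborel (\<lambda>x. LBINT y. ?K 0 y x)" by (rule lborel_pair.integrable_snd[OF Kint])
  then have "integrable lborel (\<lambda>x. complex_of_real (hconv F x))" unfolding in_x by simp
  then show "integrable lborel (hconv F)" unfolding complex_of_real_integrable_eq .
  have "(LBINT x. LBINT y. ?K \<xi> y x) = (LBINT y. LBINT x. ?K \<xi> y x)"
    by (rule lborel_pair.Fubini_integral[OF Kint])
  then show "ft (\<lambda>x. complex_of_real (hconv F x)) \<xi> = ft (\<lambda>x. complex_of_real (F x)) \<xi> / of_real (1 + \<xi>\<^sup>2)"
    unfolding in_x in_y integral_divide_zero ft_def .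
qed

lemma hconv_bound:
  assumes F: "integrable lborel F"
  shows "\<bar>hconv F x\<bar> \<le> (LBINT y. \<bar>F y\<bar>)"
proof -
  have "\<bar>hconv F x\<bar> \<le> (LBINT y. norm (exp (- \<bar>x - y\<bar>) / 2 * F y))"
    unfolding hconv_def real_norm_def[symmetric] by (rule integral_norm_bound)
  also have "\<dots> \<le> (LBINT y. \<bar>F y\<bar>)"
  proof (rule Bochner_Integration.integral_mono)
    show "integrable lborel (\<lambda>y. norm (exp (- \<bar>x - y\<bar>) / 2 * F y))" by (intro integrable_norm hconv_integrable F)
    have "exp (- \<bar>x - y\<bar>) / 2 * \<bar>F y\<bar> \<le> 1 * \<bar>F y\<bar>" for y
      by (intro mult_right_mono) (auto intro: order_trans[of _ 1])
    then show "norm (exp (- \<bar>x - y\<bar>) / 2 * F y) \<le> \<bar>F y\<bar>" for y by (simp add: abs_mult)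
  qed (use F in simp)
  finally show ?thesis .
qed

text \<open>
  Since \<open>F\<close> is bounded and integrable, it and its convolution are both integrable and square-integrable, so
  \<^const>\<open>fourier\<close> is given by the integrals. By \<open>hconv_ft\<close> the weight \<open>(1 + \<xi>\<^sup>2)\<^sup>2\<close> of \<open>H\<^sup>2\<close> cancels exactly, and
  what remains is the squared modulus of the transform of \<open>F\<close>.
\<close>
lemma hconv_sobolev:
  assumes F: "integrable lborel F" "continuous_on UNIV F" and B: "\<And>x. \<bar>F x\<bar> \<le> B"
  shows "hconv F \<in> sobolev_cont 2"
proof -
  have "continuous_on UNIV (hconv F)"
    using hconv_derivatives[OF F] by (meson DERIV_isCont continuous_at_imp_continuous_on)
  note c = this
  have [measurable]: "hconv F \<in> borel_measurable borel" by (rule borel_measurable_continuous_onI[OF c])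
  have [measurable]: "F \<in> borel_measurable borel" using F by auto
  have Wi: "integrable lborel (hconv F)" by (rule hconv_ft(1)[OF F(1)])
  have W2: "integrable lborel (\<lambda>x. (hconv F x)\<^sup>2)"
  proof (rule Bochner_Integration.integrable_bound)
    show "integrable lborel (\<lambda>x. (LBINT y. \<bar>F y\<bar>) * hconv F x)" using Wi by (rule integrable_mult_right)
    have "\<bar>hconv F x\<bar> * \<bar>hconv F x\<bar> \<le> \<bar>LBINT y. \<bar>F y\<bar>\<bar> * \<bar>hconv F x\<bar>" for x
      using hconv_bound[OF F(1), of x] by (intro mult_right_mono) auto
    then show "AE x in lborel. norm ((hconv F x)\<^sup>2) \<le> norm ((LBINT y. \<bar>F y\<bar>) * hconv F x)"
      by (simp add: power2_eq_square abs_mult)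
  qed measurable
  have F2: "integrable lborel (\<lambda>x. (F x)\<^sup>2)"
  proof (rule Bochner_Integration.integrable_bound)
    show "integrable lborel (\<lambda>x. B * F x)" using F(1) by (rule integrable_mult_right)
    have "\<bar>F x\<bar> * \<bar>F x\<bar> \<le> \<bar>B\<bar> * \<bar>F x\<bar>" for x
      using B[of x] by (intro mult_right_mono) auto
    then show "AE x in lborel. norm ((F x)\<^sup>2) \<le> norm (B * F x)"
      by (simp add: power2_eq_square abs_mult)
  qed measurable
  let ?Fc = "\<lambda>x. complex_of_real (F x)"
  have "L2 (ft ?Fc)" using F(1) F2 by (intro plancherel_bound(1)) (simp_all add: L2_of_real_iff)
  then have i: "integrable lborel (\<lambda>\<xi>. (cmod (ft ?Fc \<xi>))\<^sup>2)" by (simp add: L2_def)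
  have [measurable]: "fourier (hconv F) \<in> borel_measurable borel" using fourier_spec(1)[OF _ W2] by simp
  have "integrable lborel (\<lambda>\<xi>. (1 + \<xi>\<^sup>2) powr 2 * (cmod (fourier (hconv F) \<xi>))\<^sup>2)"
  proof (rule Bochner_Integration.integrable_bound[OF i])
    show "AE \<xi> in lborel. norm ((1 + \<xi>\<^sup>2) powr 2 * (cmod (fourier (hconv F) \<xi>))\<^sup>2) \<le> norm ((cmod (ft ?Fc \<xi>))\<^sup>2)"
      using fourier_eq_ft_AE[OF Wi W2]
    proof eventually_elim
      fix \<xi> assume "fourier (hconv F) \<xi> = ft (\<lambda>x. complex_of_real (hconv F x)) \<xi>"
      then have e: "fourier (hconv F) \<xi> = ft ?Fc \<xi> / of_real (1 + \<xi>\<^sup>2)" unfolding hconv_ft(2)[OF F(1)] .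
      have p: "1 + \<xi>\<^sup>2 > 0" by (simp add: add_pos_nonneg)
      have "(1 + \<xi>\<^sup>2) powr 2 * (cmod (fourier (hconv F) \<xi>))\<^sup>2 = (1 + \<xi>\<^sup>2)\<^sup>2 * (cmod (ft ?Fc \<xi>) / (1 + \<xi>\<^sup>2))\<^sup>2"
        unfolding e norm_divide norm_of_real using p by (simp add: powr_numeral)
      also have "\<dots> = (cmod (ft ?Fc \<xi>))\<^sup>2" using p by (simp add: power_divide)
      finally show "norm ((1 + \<xi>\<^sup>2) powr 2 * (cmod (fourier (hconv F) \<xi>))\<^sup>2) \<le> norm ((cmod (ft ?Fc \<xi>))\<^sup>2)" by simp
    qed
  qed measurable
  then show ?thesis using c W2 by (simp add: sobolev_cont_def sobolev_def)
qed

text \<open>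
  The set on which \<^const>\<open>inv_helmholtz\<close> inverts \<^const>\<open>helmholtz\<close>.
\<close>
definition helm_dom :: "(real \<Rightarrow> real) set" where
  "helm_dom = {w \<in> sobolev_cont 2. \<forall>x. w differentiable (at x) \<and> deriv w differentiable (at x)}"

lemma helmholtz_inj:
  "inj_on helmholtz helm_dom"
proof (rule inj_onI)
  fix v w assume v: "v \<in> helm_dom"
    and w: "w \<in> helm_dom"
    and eq: "helmholtz v = helmholtz w"
  have d: "(f has_real_derivative deriv f x) (at x)" "(deriv f has_real_derivative deriv (deriv f) x) (at x)" "(f \<longlongrightarrow> 0) at_infinity"
    if "f \<in> helm_dom" for f x
    using that sobolev_decay[of f 2] by (auto simp: helm_dom_def DERIV_deriv_iff_real_differentiable)
  have le: "f x \<le> g x" if f: "f \<in> helm_dom"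
    and g: "g \<in> helm_dom"
    and eq: "helmholtz f = helmholtz g" for f g x
  proof -
    have "f x - g x \<le> 0"
    proof (rule helmholtz_max_principle[where w = "\<lambda>x. f x - g x" and w' = "\<lambda>x. deriv f x - deriv g x"
          and w'' = "\<lambda>x. deriv (deriv f) x - deriv (deriv g) x"])
      show "((\<lambda>x. f x - g x) has_real_derivative deriv f x - deriv g x) (at x)" for x
        by (intro derivative_intros d f g)
      show "((\<lambda>x. deriv f x - deriv g x) has_real_derivative deriv (deriv f) x - deriv (deriv g) x) (at x)" for x
        by (intro derivative_intros d f g)
      show "((\<lambda>x. f x - g x) \<longlongrightarrow> 0) at_infinity" using tendsto_diff[OF d(3)[OF f] d(3)[OF g]] by simp
      show "f x - g x - (deriv (deriv f) x - deriv (deriv g) x) \<le> 0" for x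
        using fun_cong[OF eq, of x] by (simp add: helmholtz_def)
    qed simp
    then show ?thesis by simp
  qed
  show "v = w" using le[OF v w eq] le[OF w v eq[symmetric]] by (intro ext antisym) auto
qed

lemma hconv_solves_helmholtz:
  assumes F: "integrable lborel F" "continuous_on UNIV F" and B: "\<And>x. \<bar>F x\<bar> \<le> B"
  shows "hconv F \<in> helm_dom"
    and "helmholtz (hconv F) = F"
    and "(hconv F has_real_derivative deriv (hconv F) x) (at x)"
    and "(deriv (hconv F) has_real_derivative hconv F x - F x) (at x)"
proof -
  obtain W' where W: "\<And>x. (hconv F has_real_derivative W' x) (at x)" "\<And>x. (W' has_real_derivative hconv F x - F x) (at x)"
    using hconv_derivatives[OF F] by blast
  have d: "deriv (hconv F) = W'" using W(1) by (intro ext DERIV_imp_deriv)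
  have d2: "deriv W' x = hconv F x - F x" for x using W(2) by (rule DERIV_imp_deriv)
  show "(hconv F has_real_derivative deriv (hconv F) x) (at x)" "(deriv (hconv F) has_real_derivative hconv F x - F x) (at x)"
    unfolding d by (rule W)+
  show "hconv F \<in> helm_dom"
    using hconv_sobolev[OF F B] W by (auto simp: helm_dom_def d real_differentiable_def)
  show "helmholtz (hconv F) = F" by (rule ext) (simp add: helmholtz_def d d2)
qed

text \<open>
  Existence of a preimage comes from the convolution, uniqueness from the maximum principle.
\<close>
lemma inv_helmholtz_eq_hconv:
  assumes F: "integrable lborel F" "continuous_on UNIV F" and B: "\<And>x. \<bar>F x\<bar> \<le> B"
  shows "inv_helmholtz F = hconv F"
  unfolding inv_helmholtz_def helm_dom_def[symmetric]
  by (rule the_inv_into_f_eq[OF helmholtz_inj hconv_solves_helmholtz(2,1)[OF F B]])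

lemma hconv_pos:
  assumes F: "integrable lborel F" "continuous_on UNIV F" and nn: "\<And>y. F y \<ge> 0" and pos: "F y0 > 0"
  shows "hconv F x > 0"
proof -
  have "isCont F y0" using F(2) by (simp add: continuous_on_eq_continuous_at)
  then have "(F \<longlongrightarrow> F y0) (at y0)" by (simp add: isCont_def)
  then have "\<forall>\<^sub>F y in at y0. F y > F y0 / 2" using pos by (intro order_tendstoD(1)) auto
  then obtain d where d: "d > 0" "\<And>y. y \<noteq> y0 \<Longrightarrow> \<bar>y - y0\<bar> < d \<Longrightarrow> F y > F y0 / 2"
    by (auto simp: eventually_at dist_real_def)
  let ?I = "{y0 - d/2..y0 + d/2}"
  let ?m = "exp (- (\<bar>x - y0\<bar> + d)) / 2 * (F y0 / 2)"
  have "0 < d * ?m" using d(1) pos by simp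
  also have "d * ?m = (LBINT y. indicator ?I y * ?m)" using d(1) by simp
  also have "\<dots> \<le> hconv F x"
    unfolding hconv_def
  proof (rule Bochner_Integration.integral_mono)
    show "integrable lborel (\<lambda>y. indicator ?I y * ?m)"
      by (intro integrable_mult_left integrable_real_indicator) (auto simp: emeasure_lborel_Icc_eq)
    show "integrable lborel (\<lambda>y. exp (- \<bar>x - y\<bar>) / 2 * F y)" by (rule hconv_integrable[OF F(1)])
    fix y
    show "indicator ?I y * ?m \<le> exp (- \<bar>x - y\<bar>) / 2 * F y"
    proof (cases "y \<in> ?I")
      case True
      then have a: "\<bar>y - y0\<bar> < d" using d(1) by (auto simp: abs_less_iff)
      then have "F y0 / 2 \<le> F y" using d(2)[of y] pos by (cases "y = y0") auto
      moreover have "exp (- (\<bar>x - y0\<bar> + d)) \<le> exp (- \<bar>x - y\<bar>)" using a by auto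
      ultimately show ?thesis using True pos by (simp only: indicator_simps mult_1) (intro mult_mono, auto)
    next
      case False then show ?thesis using nn[of y] by simp
    qed
  qed
  finally show ?thesis .
qed

lemma hconv_nonneg:
  assumes "\<And>y. F y \<ge> 0"
  shows "hconv F x \<ge> 0"
  unfolding hconv_def using assms by (intro Bochner_Integration.integral_nonneg) auto

section \<open>Curves in Sobolev spaces and a barrier argument\<close>

text \<open>
  Continuity in time for the supremum distance.
\<close>
definition unif_curve :: "real set \<Rightarrow> (real \<Rightarrow> real \<Rightarrow> real) \<Rightarrow> bool" where
  "unif_curve J f \<longleftrightarrow> (\<forall>t\<in>J. \<forall>e>0. \<forall>\<^sub>F \<tau> in at t within J. \<forall>x. \<bar>f \<tau> x - f t x\<bar> \<le> e)"

lemma unif_curve_subset: "unif_curve J f \<Longrightarrow> I \<subseteq> J \<Longrightarrow> unif_curve I f"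
  unfolding unif_curve_def by (meson at_le filter_leD subsetD)

text \<open>
  Continuous curves over a compact interval are bounded; local bounds are joined by \<open>Bolzano\<close>.
\<close>
lemma unif_curve_bounded:
  assumes u: "unif_curve {0..T} f" and b: "\<And>t. t \<in> {0..T} \<Longrightarrow> \<exists>B. \<forall>x. \<bar>f t x\<bar> \<le> B" and T: "0 \<le> T"
  shows "\<exists>B\<ge>0. \<forall>t\<in>{0..T}. \<forall>x. \<bar>f t x\<bar> \<le> B"
proof -
  define P where "P a c \<longleftrightarrow> (\<exists>B. \<forall>t\<in>{a..c} \<inter> {0..T}. \<forall>x. \<bar>f t x\<bar> \<le> B)" for a c
  have "P 0 T" using T
  proof (induction rule: Bolzano)
    case (trans a b c)
    from trans(1) obtain B where B: "\<And>t x. t \<in> {a..b} \<inter> {0..T} \<Longrightarrow> \<bar>f t x\<bar> \<le> B" unfolding P_def by blast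
    from trans(2) obtain C where C: "\<And>t x. t \<in> {b..c} \<inter> {0..T} \<Longrightarrow> \<bar>f t x\<bar> \<le> C" unfolding P_def by blast
    have "\<bar>f t x\<bar> \<le> max B C" if "t \<in> {a..c} \<inter> {0..T}" for t x
      using B[of t x] C[of t x] that by (cases "t \<le> b") auto
    then show ?case unfolding P_def by blast
  next
    case (local t)
    then have t: "t \<in> {0..T}" by simp
    then obtain B where B: "\<And>x. \<bar>f t x\<bar> \<le> B" using b by blast
    have "\<forall>\<^sub>F \<tau> in at t within {0..T}. \<forall>x. \<bar>f \<tau> x - f t x\<bar> \<le> 1"
      using u t unfolding unif_curve_def by auto
    then obtain d where d: "d > 0" "\<And>\<tau> x. \<tau> \<in> {0..T} \<Longrightarrow> \<tau> \<noteq> t \<Longrightarrow> \<bar>\<tau> - t\<bar> < d \<Longrightarrow> \<bar>f \<tau> x - f t x\<bar> \<le> 1"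
      by (auto simp: eventually_at dist_real_def)
    have bd: "\<bar>f \<tau> x\<bar> \<le> B + 1" if "\<tau> \<in> {0..T}" "\<bar>\<tau> - t\<bar> < d" for \<tau> x
      using d(2)[OF that(1) _ that(2), of x] B[of x] by (cases "\<tau> = t") auto
    show ?case
    proof (intro exI[of _ d] conjI d(1) allI impI)
      fix a c assume h: "a \<le> t \<and> t \<le> c \<and> c - a < d"
      have "\<bar>f \<tau> x\<bar> \<le> B + 1" if "\<tau> \<in> {a..c} \<inter> {0..T}" for \<tau> x
        using that h by (intro bd) auto
      then show "P a c" unfolding P_def by blast
    qed
  qed
  then obtain B where "\<forall>t\<in>{0..T} \<inter> {0..T}. \<forall>x. \<bar>f t x\<bar> \<le> B" unfolding P_def by blast
  then show ?thesis by (intro exI[of _ "max 0 B"]) (auto simp: le_max_iff_disj)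
qed

lemma decay_strict_bound:
  fixes f :: "real \<Rightarrow> real"
  assumes c: "continuous_on UNIV f" and l: "(f \<longlongrightarrow> 0) at_infinity" and b: "b > 0" "\<And>x. \<bar>f x\<bar> < b"
  shows "\<exists>M<b. \<forall>x. \<bar>f x\<bar> \<le> M"
proof (cases "\<exists>x0. \<bar>f x0\<bar> > 0")
  case True
  then obtain x0 where "\<bar>f x0\<bar> > 0" by blast
  moreover have "continuous_on UNIV (\<lambda>x. \<bar>f x\<bar>)" by (intro continuous_intros c)
  moreover have "((\<lambda>x. \<bar>f x\<bar>) \<longlongrightarrow> 0) at_infinity" using tendsto_rabs[OF l] by simp
  ultimately obtain c where "\<And>x. \<bar>f x\<bar> \<le> \<bar>f c\<bar>" using decay_attains_max by blast
  then show ?thesis using b(2) by blast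
next
  case False
  then show ?thesis using b(1) by (intro exI[of _ 0]) auto
qed

text \<open>
  A Gronwall argument in the supremum norm that requires the differential inequality only at points where
  the supremum over all members of the family is attained. There the spatial derivative of the attaining
  function vanishes, so transport terms may be ignored in \<open>bound\<close>. Reaching the barrier
  \<open>\<epsilon> * exp ((C + 1) * t)\<close> for the first time at \<open>t\<close> would require growth at least as fast as that of the
  barrier, at rate \<open>C + 1\<close>, whereas the hypothesis allows only the rate \<open>C\<close>.
\<close>
lemma barrier_zero:
  fixes f D :: "'i \<Rightarrow> real \<Rightarrow> real \<Rightarrow> real" and T C :: real
  assumes fin: "finite I" and T: "0 \<le> T"
    and cont: "\<And>i t. i \<in> I \<Longrightarrow> t \<in> {0..T} \<Longrightarrow> continuous_on UNIV (f i t)"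
    and decay: "\<And>i t. i \<in> I \<Longrightarrow> t \<in> {0..T} \<Longrightarrow> (f i t \<longlongrightarrow> 0) at_infinity"
    and unif: "\<And>i. i \<in> I \<Longrightarrow> unif_curve {0..T} (f i)"
    and init: "\<And>i x. i \<in> I \<Longrightarrow> f i 0 x = 0"
    and deriv: "\<And>i t x. i \<in> I \<Longrightarrow> t \<in> {0..T} \<Longrightarrow> ((\<lambda>t. f i t x) has_real_derivative D i t x) (at t within {0..T})"
    and bound: "\<And>i t x N. i \<in> I \<Longrightarrow> t \<in> {0..T} \<Longrightarrow> (\<And>j y. j \<in> I \<Longrightarrow> \<bar>f j t y\<bar> \<le> N) \<Longrightarrow> \<bar>f i t x\<bar> = N \<Longrightarrow> \<bar>D i t x\<bar> \<le> C * N"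
    and i: "i \<in> I" and t: "t \<in> {0..T}"
  shows "f i t x = 0"
proof -
  have main: "\<forall>i\<in>I. \<forall>x. \<bar>f i t x\<bar> < \<epsilon> * exp ((C + 1) * t)" if e: "\<epsilon> > 0" and t: "t \<in> {0..T}" for \<epsilon> t
  proof -
    define b where "b t = \<epsilon> * exp ((C + 1) * t)" for t
    define A where "A t \<longleftrightarrow> (\<forall>i\<in>I. \<forall>x. \<bar>f i t x\<bar> < b t)" for t
    have b0: "b t > 0" for t using e by (simp add: b_def)
    have bd: "(b has_real_derivative (C + 1) * b t) (at t within S)" for t S
      unfolding b_def[abs_def] by (auto intro!: derivative_eq_intros)
    have bl: "(b \<longlongrightarrow> b t) (at t within S)" for t S
      using DERIV_continuous[OF bd] by (simp add: continuous_within)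
    \<comment> \<open>By decay, strict inequality everywhere leaves a positive gap below the barrier, which persists for nearby times.\<close>
    have op: "\<forall>\<^sub>F \<tau> in at t within {0..T}. A \<tau>" if t: "t \<in> {0..T}" and A: "A t" for t
      unfolding A_def
    proof (rule eventually_ball_finite[OF fin], rule ballI)
      fix i assume i: "i \<in> I"
      obtain M where M: "M < b t" "\<And>x. \<bar>f i t x\<bar> \<le> M"
        using decay_strict_bound[OF cont[OF i t] decay[OF i t] b0] A i unfolding A_def by blast
      let ?e = "(b t - M) / 3"
      have "?e > 0" using M by simp
      then have "\<forall>\<^sub>F \<tau> in at t within {0..T}. \<forall>x. \<bar>f i \<tau> x - f i t x\<bar> \<le> ?e"
        using unif[OF i] t unfolding unif_curve_def by blast
      moreover have "\<forall>\<^sub>F \<tau> in at t within {0..T}. b \<tau> > b t - ?e"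
        using M by (intro order_tendstoD(1)[OF bl]) simp
      ultimately show "\<forall>\<^sub>F \<tau> in at t within {0..T}. \<forall>x. \<bar>f i \<tau> x\<bar> < b \<tau>"
      proof eventually_elim
        fix \<tau> assume h: "\<forall>x. \<bar>f i \<tau> x - f i t x\<bar> \<le> ?e" "b \<tau> > b t - ?e"
        have "\<bar>f i \<tau> x\<bar> < b \<tau>" for x
        proof -
          have "\<bar>f i \<tau> x - f i t x\<bar> \<le> ?e" using h by blast
          then have "\<bar>f i \<tau> x\<bar> \<le> ?e + M" using M(2)[of x] by linarith
          then show ?thesis using h(2) M(1) by (simp add: field_simps)
        qed
        then show "\<forall>x. \<bar>f i \<tau> x\<bar> < b \<tau>" by blast
      qed
    qed
    \<comment> \<open>The first contact with the barrier is excluded by comparing time derivatives from the left.\<close>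
    have cl: "A t" if t: "t \<in> {0..T}" "t > 0" and before: "\<And>\<tau>. \<tau> \<in> {0..T} \<Longrightarrow> \<tau> < t \<Longrightarrow> A \<tau>" for t
    proof (rule ccontr)
      assume "\<not> A t"
      then obtain i x where ix: "i \<in> I" "\<bar>f i t x\<bar> \<ge> b t" unfolding A_def by (auto simp: not_less)
      have le: "\<bar>f j t y\<bar> \<le> b t" if j: "j \<in> I" for j y
      proof (rule tendsto_le)
        have nt: "at t within {0..<t} \<noteq> bot" using t(2) by (simp add: trivial_limit_within islimpt_Ico)
        then show "at t within {0..<t} \<noteq> bot" .
        show "(b \<longlongrightarrow> b t) (at t within {0..<t})" by (rule bl)
        have "((\<lambda>t. f j t y) \<longlongrightarrow> f j t y) (at t within {0..T})"
          using DERIV_continuous[OF deriv[OF j t(1)]] by (simp add: continuous_within)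
        then have "((\<lambda>t. f j t y) \<longlongrightarrow> f j t y) (at t within {0..<t})"
          by (rule tendsto_within_subset) (use t in auto)
        then show "((\<lambda>t. \<bar>f j t y\<bar>) \<longlongrightarrow> \<bar>f j t y\<bar>) (at t within {0..<t})" by (rule tendsto_rabs)
        have "\<bar>f j \<tau> y\<bar> \<le> b \<tau>" if "\<tau> \<in> {0..<t}" for \<tau>
          using before[of \<tau>] that t j unfolding A_def by (auto intro: less_imp_le)
        then show "\<forall>\<^sub>F \<tau> in at t within {0..<t}. \<bar>f j \<tau> y\<bar> \<le> b \<tau>"
          by (auto simp: eventually_at_filter intro: always_eventually)
      qed
      have eq: "\<bar>f i t x\<bar> = b t" using le[OF ix(1)] ix(2) by (intro antisym)
      have D: "\<bar>D i t x\<bar> \<le> C * b t" by (rule bound[OF ix(1) t(1) le eq])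
      define s where "s = sgn (f i t x)"
      have s: "\<bar>s\<bar> \<le> 1" "s * f i t x = b t" using eq by (auto simp: s_def sgn_if)
      have g: "((\<lambda>\<tau>. s * f i \<tau> x - b \<tau>) has_real_derivative s * D i t x - (C + 1) * b t) (at t within {0..T})"
        by (intro derivative_intros DERIV_cmult deriv[OF ix(1) t(1)] bd)
      have "s * D i t x \<le> \<bar>s\<bar> * \<bar>D i t x\<bar>" by (simp add: abs_mult[symmetric])
      also have "\<dots> \<le> 1 * \<bar>D i t x\<bar>" by (intro mult_right_mono s) auto
      finally have "s * D i t x \<le> C * b t" using D by simp
      then have neg: "s * D i t x - (C + 1) * b t < 0" using b0[of t] by (simp add: algebra_simps)
      obtain d where d: "d > 0" "\<And>h. h > 0 \<Longrightarrow> t - h \<in> {0..T} \<Longrightarrow> h < d \<Longrightarrow> s * f i t x - b t < s * f i (t - h) x - b (t - h)"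
        using has_real_derivative_neg_dec_left[OF g neg] by blast
      define h where "h = min t d / 2"
      have h: "h > 0" "h < d" "t - h \<in> {0..T}" "t - h < t" using d(1) t by (auto simp: h_def min_def field_simps)
      from d(2)[OF h(1,3,2)] have low: "b (t - h) < s * f i (t - h) x" using s by simp
      have "s * f i (t - h) x \<le> \<bar>s\<bar> * \<bar>f i (t - h) x\<bar>" by (simp add: abs_mult[symmetric])
      also have "\<dots> \<le> 1 * \<bar>f i (t - h) x\<bar>" by (intro mult_right_mono s) auto
      also have "\<dots> < b (t - h)" using before[OF h(3,4)] ix(1) unfolding A_def by simp
      finally show False using low by simp
    qed
    have "A t"
    proof (rule ccontr)
      assume "\<not> A t"
      define S where "S = {t \<in> {0..T}. \<not> A t}"
      have S: "S \<noteq> {}" "bdd_below S" using \<open>\<not> A t\<close> t by (auto simp: S_def bdd_below_def)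
      define t' where "t' = Inf S"
      have t': "t' \<in> {0..T}"
      proof -
        have "t' \<le> t" unfolding t'_def by (rule cInf_lower[OF _ S(2)]) (use \<open>\<not> A t\<close> t in \<open>simp add: S_def\<close>)
        moreover have "0 \<le> t'" unfolding t'_def by (rule cInf_greatest[OF S(1)]) (auto simp: S_def)
        ultimately show ?thesis using t by simp
      qed
      have before: "A \<tau>" if "\<tau> \<in> {0..T}" "\<tau> < t'" for \<tau>
        using that cInf_lower[OF _ S(2), of \<tau>] unfolding t'_def S_def by force
      have At': "A t'"
      proof (cases "t' = 0")
        case True
        then show ?thesis using init b0 by (simp add: A_def)
      next
        case False
        then show ?thesis using cl[OF t' _ before] t' by simp
      qed
      obtain d where d: "d > 0" "\<And>\<tau>. \<tau> \<in> {0..T} \<Longrightarrow> \<tau> \<noteq> t' \<Longrightarrow> \<bar>\<tau> - t'\<bar> < d \<Longrightarrow> A \<tau>"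
        using op[OF t' At'] by (auto simp: eventually_at dist_real_def)
      obtain \<tau> where \<tau>: "\<tau> \<in> S" "\<tau> < t' + d" using cInf_lessD[OF S(1), of "t' + d"] d(1) unfolding t'_def by auto
      have "t' \<le> \<tau>" unfolding t'_def by (rule cInf_lower[OF \<tau>(1) S(2)])
      then have "A \<tau>" using d(2)[of \<tau>] \<tau> At' unfolding S_def by (cases "\<tau> = t'") auto
      then show False using \<tau>(1) by (simp add: S_def)
    qed
    then show ?thesis unfolding A_def b_def by blast
  qed
  have "\<bar>f i t x\<bar> \<le> 0 + \<epsilon>" if "\<epsilon> > 0" for \<epsilon>
  proof -
    have "\<bar>f i t x\<bar> < \<epsilon> / exp ((C + 1) * t) * exp ((C + 1) * t)"
      using main[OF _ t, of "\<epsilon> / exp ((C + 1) * t)"] i that by simp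
    then show ?thesis by simp
  qed
  then have "\<bar>f i t x\<bar> \<le> 0" by (rule field_le_epsilon)
  then show ?thesis by simp
qed

lemma sobolev_cont_linear_combination:
  assumes "f \<in> sobolev_cont r" "g \<in> sobolev_cont r"
  shows "(\<lambda>x. a * f x + b * g x) \<in> sobolev_cont r"
  using assms sobolev_linear_combination[of f r g a b] by (auto simp: sobolev_cont_def intro!: continuous_intros)

lemma sobolev_cont_diff:
  assumes "f \<in> sobolev_cont r" "g \<in> sobolev_cont r"
  shows "(\<lambda>x. f x - g x) \<in> sobolev_cont r"
  using sobolev_cont_linear_combination[OF assms, of 1 "-1"] by simp

text \<open>
  The form in which the Sobolev embeddings are applied to curves.
\<close>
lemma unif_curve_by_norm:
  assumes "\<And>t. t \<in> J \<Longrightarrow> ((\<lambda>\<tau>. N t \<tau>) \<longlongrightarrow> 0) (at t within J)"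
    and "\<And>t \<tau> x. t \<in> J \<Longrightarrow> \<tau> \<in> J \<Longrightarrow> \<bar>f \<tau> x - f t x\<bar> \<le> K * N t \<tau>"
  shows "unif_curve J f"
  unfolding unif_curve_def
proof (intro ballI allI impI)
  fix t and e :: real assume t: "t \<in> J" and e: "e > 0"
  have "((\<lambda>\<tau>. K * N t \<tau>) \<longlongrightarrow> K * 0) (at t within J)" by (intro tendsto_intros assms(1) t)
  then have "\<forall>\<^sub>F \<tau> in at t within J. K * N t \<tau> < e" using order_tendstoD(2)[of _ "K * 0" _ e] e by simp
  moreover have "\<forall>\<^sub>F \<tau> in at t within J. \<tau> \<in> J" by (auto simp: eventually_at_filter intro: always_eventually)
  ultimately show "\<forall>\<^sub>F \<tau> in at t within J. \<forall>x. \<bar>f \<tau> x - f t x\<bar> \<le> e"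
  proof eventually_elim
    fix \<tau> assume h: "K * N t \<tau> < e" "\<tau> \<in> J"
    have "\<bar>f \<tau> x - f t x\<bar> \<le> e" for x using assms(2)[OF t h(2), of x] h(1) by linarith
    then show "\<forall>x. \<bar>f \<tau> x - f t x\<bar> \<le> e" by blast
  qed
qed

lemma deriv_diff_fun:
  fixes f g :: "real \<Rightarrow> real"
  assumes "\<And>x. (f has_real_derivative f' x) (at x)" "\<And>x. (g has_real_derivative g' x) (at x)"
  shows "deriv (\<lambda>x. f x - g x) = (\<lambda>x. f' x - g' x)"
  by (intro ext DERIV_imp_deriv derivative_intros assms)

lemma curve_cont_unif0:
  assumes v: "curve_cont r J v" and r: "r > 1 / 2"
  shows "unif_curve J v"
proof (rule unif_curve_by_norm)
  show "((\<lambda>\<tau>. sobolev_norm r (\<lambda>x. v \<tau> x - v t x)) \<longlongrightarrow> 0) (at t within J)" if "t \<in> J" for t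
    using v that by (simp add: curve_cont_def)
  show "\<bar>v \<tau> x - v t x\<bar> \<le> sob_const 0 r * sobolev_norm r (\<lambda>x. v \<tau> x - v t x)" if "t \<in> J" "\<tau> \<in> J" for t \<tau> x
    using v that by (intro sobolev_embed0[OF sobolev_cont_diff r]) (auto simp: curve_cont_def)
qed

lemma curve_cont_unif1:
  assumes v: "curve_cont r J v" and r: "r > 3 / 2"
  shows "unif_curve J (\<lambda>t. deriv (v t))"
proof (rule unif_curve_by_norm)
  show "((\<lambda>\<tau>. sobolev_norm r (\<lambda>x. v \<tau> x - v t x)) \<longlongrightarrow> 0) (at t within J)" if "t \<in> J" for t
    using v that by (simp add: curve_cont_def)
  show "\<bar>deriv (v \<tau>) x - deriv (v t) x\<bar> \<le> sob_const 1 r * sobolev_norm r (\<lambda>x. v \<tau> x - v t x)" if "t \<in> J" "\<tau> \<in> J" for t \<tau> x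
  proof -
    have m: "v \<tau> \<in> sobolev_cont r" "v t \<in> sobolev_cont r" using v that by (auto simp: curve_cont_def)
    show ?thesis
      using sobolev_embed1(2)[OF sobolev_cont_diff[OF m] r, of x]
      unfolding deriv_diff_fun[OF sobolev_embed1(1)[OF m(1) r] sobolev_embed1(1)[OF m(2) r]] .
  qed
qed

lemma curve_cont_unif2:
  assumes v: "curve_cont r J v" and r: "r > 5 / 2"
  shows "unif_curve J (\<lambda>t. deriv (deriv (v t)))"
proof (rule unif_curve_by_norm)
  show "((\<lambda>\<tau>. sobolev_norm r (\<lambda>x. v \<tau> x - v t x)) \<longlongrightarrow> 0) (at t within J)" if "t \<in> J" for t
    using v that by (simp add: curve_cont_def)
  show "\<bar>deriv (deriv (v \<tau>)) x - deriv (deriv (v t)) x\<bar> \<le> sob_const 2 r * sobolev_norm r (\<lambda>x. v \<tau> x - v t x)" if "t \<in> J" "\<tau> \<in> J" for t \<tau> x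
  proof -
    have r': "r > 3 / 2" using r by simp
    have m: "v \<tau> \<in> sobolev_cont r" "v t \<in> sobolev_cont r" using v that by (auto simp: curve_cont_def)
    show ?thesis
      using sobolev_embed2(2)[OF sobolev_cont_diff[OF m] r, of x]
      unfolding deriv_diff_fun[OF sobolev_embed1(1)[OF m(1) r'] sobolev_embed1(1)[OF m(2) r']]
        deriv_diff_fun[OF sobolev_embed2(1)[OF m(1) r] sobolev_embed2(1)[OF m(2) r]] .
  qed
qed

lemma curve_C1_quotient:
  assumes v: "curve_C1 r J v v'" and t: "t \<in> J" "\<tau> \<in> J"
  shows "(\<lambda>x. (v \<tau> x - v t x) / (\<tau> - t) - v' t x) \<in> sobolev_cont r"
proof -
  have m: "v \<tau> \<in> sobolev_cont r" "v t \<in> sobolev_cont r" "v' t \<in> sobolev_cont r"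
    using v t by (auto simp: curve_C1_def curve_cont_def)
  show ?thesis
    using sobolev_cont_diff[OF sobolev_cont_linear_combination[OF m(1,2), of "1 / (\<tau> - t)" "- 1 / (\<tau> - t)"] m(3)]
    by (simp add: diff_divide_distrib)
qed

lemma has_derivative_by_norm:
  fixes g :: "real \<Rightarrow> real"
  assumes N: "(N \<longlongrightarrow> 0) (at t within J)" and le: "\<And>\<tau>. \<tau> \<in> J \<Longrightarrow> \<tau> \<noteq> t \<Longrightarrow> \<bar>(g \<tau> - g t) / (\<tau> - t) - D\<bar> \<le> K * N \<tau>"
  shows "(g has_real_derivative D) (at t within J)"
  unfolding has_field_derivative_iff
proof (rule LIM_zero_cancel, rule Lim_null_comparison)
  have "((\<lambda>\<tau>. K * N \<tau>) \<longlongrightarrow> K * 0) (at t within J)" by (intro tendsto_intros N)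
  then show "((\<lambda>\<tau>. K * N \<tau>) \<longlongrightarrow> 0) (at t within J)" by simp
  show "\<forall>\<^sub>F \<tau> in at t within J. norm ((g \<tau> - g t) / (\<tau> - t) - D) \<le> K * N \<tau>"
    using le by (auto simp: eventually_at_filter intro!: always_eventually)
qed

lemma curve_C1_time_derivative:
  assumes v: "curve_C1 r J v v'" and r: "r > 1 / 2" and t: "t \<in> J"
  shows "((\<lambda>\<tau>. v \<tau> x) has_real_derivative v' t x) (at t within J)"
proof (rule has_derivative_by_norm)
  show "((\<lambda>\<tau>. sobolev_norm r (\<lambda>x. (v \<tau> x - v t x) / (\<tau> - t) - v' t x)) \<longlongrightarrow> 0) (at t within J)"
    using v t by (simp add: curve_C1_def)
  show "\<bar>(v \<tau> x - v t x) / (\<tau> - t) - v' t x\<bar> \<le> sob_const 0 r * sobolev_norm r (\<lambda>x. (v \<tau> x - v t x) / (\<tau> - t) - v' t x)" if "\<tau> \<in> J" for \<tau>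
    by (rule sobolev_embed0[OF curve_C1_quotient[OF v t that] r])
qed

lemma curve_C1_time_derivative_deriv:
  assumes v: "curve_C1 r J v v'" and r: "r > 3 / 2" and t: "t \<in> J"
  shows "((\<lambda>\<tau>. deriv (v \<tau>) x) has_real_derivative deriv (v' t) x) (at t within J)"
proof (rule has_derivative_by_norm)
  show "((\<lambda>\<tau>. sobolev_norm r (\<lambda>x. (v \<tau> x - v t x) / (\<tau> - t) - v' t x)) \<longlongrightarrow> 0) (at t within J)"
    using v t by (simp add: curve_C1_def)
  fix \<tau> assume \<tau>: "\<tau> \<in> J" "\<tau> \<noteq> t"
  have m: "v \<tau> \<in> sobolev_cont r" "v t \<in> sobolev_cont r" "v' t \<in> sobolev_cont r"
    using v t \<tau> by (auto simp: curve_C1_def curve_cont_def)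
  have "deriv (\<lambda>x. (v \<tau> x - v t x) / (\<tau> - t) - v' t x) x = (deriv (v \<tau>) x - deriv (v t) x) / (\<tau> - t) - deriv (v' t) x"
    by (intro DERIV_imp_deriv DERIV_diff DERIV_cdivide sobolev_embed1(1)[OF _ r] m)
  then show "\<bar>(deriv (v \<tau>) x - deriv (v t) x) / (\<tau> - t) - deriv (v' t) x\<bar>
     \<le> sob_const 1 r * sobolev_norm r (\<lambda>x. (v \<tau> x - v t x) / (\<tau> - t) - v' t x)"
    using sobolev_embed1(2)[OF curve_C1_quotient[OF v t \<tau>(1)] r, of x] by simp
qed

section \<open>Odd functions and differential inequalities\<close>

lemma tendsto_reflect_at_infinity:
  fixes f :: "real \<Rightarrow> real"
  assumes "(f \<longlongrightarrow> l) at_infinity"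
  shows "((\<lambda>x. f (- x)) \<longlongrightarrow> l) at_infinity"
proof -
  have "filterlim (uminus :: real \<Rightarrow> real) at_infinity at_infinity"
    by (rule filterlim_norm_at_top_imp_at_infinity) (simp only: norm_minus_cancel filterlim_norm_at_top)
  then show ?thesis by (rule filterlim_compose[OF assms])
qed

lemma unif_curve_reflect:
  assumes f: "unif_curve J f" and c: "\<bar>c\<bar> \<le> 1"
  shows "unif_curve J (\<lambda>t x. f t x + c * f t (- x))"
  unfolding unif_curve_def
proof (intro ballI allI impI)
  fix t and e :: real assume "t \<in> J" "e > 0"
  then have "\<forall>\<^sub>F \<tau> in at t within J. \<forall>x. \<bar>f \<tau> x - f t x\<bar> \<le> e / 2"
    using f unfolding unif_curve_def by (meson half_gt_zero)
  then show "\<forall>\<^sub>F \<tau> in at t within J. \<forall>x. \<bar>f \<tau> x + c * f \<tau> (- x) - (f t x + c * f t (- x))\<bar> \<le> e"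
  proof eventually_elim
    fix \<tau> assume h: "\<forall>x. \<bar>f \<tau> x - f t x\<bar> \<le> e / 2"
    have "\<bar>f \<tau> x + c * f \<tau> (- x) - (f t x + c * f t (- x))\<bar> \<le> e" for x
    proof -
      have "\<bar>c * (f \<tau> (- x) - f t (- x))\<bar> \<le> 1 * (e / 2)"
        unfolding abs_mult using h c by (intro mult_mono) auto
      moreover have "\<bar>f \<tau> x - f t x\<bar> \<le> e / 2" using h by blast
      moreover have "f \<tau> x + c * f \<tau> (- x) - (f t x + c * f t (- x)) = (f \<tau> x - f t x) + c * (f \<tau> (- x) - f t (- x))"
        by (simp add: algebra_simps)
      ultimately show ?thesis by linarith
    qed
    then show "\<forall>x. \<bar>f \<tau> x + c * f \<tau> (- x) - (f t x + c * f t (- x))\<bar> \<le> e" by blast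
  qed
qed

text \<open>
  This is what makes the transport terms disappear in the barrier argument.
\<close>
lemma deriv_zero_at_abs_max:
  fixes g :: "real \<Rightarrow> real"
  assumes "(g has_real_derivative d) (at x)" "\<And>y. \<bar>g y\<bar> \<le> N" "\<bar>g x\<bar> = N"
  shows "d = 0"
proof (cases "g x \<ge> 0")
  case True
  then have "g y \<le> g x" for y using assms(2)[of y] assms(3) by linarith
  then show ?thesis using DERIV_local_max[OF assms(1), of 1] by simp
next
  case False
  then have "g x \<le> g y" for y using assms(2)[of y] assms(3) by linarith
  then show ?thesis using DERIV_local_min[OF assms(1), of 1] by simp
qed

lemma deriv_bound_interpolation:
  fixes g g' g'' :: "real \<Rightarrow> real"
  assumes d1: "\<And>x. (g has_real_derivative g' x) (at x)" and d2: "\<And>x. (g' has_real_derivative g'' x) (at x)"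
    and a: "\<And>x. \<bar>g x\<bar> \<le> a" and c: "\<And>x. \<bar>g'' x\<bar> \<le> c"
  shows "\<bar>g' x\<bar> \<le> 2 * a + c"
proof -
  obtain z where z: "x < z" "z < x + 1" "g (x + 1) - g x = (x + 1 - x) * g' z"
    using MVT2[of x "x + 1" g g'] d1 by auto
  have "\<bar>g' x - g' z\<bar> \<le> c * \<bar>x - z\<bar>" by (rule bounded_deriv_Lipschitz[OF d2 c])
  also have "\<dots> \<le> c * 1" using z c[of x] by (intro mult_left_mono) auto
  finally have "\<bar>g' x - g' z\<bar> \<le> c" by simp
  moreover have "\<bar>g' z\<bar> \<le> 2 * a" using z(3) a[of x] a[of "x + 1"] by simp
  ultimately show ?thesis by linarith
qed

lemma abs_mult_le:
  fixes a b A B :: real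
  assumes "\<bar>a\<bar> \<le> A" "\<bar>b\<bar> \<le> B"
  shows "\<bar>a * b\<bar> \<le> A * B"
  unfolding abs_mult using assms by (intro mult_mono) auto

text \<open>
  The even part of \<open>f\<close> is annihilated by \<open>1 - \<partial>\<^sub>x\<^sup>2\<close> and decays, so the maximum principle applies to it
  and to its negative.
\<close>
lemma helmholtz_odd_imp_odd:
  assumes f: "f \<in> sobolev_cont r" and r: "r > 5 / 2" and odd: "\<And>x. helmholtz f (- x) = - helmholtz f x"
  shows "f (- x) = - f x"
proof -
  have r': "r > 3 / 2" using r by simp
  note d1 = sobolev_embed1(1)[OF f r'] and d2 = sobolev_embed2(1)[OF f r]
  have le: "c * (f x + f (- x)) \<le> 0" for c x :: real
  proof (rule helmholtz_max_principle[where w = "\<lambda>x. c * (f x + f (- x))" and w' = "\<lambda>x. c * (deriv f x + deriv f (- x) * (- 1))"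
        and w'' = "\<lambda>x. c * (deriv (deriv f) x + (deriv (deriv f) (- x) * (- 1)) * (- 1))"])
    have m: "((\<lambda>x. - x) has_real_derivative - 1) (at x)" for x :: real by (auto intro!: derivative_eq_intros)
    show "((\<lambda>x. c * (f x + f (- x))) has_real_derivative c * (deriv f x + deriv f (- x) * (- 1))) (at x)" for x
      by (intro DERIV_cmult DERIV_add d1 DERIV_chain2[OF d1 m])
    show "((\<lambda>x. c * (deriv f x + deriv f (- x) * (- 1))) has_real_derivative c * (deriv (deriv f) x + (deriv (deriv f) (- x) * (- 1)) * (- 1))) (at x)" for x
      by (intro DERIV_cmult DERIV_add DERIV_cmult_right d2 DERIV_chain2[OF d2 m])
    have "((\<lambda>x. c * (f x + f (- x))) \<longlongrightarrow> c * (0 + 0)) at_infinity"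
      by (intro tendsto_intros sobolev_decay[OF f r'] tendsto_reflect_at_infinity)
    then show "((\<lambda>x. c * (f x + f (- x))) \<longlongrightarrow> 0) at_infinity" by simp
    show "c * (f x + f (- x)) - c * (deriv (deriv f) x + (deriv (deriv f) (- x) * (- 1)) * (- 1)) \<le> 0" for x
    proof -
      have "f x + f (- x) = deriv (deriv f) x + deriv (deriv f) (- x)"
        using odd[of x] by (simp add: helmholtz_def)
      then show ?thesis by simp
    qed
  qed simp
  from le[of 1 x] le[of "-1" x] show ?thesis by simp
qed

text \<open>
  \<open>- exp (- y) * (f y + f' y)\<close> is an antiderivative of the integrand. For odd \<open>f\<close> the integral is therefore the
  slope at the origin.
\<close>
lemma helmholtz_laplace_at_0:
  assumes f: "f \<in> sobolev_cont r" and r: "r > 5 / 2"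
  shows "(LBINT y:{0..}. exp (- y) * helmholtz f y) = f 0 + deriv f 0"
proof -
  have r': "r > 3 / 2" "r > 1 / 2" using r by auto
  note d1 = sobolev_embed1(1)[OF f r'(1)] and d2 = sobolev_embed2(1)[OF f r]
  let ?g = "\<lambda>y. exp (- y) * helmholtz f y"
  let ?G = "\<lambda>y. - (exp (- y) * (f y + deriv f y))"
  define B0 where "B0 = sob_const 0 r * sobolev_norm r f"
  define B1 where "B1 = sob_const 1 r * sobolev_norm r f"
  define B2 where "B2 = sob_const 2 r * sobolev_norm r f"
  have B: "\<bar>f y\<bar> \<le> B0" "\<bar>deriv f y\<bar> \<le> B1" "\<bar>deriv (deriv f) y\<bar> \<le> B2" for y
    unfolding B0_def B1_def B2_def by (rule sobolev_embed0[OF f r'(2)] sobolev_embed1(2)[OF f r'(1)] sobolev_embed2(2)[OF f r])+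
  have ch: "continuous_on S (helmholtz f)" for S
    unfolding helmholtz_def[abs_def]
    using f sobolev_embed2(3)[OF f r] by (auto simp: sobolev_cont_def intro!: continuous_intros intro: continuous_on_subset)
  have [measurable]: "helmholtz f \<in> borel_measurable borel" by (rule borel_measurable_continuous_onI[OF ch])
  have e: "integrable lborel (\<lambda>y::real. exp (- \<bar>y\<bar>))"
    using exp_abs_ft(1)[of 1] unfolding complex_of_real_integrable_eq by simp
  have int: "set_integrable lborel {0..} ?g"
    unfolding set_integrable_def
  proof (rule Bochner_Integration.integrable_bound)
    show "integrable lborel (\<lambda>y::real. (B0 + B2) * exp (- \<bar>y\<bar>))" using e by (rule integrable_mult_right)
    have "\<bar>helmholtz f y\<bar> \<le> \<bar>B0 + B2\<bar>" for y using B[of y] unfolding helmholtz_def by linarith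
    then have "exp (- y) * \<bar>helmholtz f y\<bar> \<le> \<bar>B0 + B2\<bar> * exp (- y)" for y
      by (subst mult.commute, intro mult_right_mono) auto
    then show "AE y in lborel. norm (indicator {0..} y *\<^sub>R ?g y) \<le> norm ((B0 + B2) * exp (- \<bar>y\<bar>))"
      by (intro AE_I2) (auto simp: indicator_def abs_mult)
  qed measurable
  have FTC: "(LBINT y:{0..b}. ?g y) = ?G b - ?G 0" if "b \<ge> 0" for b
    unfolding set_lebesgue_integral_def
  proof (rule integral_FTC_Icc[OF that])
    have "((\<lambda>y. exp (- y)) has_real_derivative - exp (- y)) (at y)" for y :: real by (auto intro!: derivative_eq_intros)
    from DERIV_minus[OF DERIV_mult[OF this DERIV_add[OF d1 d2]]]
    have "(?G has_real_derivative ?g y) (at y)" for y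
      by (rule DERIV_cong) (simp add: helmholtz_def algebra_simps)
    then show "(?G has_vector_derivative ?g y) (at y within {0..b})" for y
      by (simp add: has_real_derivative_iff_has_vector_derivative has_vector_derivative_at_within)
    show "continuous_on {0..b} ?g" by (intro continuous_intros ch)
  qed
  have l1: "((\<lambda>b. LBINT y:{0..b}. ?g y) \<longlongrightarrow> (LBINT y:{0..}. ?g y)) at_top"
    by (rule tendsto_set_lebesgue_integral_at_top[OF _ int]) auto
  have l2: "((\<lambda>b. LBINT y:{0..b}. ?g y) \<longlongrightarrow> f 0 + deriv f 0) at_top"
  proof -
    have "((\<lambda>b. exp (- b)) \<longlongrightarrow> (0::real)) at_top"
      by (rule filterlim_compose[OF exp_at_bot]) (simp add: filterlim_uminus_at_bot filterlim_ident)
    then have l: "((\<lambda>b. (B0 + B1) * exp (- b)) \<longlongrightarrow> (B0 + B1) * 0) at_top" by (intro tendsto_intros)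
    have "(?G \<longlongrightarrow> 0) at_top"
    proof (rule Lim_null_comparison)
      show "((\<lambda>b. (B0 + B1) * exp (- b)) \<longlongrightarrow> 0) at_top" using l by simp
      have "norm (?G b) \<le> (B0 + B1) * exp (- b)" for b
      proof -
        have "\<bar>f b + deriv f b\<bar> \<le> B0 + B1" using B[of b] by linarith
        then have "\<bar>f b + deriv f b\<bar> * exp (- b) \<le> (B0 + B1) * exp (- b)" by (intro mult_right_mono) auto
        then show ?thesis by (simp add: abs_mult mult.commute)
      qed
      then show "\<forall>\<^sub>F b in at_top. norm (?G b) \<le> (B0 + B1) * exp (- b)" by (intro always_eventually allI)
    qed
    then have "((\<lambda>b. ?G b - ?G 0) \<longlongrightarrow> 0 - ?G 0) at_top" by (intro tendsto_intros)
    moreover have "0 - ?G 0 = f 0 + deriv f 0" by simp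
    ultimately have "((\<lambda>b. ?G b - ?G 0) \<longlongrightarrow> f 0 + deriv f 0) at_top" by (simp only:)
    then show ?thesis
      by (rule Lim_transform_eventually)
         (rule eventually_mono[OF eventually_ge_at_top[of 0]], simp only: FTC)
  qed
  show ?thesis by (rule tendsto_unique[OF trivial_limit_at_top_linorder l1 l2])
qed

text \<open>
  The forcing makes \<open>a\<close> positive at once if it is not so initially. From then on \<open>1 / a\<close> decreases at rate at
  least \<open>c\<close>, so it would reach zero in finite time.
\<close>
lemma riccati_no_global_solution:
  fixes a w :: "real \<Rightarrow> real"
  assumes d: "\<And>t. t \<ge> 0 \<Longrightarrow> (a has_real_derivative c * (a t)\<^sup>2 + w t) (at t within {0..})"
    and c: "c > 0" and w: "\<And>t. t \<ge> 0 \<Longrightarrow> w t \<ge> 0" "w 0 > 0" and a0: "a 0 \<ge> 0"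
  shows False
proof -
  have d': "(a has_real_derivative c * (a t)\<^sup>2 + w t) (at t)" if "t > 0" for t
  proof -
    have "at t within {0..} = at t" by (rule at_within_interior) (use that in \<open>simp add: interior_real_atLeast\<close>)
    then show ?thesis using d[of t] that by simp
  qed
  have cont: "continuous_on {0..} a"
    unfolding continuous_on_eq_continuous_within by (intro ballI DERIV_continuous[OF d]) simp
  have mono: "a x \<le> a y" if "0 \<le> x" "x \<le> y" for x y
  proof (cases "x = y")
    case False
    show ?thesis
    proof (rule DERIV_nonneg_imp_increasing_open[where f = a])
      show "\<exists>D. (a has_real_derivative D) (at t) \<and> 0 \<le> D" if "x < t" "t < y" for t
        using d'[of t] w(1)[of t] c that \<open>0 \<le> x\<close> by (intro exI[of _ "c * (a t)\<^sup>2 + w t"]) auto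
      show "continuous_on {x..y} a" by (rule continuous_on_subset[OF cont]) (use that in auto)
    qed (use that in simp)
  qed simp
  have "\<exists>d>0. \<forall>h>0. 0 + h \<in> {0..} \<longrightarrow> h < d \<longrightarrow> a 0 < a (0 + h)"
    by (rule has_real_derivative_pos_inc_right[OF d]) (use w c in \<open>auto simp: add_nonneg_pos\<close>)
  then obtain \<delta> where \<delta>: "\<delta> > 0" "\<And>h. h > 0 \<Longrightarrow> h < \<delta> \<Longrightarrow> a 0 < a h" by auto
  define t0 where "t0 = \<delta> / 2"
  have t0: "t0 > 0" "a t0 > 0" using \<delta>(1) \<delta>(2)[of t0] a0 by (auto simp: t0_def)
  have pos: "a t > 0" if "t \<ge> t0" for t using mono[of t0 t] t0 that by linarith
  \<comment> \<open>The time at which \<open>1 / a(t0) - c * (t - t0)\<close>, an upper bound for \<open>1 / a\<close>, vanishes.\<close>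
  define t1 where "t1 = t0 + 1 / (c * a t0)"
  have t1: "t1 > t0" using t0 c by (simp add: t1_def)
  let ?g = "\<lambda>t. - inverse (a t) - c * t"
  have "?g t0 \<le> ?g t1"
  proof (rule DERIV_nonneg_imp_increasing_open[where f = ?g])
    show "t0 \<le> t1" using t1 by simp
    show "\<exists>D. (?g has_real_derivative D) (at t) \<and> 0 \<le> D" if t: "t0 < t" "t < t1" for t
    proof (intro exI conjI)
      have p: "a t > 0" using pos t by simp
      have "((\<lambda>t. inverse (a t)) has_real_derivative - (inverse (a t) * (c * (a t)\<^sup>2 + w t) * inverse (a t))) (at t)"
        using d'[of t] t t0 p by (intro DERIV_inverse') auto
      moreover have "((\<lambda>t. c * t) has_real_derivative c) (at t)" by (auto intro!: derivative_eq_intros)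
      ultimately show "(?g has_real_derivative - (- (inverse (a t) * (c * (a t)\<^sup>2 + w t) * inverse (a t))) - c) (at t)"
        by (intro DERIV_diff DERIV_minus)
      have "inverse (a t) * (c * (a t)\<^sup>2 + w t) * inverse (a t) = c + w t / (a t)\<^sup>2"
        using p by (simp add: field_simps power2_eq_square)
      then show "0 \<le> - (- (inverse (a t) * (c * (a t)\<^sup>2 + w t) * inverse (a t))) - c"
        using w(1)[of t] t t0 by simp
    qed
    show "continuous_on {t0..t1} ?g"
      by (intro continuous_intros continuous_on_subset[OF cont]) (use pos t0 in \<open>force+\<close>)
  qed
  moreover have "c * t1 - c * t0 = inverse (a t0)" using c t0 by (simp add: t1_def field_simps)
  ultimately have "inverse (a t1) \<le> 0" by linarith
  then show False using pos[of t1] t1 by (simp add: inverse_nonpositive_iff_nonpositive)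
qed

text \<open>
  \<open>y\<^sup>2 * exp (- 2 * K * t)\<close> is nonincreasing.
\<close>
lemma linear_ode_zero:
  fixes y c :: "real \<Rightarrow> real"
  assumes d: "\<And>t. t \<in> {0..T} \<Longrightarrow> (y has_real_derivative c t * y t) (at t within {0..T})"
    and K: "\<And>t. t \<in> {0..T} \<Longrightarrow> c t \<le> K" and y0: "y 0 = 0" and T: "T \<ge> 0"
  shows "y T = 0"
proof -
  let ?z = "\<lambda>t. (y t)\<^sup>2 * exp (- 2 * K * t)"
  have "?z T \<le> ?z 0"
  proof (cases "T = 0")
    case False
    show ?thesis
    proof (rule DERIV_nonpos_imp_decreasing_open[where f = ?z])
      show "\<exists>D. (?z has_real_derivative D) (at t) \<and> D \<le> 0" if t: "0 < t" "t < T" for t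
      proof (intro exI conjI)
        have y': "(y has_real_derivative c t * y t) (at t)"
          using d[of t] t by (simp add: at_within_Icc_at)
        show "(?z has_real_derivative 2 * (c t - K) * ((y t)\<^sup>2 * exp (- 2 * K * t))) (at t)"
          using y' by (auto intro!: derivative_eq_intros simp: algebra_simps power2_eq_square)
        show "2 * (c t - K) * ((y t)\<^sup>2 * exp (- 2 * K * t)) \<le> 0"
          using K[of t] t by (intro mult_nonpos_nonneg[of "2 * (c t - K)"]) auto
      qed
      have "continuous_on {0..T} y"
        unfolding continuous_on_eq_continuous_within by (intro ballI DERIV_continuous[OF d])
      then show "continuous_on {0..T} ?z" by (intro continuous_intros)
    qed (use T in simp)
  qed simp
  then have "(y T)\<^sup>2 * exp (- 2 * K * T) \<le> 0" using y0 by simp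
  then have "(y T)\<^sup>2 \<le> 0" using exp_gt_zero[of "- 2 * K * T"] by (simp add: mult_le_0_iff)
  then show ?thesis by simp
qed

section \<open>Symmetry and blow-up of solutions\<close>

text \<open>
  A solution on \<open>[0,\<infinity>)\<close>, from whose Sobolev regularity the classical facts about \<open>u\<close>, \<open>\<rho>\<close> and the
  source are derived.
\<close>
locale global_b_family =
  fixes k1 k2 k3 s :: real and u0 \<rho>0 :: "real \<Rightarrow> real" and u \<rho> :: "real \<Rightarrow> real \<Rightarrow> real"
  assumes s: "s > 5 / 2"
    and sol: "b_family_solution k1 k2 k3 s u0 \<rho>0 \<infinity> u \<rho>"
begin

abbreviation "ux t \<equiv> deriv (u t)"
abbreviation "uxx t \<equiv> deriv (deriv (u t))"
abbreviation "\<rho>x t \<equiv> deriv (\<rho> t)"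

text \<open>The source, and the potential that it generates.\<close>
definition F :: "real \<Rightarrow> real \<Rightarrow> real" where
  "F t y = k1 / 2 * (u t y)\<^sup>2 + (3 - k1) / 2 * (ux t y)\<^sup>2 + k2 / 2 * (\<rho> t y)\<^sup>2"

definition W :: "real \<Rightarrow> real \<Rightarrow> real" where "W t = hconv (F t)"

lemma J: "time_interval \<infinity> = {0..}" by (auto simp: time_interval_def)

lemma init: "u 0 = u0" "\<rho> 0 = \<rho>0"
  and u_curve: "curve_cont s {0..} u" and \<rho>_curve: "curve_cont (s - 1) {0..} \<rho>"
  using sol unfolding b_family_solution_def J by auto

lemma u_sob: "t \<ge> 0 \<Longrightarrow> u t \<in> sobolev_cont s" and \<rho>_sob: "t \<ge> 0 \<Longrightarrow> \<rho> t \<in> sobolev_cont (s - 1)"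
  using u_curve \<rho>_curve by (auto simp: curve_cont_def)

lemma u_deriv: "t \<ge> 0 \<Longrightarrow> (u t has_real_derivative ux t x) (at x)"
  using sobolev_embed1(1)[OF u_sob] s by simp

lemma ux_deriv: "t \<ge> 0 \<Longrightarrow> (ux t has_real_derivative uxx t x) (at x)"
  using sobolev_embed2(1)[OF u_sob] s by simp

lemma \<rho>_deriv: "t \<ge> 0 \<Longrightarrow> (\<rho> t has_real_derivative \<rho>x t x) (at x)"
  using sobolev_embed1(1)[OF \<rho>_sob] s by simp

lemma cont:
  assumes "t \<ge> 0"
  shows "continuous_on S (u t)" "continuous_on S (ux t)" "continuous_on S (\<rho> t)"
  using DERIV_isCont[OF u_deriv[OF assms]] DERIV_isCont[OF ux_deriv[OF assms]] DERIV_isCont[OF \<rho>_deriv[OF assms]]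
  by (auto intro: continuous_at_imp_continuous_on)

lemma decay:
  assumes "t \<ge> 0"
  shows "(u t \<longlongrightarrow> 0) at_infinity" "(ux t \<longlongrightarrow> 0) at_infinity" "(\<rho> t \<longlongrightarrow> 0) at_infinity"
  using sobolev_decay[OF u_sob[OF assms]] sobolev_deriv_decay[OF u_sob[OF assms]] sobolev_decay[OF \<rho>_sob[OF assms]] s by auto

lemma pointwise_bounded:
  assumes "t \<ge> 0"
  shows "\<exists>B. \<forall>x. \<bar>u t x\<bar> \<le> B" "\<exists>B. \<forall>x. \<bar>ux t x\<bar> \<le> B" "\<exists>B. \<forall>x. \<bar>uxx t x\<bar> \<le> B"
    "\<exists>B. \<forall>x. \<bar>\<rho> t x\<bar> \<le> B" "\<exists>B. \<forall>x. \<bar>\<rho>x t x\<bar> \<le> B"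
  using sobolev_embed0[OF u_sob[OF assms]] sobolev_embed1(2)[OF u_sob[OF assms]] sobolev_embed2(2)[OF u_sob[OF assms] s]
    sobolev_embed0[OF \<rho>_sob[OF assms]] sobolev_embed1(2)[OF \<rho>_sob[OF assms]] s
  by (auto intro!: exI)

lemma unif:
  shows "unif_curve {0..} u" "unif_curve {0..} ux" "unif_curve {0..} uxx" "unif_curve {0..} \<rho>" "unif_curve {0..} \<rho>x"
  using s by (intro curve_cont_unif0[OF u_curve] curve_cont_unif1[OF u_curve] curve_cont_unif2[OF u_curve]
      curve_cont_unif0[OF \<rho>_curve] curve_cont_unif1[OF \<rho>_curve]; simp)+

lemma uniform_bound:
  assumes T: "T \<ge> 0"
  shows "\<exists>B\<ge>0. \<forall>t\<in>{0..T}. \<forall>x. \<bar>u t x\<bar> \<le> B \<and> \<bar>ux t x\<bar> \<le> B \<and> \<bar>uxx t x\<bar> \<le> B \<and> \<bar>\<rho> t x\<bar> \<le> B \<and> \<bar>\<rho>x t x\<bar> \<le> B"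
proof -
  have sub: "{0..T} \<subseteq> {0..}" by auto
  obtain B1 where B1: "B1 \<ge> 0" "\<forall>t\<in>{0..T}. \<forall>x. \<bar>u t x\<bar> \<le> B1"
    using unif_curve_bounded[OF unif_curve_subset[OF unif(1) sub] _ T] pointwise_bounded by auto
  obtain B2 where B2: "B2 \<ge> 0" "\<forall>t\<in>{0..T}. \<forall>x. \<bar>ux t x\<bar> \<le> B2"
    using unif_curve_bounded[OF unif_curve_subset[OF unif(2) sub] _ T] pointwise_bounded by auto
  obtain B3 where B3: "B3 \<ge> 0" "\<forall>t\<in>{0..T}. \<forall>x. \<bar>uxx t x\<bar> \<le> B3"
    using unif_curve_bounded[OF unif_curve_subset[OF unif(3) sub] _ T] pointwise_bounded by auto
  obtain B4 where B4: "B4 \<ge> 0" "\<forall>t\<in>{0..T}. \<forall>x. \<bar>\<rho> t x\<bar> \<le> B4"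
    using unif_curve_bounded[OF unif_curve_subset[OF unif(4) sub] _ T] pointwise_bounded by auto
  obtain B5 where B5: "B5 \<ge> 0" "\<forall>t\<in>{0..T}. \<forall>x. \<bar>\<rho>x t x\<bar> \<le> B5"
    using unif_curve_bounded[OF unif_curve_subset[OF unif(5) sub] _ T] pointwise_bounded by auto
  show ?thesis
  proof (intro exI[of _ "B1 + B2 + B3 + B4 + B5"] conjI ballI allI)
    fix t x assume t: "t \<in> {0..T}"
    have "\<bar>u t x\<bar> \<le> B1" "\<bar>ux t x\<bar> \<le> B2" "\<bar>uxx t x\<bar> \<le> B3" "\<bar>\<rho> t x\<bar> \<le> B4" "\<bar>\<rho>x t x\<bar> \<le> B5"
      using B1 B2 B3 B4 B5 t by blast+
    then show "\<bar>u t x\<bar> \<le> B1 + B2 + B3 + B4 + B5" "\<bar>ux t x\<bar> \<le> B1 + B2 + B3 + B4 + B5" "\<bar>uxx t x\<bar> \<le> B1 + B2 + B3 + B4 + B5"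
      "\<bar>\<rho> t x\<bar> \<le> B1 + B2 + B3 + B4 + B5" "\<bar>\<rho>x t x\<bar> \<le> B1 + B2 + B3 + B4 + B5"
      using B1(1) B2(1) B3(1) B4(1) B5(1) by linarith+
  qed (use B1 B2 B3 B4 B5 in simp)
qed

lemma F_props:
  assumes t: "t \<ge> 0"
  shows "integrable lborel (F t)" "continuous_on UNIV (F t)" "\<exists>B. \<forall>x. \<bar>F t x\<bar> \<le> B"
proof -
  have "integrable lborel (\<lambda>x. (u t x)\<^sup>2)" "integrable lborel (\<lambda>x. (ux t x)\<^sup>2)" "integrable lborel (\<lambda>x. (\<rho> t x)\<^sup>2)"
    using u_sob[OF t] \<rho>_sob[OF t] sobolev_embed1(4)[OF u_sob[OF t]] s by (auto simp: sobolev_cont_def sobolev_def)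
  then show "integrable lborel (F t)" unfolding F_def[abs_def] by simp
  show "continuous_on UNIV (F t)" unfolding F_def[abs_def] by (intro continuous_intros cont t)
  obtain A B C where b: "\<And>x. \<bar>u t x\<bar> \<le> A" "\<And>x. \<bar>ux t x\<bar> \<le> B" "\<And>x. \<bar>\<rho> t x\<bar> \<le> C"
    using pointwise_bounded[OF t] by metis
  have sq: "\<bar>c * y\<^sup>2\<bar> \<le> \<bar>c\<bar> * Z\<^sup>2" if "\<bar>y\<bar> \<le> Z" for c y Z :: real
    using power_mono[OF that, of 2] by (simp add: abs_mult mult_left_mono)
  have "\<bar>F t x\<bar> \<le> \<bar>k1 / 2\<bar> * A\<^sup>2 + \<bar>(3 - k1) / 2\<bar> * B\<^sup>2 + \<bar>k2 / 2\<bar> * C\<^sup>2" for x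
    unfolding F_def using sq[OF b(1), of "k1 / 2" x] sq[OF b(2), of "(3 - k1) / 2" x] sq[OF b(3), of "k2 / 2" x] by linarith
  then show "\<exists>B. \<forall>x. \<bar>F t x\<bar> \<le> B" by blast
qed

lemma W_props:
  assumes t: "t \<ge> 0"
  shows "inv_helmholtz (F t) = W t" "(W t has_real_derivative deriv (W t) x) (at x)"
    "(deriv (W t) has_real_derivative W t x - F t x) (at x)" "(W t \<longlongrightarrow> 0) at_infinity"
proof -
  obtain B where B: "\<And>x. \<bar>F t x\<bar> \<le> B" using F_props(3)[OF t] by blast
  note p = F_props(1,2)[OF t] B
  show "inv_helmholtz (F t) = W t" unfolding W_def by (rule inv_helmholtz_eq_hconv[OF p])
  show "(W t has_real_derivative deriv (W t) x) (at x)" "(deriv (W t) has_real_derivative W t x - F t x) (at x)"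
    unfolding W_def by (rule hconv_solves_helmholtz(3,4)[OF p])+
  show "(W t \<longlongrightarrow> 0) at_infinity"
    unfolding W_def by (rule sobolev_decay[OF hconv_sobolev[OF p]]) simp
qed

text \<open>
  The equation itself, its spatial derivative, and the transport equation. Since \<open>s - 1 > 3/2\<close>, the time
  derivative may be exchanged with \<open>\<partial>\<^sub>x\<close>, and \<open>\<partial>\<^sub>x\<^sup>2 W = W - F\<close> removes the highest derivative of
  the nonlocal term.
\<close>
lemma time_derivatives:
  assumes t: "t \<ge> 0"
  shows "((\<lambda>\<tau>. u \<tau> x) has_real_derivative u t x * ux t x + deriv (W t) x) (at t within {0..})"
    and "((\<lambda>\<tau>. ux \<tau> x) has_real_derivative (ux t x)\<^sup>2 + u t x * uxx t x + W t x - F t x) (at t within {0..})"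
    and "((\<lambda>\<tau>. \<rho> \<tau> x) has_real_derivative k3 * (u t x * \<rho>x t x + ux t x * \<rho> t x)) (at t within {0..})"
proof -
  obtain ut \<rho>t where c: "curve_C1 (s - 1) {0..} u ut" "curve_C1 (s - 2) {0..} \<rho> \<rho>t"
    and eq: "\<And>t x. t \<in> {0..} \<Longrightarrow> ut t x - u t x * ux t x = deriv (inv_helmholtz (F t)) x \<and>
        \<rho>t t x - k3 * u t x * \<rho>x t x = k3 * ux t x * \<rho> t x"
    using sol unfolding b_family_solution_def J F_def[abs_def] by blast
  have t': "t \<in> {0..}" using t by simp
  have ut: "ut t = (\<lambda>x. u t x * ux t x + deriv (W t) x)"
    using eq[OF t'] W_props(1)[OF t] by (auto simp: algebra_simps)
  have \<rho>t: "\<rho>t t x = k3 * (u t x * \<rho>x t x + ux t x * \<rho> t x)"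
    using eq[OF t', of x] by (auto simp: algebra_simps)
  show "((\<lambda>\<tau>. u \<tau> x) has_real_derivative u t x * ux t x + deriv (W t) x) (at t within {0..})"
    using curve_C1_time_derivative[OF c(1) _ t', of x] s unfolding ut by simp
  show "((\<lambda>\<tau>. \<rho> \<tau> x) has_real_derivative k3 * (u t x * \<rho>x t x + ux t x * \<rho> t x)) (at t within {0..})"
    using curve_C1_time_derivative[OF c(2) _ t', of x] s unfolding \<rho>t by simp
  have "deriv (ut t) x = ux t x * ux t x + uxx t x * u t x + (W t x - F t x)"
    unfolding ut by (intro DERIV_imp_deriv DERIV_add DERIV_mult u_deriv ux_deriv W_props t)
  then have "deriv (ut t) x = (ux t x)\<^sup>2 + u t x * uxx t x + W t x - F t x"
    by (simp add: power2_eq_square algebra_simps)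
  then show "((\<lambda>\<tau>. ux \<tau> x) has_real_derivative (ux t x)\<^sup>2 + u t x * uxx t x + W t x - F t x) (at t within {0..})"
    using curve_C1_time_derivative_deriv[OF c(1) _ t', of x] s by simp
qed

text \<open>
  The deviation of the solution from oddness of \<open>u\<close> and evenness of \<open>\<rho>\<close>. The derivative of the first deviation
  is carried along as a separate component, because the source depends on \<open>u\<^sub>x\<close>.
\<close>
definition defect :: "nat \<Rightarrow> real \<Rightarrow> real \<Rightarrow> real" where
  "defect i t x = (if i = 0 then u t x + u t (- x) else if i = 1 then ux t x - ux t (- x) else \<rho> t x - \<rho> t (- x))"

definition defect_rate :: "nat \<Rightarrow> real \<Rightarrow> real \<Rightarrow> real" where
  "defect_rate i t x =
    (if i = 0 then (u t x * ux t x + deriv (W t) x) + (u t (- x) * ux t (- x) + deriv (W t) (- x))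
     else if i = 1 then ((ux t x)\<^sup>2 + u t x * uxx t x + W t x - F t x) - ((ux t (- x))\<^sup>2 + u t (- x) * uxx t (- x) + W t (- x) - F t (- x))
     else k3 * (u t x * \<rho>x t x + ux t x * \<rho> t x) - k3 * (u t (- x) * \<rho>x t (- x) + ux t (- x) * \<rho> t (- x)))"

lemma reflect_deriv:
  fixes g :: "real \<Rightarrow> real"
  assumes "\<And>x. (g has_real_derivative g' x) (at x)"
  shows "((\<lambda>x. g (- x)) has_real_derivative - g' (- x)) (at x)"
proof -
  have "((\<lambda>x. - x) has_real_derivative - 1) (at x)" by (auto intro!: derivative_eq_intros)
  from DERIV_chain2[OF assms this] show ?thesis by simp
qed

text \<open>
  The odd part of \<open>W\<close> solves \<open>w - w'' = g\<close> with \<open>g\<close> the odd part of \<open>F\<close>, up to factors of two. Its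
  supremum is bounded by the maximum principle, its second derivative by the equation, and
  its first derivative by interpolation.
\<close>
lemma W_defect_bound:
  assumes t: "t \<ge> 0" and G: "\<And>x. \<bar>F t x - F t (- x)\<bar> \<le> M"
  shows "\<bar>W t x - W t (- x)\<bar> \<le> M" "\<bar>deriv (W t) x + deriv (W t) (- x)\<bar> \<le> 4 * M"
proof -
  let ?D = "\<lambda>x. W t x - W t (- x)"
  let ?D1 = "\<lambda>x. deriv (W t) x - - deriv (W t) (- x)"
  let ?D2 = "\<lambda>x. (W t x - F t x) - (- (- (W t (- x) - F t (- x))))"
  have d1: "(?D has_real_derivative ?D1 x) (at x)" for x
    by (rule DERIV_diff[OF W_props(2)[OF t] reflect_deriv[OF W_props(2)[OF t]]])
  have d2: "(?D1 has_real_derivative ?D2 x) (at x)" for x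
    by (rule DERIV_diff[OF W_props(3)[OF t] DERIV_minus[OF reflect_deriv[OF W_props(3)[OF t]]]])
  have l: "(?D \<longlongrightarrow> 0) at_infinity"
    using tendsto_diff[OF W_props(4)[OF t] tendsto_reflect_at_infinity[OF W_props(4)[OF t]]] by simp
  have M: "M \<ge> 0" using G[of 0] by simp
  have le: "W t x - W t (- x) \<le> M" for x
  proof (rule helmholtz_max_principle[where w = ?D and w' = ?D1 and w'' = ?D2, OF d1 d2 l M])
    show "?D x - ?D2 x \<le> M" for x using G[of x] by simp
  qed
  have D: "\<bar>W t x - W t (- x)\<bar> \<le> M" for x using le[of x] le[of "- x"] by simp
  then show "\<bar>W t x - W t (- x)\<bar> \<le> M" .
  have "\<bar>?D1 x\<bar> \<le> 2 * M + 2 * M"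
  proof (rule deriv_bound_interpolation[where g = ?D and g' = ?D1 and g'' = ?D2, OF d1 d2 D])
    show "\<bar>?D2 x\<bar> \<le> 2 * M" for x using G[of x] D[of x] by linarith
  qed
  then show "\<bar>deriv (W t) x + deriv (W t) (- x)\<bar> \<le> 4 * M" by simp
qed

text \<open>
  In each component the quadratic differences factor into a bounded function times a deviation. What does not
  is a bounded function times the spatial derivative of the component itself, which vanishes where its
  modulus is maximal.
\<close>
lemma symmetry:
  assumes odd: "\<And>x. u0 (- x) = - u0 x" and even: "\<And>x. \<rho>0 (- x) = \<rho>0 x" and t: "t \<ge> 0"
  shows "u t (- x) = - u t x" "\<rho> t (- x) = \<rho> t x"
proof -
  obtain B where B0: "B \<ge> 0"
    and B: "\<And>r x. r \<in> {0..t} \<Longrightarrow> \<bar>u r x\<bar> \<le> B" "\<And>r x. r \<in> {0..t} \<Longrightarrow> \<bar>ux r x\<bar> \<le> B"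
    "\<And>r x. r \<in> {0..t} \<Longrightarrow> \<bar>uxx r x\<bar> \<le> B" "\<And>r x. r \<in> {0..t} \<Longrightarrow> \<bar>\<rho> r x\<bar> \<le> B" "\<And>r x. r \<in> {0..t} \<Longrightarrow> \<bar>\<rho>x r x\<bar> \<le> B"
    using uniform_bound[OF t] by blast
  define M where "M = (\<bar>k1\<bar> + \<bar>3 - k1\<bar> + \<bar>k2\<bar>) * B"
  have M0: "M \<ge> 0" unfolding M_def using B0 by (intro mult_nonneg_nonneg) auto
  define C where "C = 3 * B + 4 * M + \<bar>k3\<bar> * (3 * B)"
  have zero: "defect i t x = 0" if i: "i \<in> {0, 1, 2}" for i x
  proof (rule barrier_zero[where f = defect and D = defect_rate and I = "{0, 1, 2}" and T = t and C = C])
    have ux0: "deriv u0 (- x) = deriv u0 x" for x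
    proof -
      have d: "(u0 has_real_derivative deriv u0 x) (at x)" for x using u_deriv[of 0 x] init by simp
      have "((\<lambda>x. u0 (- x)) has_real_derivative - deriv u0 (- x)) (at x)" by (rule reflect_deriv[OF d])
      moreover have "((\<lambda>x. u0 (- x)) has_real_derivative - deriv u0 x) (at x)"
        unfolding odd by (intro DERIV_minus d)
      ultimately show ?thesis using DERIV_unique by fastforce
    qed
    show "defect i 0 x = 0" for i x using odd even ux0 by (simp add: defect_def init)
    show "continuous_on UNIV (defect i r)" if "r \<in> {0..t}" for i r
    proof -
      have r: "r \<ge> 0" using that by simp
      have m: "continuous_on UNIV (\<lambda>x. g (- x))" if "continuous_on UNIV g" for g :: "real \<Rightarrow> real"
        by (intro continuous_on_compose2[OF that] continuous_intros) auto
      consider "i = 0" | "i = 1" | "i \<noteq> 0" "i \<noteq> 1" by blast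
      then show ?thesis
        by cases (auto simp: defect_def[abs_def] intro!: continuous_on_add continuous_on_diff cont[OF r] m)
    qed
    show "(defect i r \<longlongrightarrow> 0) at_infinity" if "r \<in> {0..t}" for i r
    proof -
      have r: "r \<ge> 0" using that by simp
      consider "i = 0" | "i = 1" | "i \<noteq> 0" "i \<noteq> 1" by blast
      then show ?thesis
        using tendsto_add[OF decay(1)[OF r] tendsto_reflect_at_infinity[OF decay(1)[OF r]]]
          tendsto_diff[OF decay(2)[OF r] tendsto_reflect_at_infinity[OF decay(2)[OF r]]]
          tendsto_diff[OF decay(3)[OF r] tendsto_reflect_at_infinity[OF decay(3)[OF r]]]
        by cases (simp_all add: defect_def[abs_def])
    qed
    show "unif_curve {0..t} (defect i)" for i
    proof -
      have sub: "{0..t} \<subseteq> {0..}" by auto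
      consider "i = 0" | "i = 1" | "i \<noteq> 0" "i \<noteq> 1" by blast
      then show ?thesis
        using unif_curve_reflect[OF unif_curve_subset[OF unif(1) sub], of 1]
          unif_curve_reflect[OF unif_curve_subset[OF unif(2) sub], of "-1"]
          unif_curve_reflect[OF unif_curve_subset[OF unif(4) sub], of "-1"]
        by cases (simp_all add: defect_def[abs_def])
    qed
    show "((\<lambda>r. defect i r x) has_real_derivative defect_rate i r x) (at r within {0..t})" if "r \<in> {0..t}" for i r x
    proof -
      have r: "r \<ge> 0" using that by simp
      have "((\<lambda>r. defect i r x) has_real_derivative defect_rate i r x) (at r within {0..})"
      proof -
        consider "i = 0" | "i = 1" | "i \<noteq> 0" "i \<noteq> 1" by blast
        then show ?thesis
          using DERIV_add[OF time_derivatives(1)[OF r, of x] time_derivatives(1)[OF r, of "- x"]]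
            DERIV_diff[OF time_derivatives(2)[OF r, of x] time_derivatives(2)[OF r, of "- x"]]
            DERIV_diff[OF time_derivatives(3)[OF r, of x] time_derivatives(3)[OF r, of "- x"]]
          by cases (simp_all only: defect_def defect_rate_def if_True if_False refl one_neq_zero)
      qed
      then show ?thesis by (rule DERIV_subset) auto
    qed
    show "\<bar>defect_rate i r x\<bar> \<le> C * N"
      if r: "r \<in> {0..t}" and N: "\<And>j y. j \<in> {0, 1, 2} \<Longrightarrow> \<bar>defect j r y\<bar> \<le> N" and eq: "\<bar>defect i r x\<bar> = N" for i r x N
    proof -
      have r0: "r \<ge> 0" using r by simp
      note b = B[OF r]
      have v: "\<bar>u r y + u r (- y)\<bar> \<le> N" for y using N[of 0 y] by (simp add: defect_def)
      have w: "\<bar>ux r y - ux r (- y)\<bar> \<le> N" for y using N[of 1 y] by (simp add: defect_def)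
      have z: "\<bar>\<rho> r y - \<rho> r (- y)\<bar> \<le> N" for y using N[of 2 y] by (simp add: defect_def)
      have N0: "N \<ge> 0" using v[of 0] by linarith
      have G: "\<bar>F r y - F r (- y)\<bar> \<le> M * N" for y
      proof -
        have e: "F r y - F r (- y) = k1 / 2 * ((u r y - u r (- y)) * (u r y + u r (- y)))
            + (3 - k1) / 2 * ((ux r y + ux r (- y)) * (ux r y - ux r (- y)))
            + k2 / 2 * ((\<rho> r y + \<rho> r (- y)) * (\<rho> r y - \<rho> r (- y)))"
          by (simp add: F_def power2_eq_square algebra_simps)
        have b2: "\<bar>u r y - u r (- y)\<bar> \<le> 2 * B" "\<bar>ux r y + ux r (- y)\<bar> \<le> 2 * B" "\<bar>\<rho> r y + \<rho> r (- y)\<bar> \<le> 2 * B"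
          using b(1)[of y] b(1)[of "- y"] b(2)[of y] b(2)[of "- y"] b(4)[of y] b(4)[of "- y"] by linarith+
        have "\<bar>k1 / 2 * ((u r y - u r (- y)) * (u r y + u r (- y)))\<bar> \<le> \<bar>k1 / 2\<bar> * (2 * B * N)"
          "\<bar>(3 - k1) / 2 * ((ux r y + ux r (- y)) * (ux r y - ux r (- y)))\<bar> \<le> \<bar>(3 - k1) / 2\<bar> * (2 * B * N)"
          "\<bar>k2 / 2 * ((\<rho> r y + \<rho> r (- y)) * (\<rho> r y - \<rho> r (- y)))\<bar> \<le> \<bar>k2 / 2\<bar> * (2 * B * N)"
          by (intro abs_mult_le order_refl b2 v w z)+
        then have "\<bar>F r y - F r (- y)\<bar> \<le> \<bar>k1 / 2\<bar> * (2 * B * N) + \<bar>(3 - k1) / 2\<bar> * (2 * B * N) + \<bar>k2 / 2\<bar> * (2 * B * N)"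
          unfolding e by linarith
        also have "\<dots> = M * N" by (simp add: M_def algebra_simps)
        finally show ?thesis .
      qed
      note W1 = W_defect_bound(1)[OF r0 G] and W2 = W_defect_bound(2)[OF r0 G]
      have CN: "C * N = 3 * (B * N) + 4 * (M * N) + \<bar>k3\<bar> * (3 * (B * N))" by (simp add: C_def algebra_simps)
      have nn: "B * N \<ge> 0" "M * N \<ge> 0" "\<bar>k3\<bar> * (3 * (B * N)) \<ge> 0" using B0 N0 M0 by auto
      consider "i = 0" | "i = 1" | "i \<noteq> 0" "i \<noteq> 1" by blast
      then show ?thesis
      proof cases
        case 1
        have e: "defect_rate i r x = u r x * (ux r x - ux r (- x)) + ux r (- x) * (u r x + u r (- x)) + (deriv (W r) x + deriv (W r) (- x))"
          using 1 by (simp add: defect_rate_def algebra_simps)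
        have "\<bar>u r x * (ux r x - ux r (- x))\<bar> \<le> B * N" "\<bar>ux r (- x) * (u r x + u r (- x))\<bar> \<le> B * N"
          by (intro abs_mult_le b v w)+
        then show ?thesis unfolding e CN using W2[of x] nn by linarith
      next
        case 2
        have "uxx r x - - uxx r (- x) = 0"
        proof (rule deriv_zero_at_abs_max)
          show "((\<lambda>x. ux r x - ux r (- x)) has_real_derivative uxx r x - - uxx r (- x)) (at x)"
            by (rule DERIV_diff[OF ux_deriv[OF r0] reflect_deriv[OF ux_deriv[OF r0]]])
          show "\<bar>ux r x - ux r (- x)\<bar> = N" using eq 2 by (simp add: defect_def)
        qed (rule w)
        \<comment> \<open>Where the deviation of \<open>u\<^sub>x\<close> is extremal, this relation turns \<open>u u\<^sub>x\<^sub>x\<close> at \<open>x\<close> minus its value at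
           \<open>- x\<close> into \<open>u\<^sub>x\<^sub>x\<close> times the deviation of \<open>u\<close>.\<close>
        then have m: "uxx r (- x) = - uxx r x" by simp
        have e: "defect_rate i r x = (ux r x + ux r (- x)) * (ux r x - ux r (- x)) + uxx r x * (u r x + u r (- x))
            + (W r x - W r (- x)) - (F r x - F r (- x))"
          using 2 by (simp add: defect_rate_def m power2_eq_square algebra_simps)
        have "\<bar>ux r x + ux r (- x)\<bar> \<le> 2 * B" using b(2)[of x] b(2)[of "- x"] by linarith
        then have "\<bar>(ux r x + ux r (- x)) * (ux r x - ux r (- x))\<bar> \<le> 2 * B * N" "\<bar>uxx r x * (u r x + u r (- x))\<bar> \<le> B * N"
          by (intro abs_mult_le b v w; assumption)+
        then show ?thesis unfolding e CN using W1[of x] G[of x] nn by linarith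
      next
        case 3
        have "\<rho>x r x - - \<rho>x r (- x) = 0"
        proof (rule deriv_zero_at_abs_max)
          show "((\<lambda>x. \<rho> r x - \<rho> r (- x)) has_real_derivative \<rho>x r x - - \<rho>x r (- x)) (at x)"
            by (rule DERIV_diff[OF \<rho>_deriv[OF r0] reflect_deriv[OF \<rho>_deriv[OF r0]]])
          show "\<bar>\<rho> r x - \<rho> r (- x)\<bar> = N" using eq 3 by (simp add: defect_def)
        qed (rule z)
        then have m: "\<rho>x r (- x) = - \<rho>x r x" by simp
        have e: "defect_rate i r x = k3 * (\<rho>x r x * (u r x + u r (- x)) + ux r x * (\<rho> r x - \<rho> r (- x)) + \<rho> r (- x) * (ux r x - ux r (- x)))"
          using 3 by (simp add: defect_rate_def m algebra_simps)
        have "\<bar>\<rho>x r x * (u r x + u r (- x))\<bar> \<le> B * N" "\<bar>ux r x * (\<rho> r x - \<rho> r (- x))\<bar> \<le> B * N" "\<bar>\<rho> r (- x) * (ux r x - ux r (- x))\<bar> \<le> B * N"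
          by (intro abs_mult_le b v w z)+
        then have "\<bar>\<rho>x r x * (u r x + u r (- x)) + ux r x * (\<rho> r x - \<rho> r (- x)) + \<rho> r (- x) * (ux r x - ux r (- x))\<bar> \<le> 3 * (B * N)"
          by linarith
        then have "\<bar>defect_rate i r x\<bar> \<le> \<bar>k3\<bar> * (3 * (B * N))" unfolding e by (intro abs_mult_le order_refl)
        then show ?thesis unfolding CN using nn by linarith
      qed
    qed
  qed (use t i in auto)
  show "u t (- x) = - u t x" using zero[of 0 x] by (simp add: defect_def)
  show "\<rho> t (- x) = \<rho> t x" using zero[of 2 x] by (simp add: defect_def)
qed

text \<open>
  Where \<open>u\<close> vanishes, the transport equation reduces to \<open>\<rho>\<^sub>t = k3 u\<^sub>x \<rho>\<close>.
\<close>
lemma density_stays_zero: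
  assumes u: "\<And>t. t \<ge> 0 \<Longrightarrow> u t 0 = 0" and z: "\<rho>0 0 = 0" and T: "T \<ge> 0"
  shows "\<rho> T 0 = 0"
proof -
  obtain B where B: "\<And>t x. t \<in> {0..T} \<Longrightarrow> \<bar>ux t x\<bar> \<le> B" using uniform_bound[OF T] by metis
  show ?thesis
  proof (rule linear_ode_zero[where y = "\<lambda>t. \<rho> t 0" and c = "\<lambda>t. k3 * ux t 0" and K = "\<bar>k3\<bar> * B"])
    show "((\<lambda>t. \<rho> t 0) has_real_derivative k3 * ux t 0 * \<rho> t 0) (at t within {0..T})" if t: "t \<in> {0..T}" for t
    proof -
      have "((\<lambda>t. \<rho> t 0) has_real_derivative k3 * ux t 0 * \<rho> t 0) (at t within {0..})"
        using time_derivatives(3)[of t 0] u[of t] t by (simp add: mult.assoc)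
      then show ?thesis by (rule DERIV_subset) auto
    qed
    show "k3 * ux t 0 \<le> \<bar>k3\<bar> * B" if t: "t \<in> {0..T}" for t
      using abs_mult_le[OF order_refl B[OF t], of k3 0] by linarith
  qed (use z T init in auto)
qed

lemma initial_source_positive:
  assumes k: "0 < k1" "k1 \<le> 3" "0 < k2" and nontrivial: "\<not> (\<forall>x. u0 x = 0 \<and> \<rho>0 x = 0)"
  shows "W 0 x > 0"
proof -
  obtain y where y: "u0 y \<noteq> 0 \<or> \<rho>0 y \<noteq> 0" using nontrivial by blast
  show ?thesis
    unfolding W_def
  proof (rule hconv_pos[OF F_props(1,2)])
    show "F 0 z \<ge> 0" for z unfolding F_def using k by simp
    have "0 < k1 / 2 * (u 0 y)\<^sup>2 + k2 / 2 * (\<rho> 0 y)\<^sup>2"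
      using y
    proof
      assume "u0 y \<noteq> 0"
      then show ?thesis using k by (intro add_pos_nonneg) (auto simp: init)
    next
      assume "\<rho>0 y \<noteq> 0"
      then show ?thesis using k by (intro add_nonneg_pos) (auto simp: init)
    qed
    moreover have "0 \<le> (3 - k1) / 2 * (ux 0 y)\<^sup>2" using k by simp
    ultimately show "F 0 y > 0" unfolding F_def by linarith
  qed simp_all
qed

text \<open>
  The slope at the origin satisfies \<open>a' = (k1 - 1)/2 a\<^sup>2 + W(t,0)\<close>.
\<close>
lemma no_global_symmetric_solution:
  assumes k: "1 < k1" "k1 \<le> 3" "0 < k2" and nontrivial: "\<not> (\<forall>x. u0 x = 0 \<and> \<rho>0 x = 0)"
    and odd: "\<And>x. u0 (- x) = - u0 x" and even: "\<And>x. \<rho>0 (- x) = \<rho>0 x" and z: "\<rho>0 0 = 0"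
    and slope: "deriv u0 0 \<ge> 0"
  shows False
proof (rule riccati_no_global_solution)
  have u0: "u t 0 = 0" if "t \<ge> 0" for t using symmetry(1)[OF odd even that, of 0] by simp
  have \<rho>0: "\<rho> t 0 = 0" if "t \<ge> 0" for t by (rule density_stays_zero[OF u0 z that])
  show "((\<lambda>t. ux t 0) has_real_derivative (k1 - 1) / 2 * (ux t 0)\<^sup>2 + W t 0) (at t within {0..})" if t: "t \<ge> 0" for t
  proof -
    have "(ux t 0)\<^sup>2 + u t 0 * uxx t 0 + W t 0 - F t 0 = (k1 - 1) / 2 * (ux t 0)\<^sup>2 + W t 0"
      unfolding F_def u0[OF t] \<rho>0[OF t] by (simp add: field_simps)
    then show ?thesis using time_derivatives(2)[OF t, of 0] by (simp only:)
  qed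
  show "(k1 - 1) / 2 > 0" using k by simp
  show "W t 0 \<ge> 0" for t
    unfolding W_def using k by (intro hconv_nonneg) (simp add: F_def)
  show "W 0 0 > 0" by (rule initial_source_positive[OF _ _ _ nontrivial]) (use k in simp_all)
  show "ux 0 0 \<ge> 0" using slope by (simp add: init)
qed

end

theorem corollary4p1:
  fixes b k1 k2 k3 s :: real
    and u0 \<rho>0 :: "real \<Rightarrow> real"
    and u \<rho> :: "real \<Rightarrow> real \<Rightarrow> real"
    and T :: ereal
  assumes coeffs: "(k1 = b \<and> k2 = 2 * b \<and> k3 = 1) \<or> (k1 = b + 1 \<and> k2 = 2 \<and> k3 = b)"
    and s: "s > 5 / 2"
    and u0: "u0 \<in> sobolev_cont s"
    and \<rho>0: "\<rho>0 \<in> sobolev_cont (s - 1)"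
    and nontrivial: "\<not> (\<forall>x. u0 x = 0 \<and> \<rho>0 x = 0)"
    and maximal: "b_family_maximal_solution k1 k2 k3 s u0 \<rho>0 T u \<rho>"
    and k1: "1 < k1" "k1 \<le> 3"
    and k2: "k2 \<ge> 0"
    and m0_odd: "\<forall>x. helmholtz u0 (- x) = - helmholtz u0 x"
    and \<rho>0_even: "\<forall>x. \<rho>0 (- x) = \<rho>0 x"
    and \<rho>0_zero: "\<rho>0 0 = 0"
    and m0_integral: "(LBINT y:{0..}. exp (- y) * helmholtz u0 y) \<ge> 0"
  shows "T < \<infinity>"
proof (rule ccontr)
  assume "\<not> T < \<infinity>"
  then have "T = \<infinity>" by simp
  then have "b_family_solution k1 k2 k3 s u0 \<rho>0 \<infinity> u \<rho>"
    using maximal by (simp add: b_family_maximal_solution_def)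
  then interpret global_b_family k1 k2 k3 s u0 \<rho>0 u \<rho>
    using s by unfold_locales
  have odd: "u0 (- x) = - u0 x" for x
    using helmholtz_odd_imp_odd[OF u0 s] m0_odd by blast
  have "deriv u0 0 \<ge> 0"
    using m0_integral odd[of 0] unfolding helmholtz_laplace_at_0[OF u0 s] by simp
  moreover have "k2 > 0" using coeffs k1 by auto
  ultimately show False
    using no_global_symmetric_solution[OF k1 _ nontrivial odd _ \<rho>0_zero] \<rho>0_even by blast
qed

end
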